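(* Let $\Bbbk$ be an $F$-finite field of characteristic $p>0$, let $L$ be a (two-sided) ladder with $v$ lower-outside corners, let $\mathbf{t}=(t_1,\ldots,t_v)\in\mathbb{Z}_{>0}^v$, and let $I_{\mathbf t}(L)\subseteq R=\Bbbk[L]$ be the corresponding mixed ladder determinantal ideal. Then $I_{\mathbf t}(L)$ is symbolic $F$-split.
   Context: Ladders. Let $X=(x_{i,j})$ be a $k\times\ell$ matrix of distinct indeterminates. A subset $L\subseteq X$ is a (two-sided) ladder if whenever $x_{i,j},x_{i',j'}\in L$ with $i\le i'$ and $j\ge j'$, then $x_{u,w}\in L$ for all $i\le u\le i'$, $j'\le w\le j$. (An entry with indices out of range is regarded as not in $L$.) The upper-outside corners of $L$ are the elements $x_{b_1,a_1},\ldots,x_{b_u,a_u}\in L$, with $1=b_1<\cdots<b_u$ and $a_1<\cdots<a_u=\ell$, defined by $x_{b_h-1,a_h}\notin L$ and $x_{b_h,a_h+1}\notin L$. The lower-outside corners $x_{d_1,c_1},\ldots,x_{d_v,c_v}\in L$, with $d_1\le\cdots\le d_v=k$ and $1=c_1\le\cdots\le c_v$, are part of the data of the ladder: they include all $x_{i,j}\in L$ with $x_{i+1,j}\notin L$ and $x_{i,j-1}\notin L$, and each of them satisfies $x_{d_h+1,c_h}\notin L$ or $x_{d_h,c_h-1}\notin L$. All corners are assumed distinct. For $j=1,\ldots,v$ set $L_j=\{x_{b,a}\in L\mid 1\le b\le d_j,\ c_j\le a\le \ell\}$. Ideals. $\Bbbk[L]$ is the (standard graded) polynomial ring over $\Bbbk$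 in the entries of $L$. For a positive integer $t$ and a subladder $L'\subseteq L$, $I_t(L')$ is the ideal of $\Bbbk[L]$ generated by the $t$-minors of $X$ all of whose entries lie in $L'$. The mixed ladder determinantal ideal is $I_{\mathbf t}(L)=I_{t_1}(L_1)+\cdots+I_{t_v}(L_v)$; it is prime. Standing assumptions: (1) every entry of $L$ is involved in some of the generating minors of $I_{\mathbf t}(L)$; (2) no two consecutive corners coincide, and no two upper-outside corners belong to the same row or the same column; (3) $I_{t_i}(L_i)\not\subseteq I_{t_j}(L_j)$ for all $i\ne j$; (4) no proper submatrix of $X$ contains $L$. Symbolic $F$-split: let $R$ be a standard graded polynomial ring over an $F$-finite field of characteristic $p>0$. A homogeneous ideal $I\subseteq R$ is symbolic $F$-split if there exists a splitting $\phi:R^{1/p}\to R$ (an $R$-linear map restricting to the identity on $R\subseteq R^{1/p}$) such that $\phi\left((I^{(np+1)})^{1/p}\right)\subseteq I^{(n+1)}$ for every $n\in\mathbb{N}=\{0,1,2,\ldots\}$, where $I^{(m)}$ is the $m$-th symbolic power. *)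

theory Defs
  imports
    "HOL-Library.Poly_Mapping"
    "HOL-Computational_Algebra.Primes"
    "HOL-Algebra.Ideal_Product"
    "Jordan_Normal_Form.Determinant"
begin

section \<open>Polynomial rings\<close>

type_synonym ('v, 'k) mpoly = "('v \<Rightarrow>\<^sub>0 nat) \<Rightarrow>\<^sub>0 'k"

definition poly_ring :: "'v set \<Rightarrow> ('v, 'k::field) mpoly ring" where
  "poly_ring V = \<lparr>carrier = {f. \<forall>m \<in> Poly_Mapping.keys f. Poly_Mapping.keys m \<subseteq> V},
     monoid.mult = (*), one = 1, zero = 0, add = (+)\<rparr>"

definition mvar :: "'v \<Rightarrow> ('v, 'k::field) mpoly" where
  "mvar x = Poly_Mapping.single (Poly_Mapping.single x 1) 1"

definition monom_degree :: "('v \<Rightarrow>\<^sub>0 nat) \<Rightarrow> nat" where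
  "monom_degree m = (\<Sum>x \<in> Poly_Mapping.keys m. Poly_Mapping.lookup m x)"

definition homogeneous :: "('v, 'k::field) mpoly \<Rightarrow> bool" where
  "homogeneous f \<longleftrightarrow> (\<exists>e. \<forall>m \<in> Poly_Mapping.keys f. monom_degree m = e)"

definition homogeneous_ideal :: "'v set \<Rightarrow> ('v, 'k::field) mpoly set \<Rightarrow> bool" where
  "homogeneous_ideal V I \<longleftrightarrow>
     ideal I (poly_ring V) \<and> I = Idl\<^bsub>poly_ring V\<^esub> {f \<in> I. homogeneous f}"

lemma poly_ring_simps [simp]:
  "carrier (poly_ring V) = {f. \<forall>m \<in> Poly_Mapping.keys f. Poly_Mapping.keys m \<subseteq> V}"
  "f \<otimes>\<^bsub>poly_ring V\<^esub> g = f * g" "f \<oplus>\<^bsub>poly_ring V\<^esub> g = f + g"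
  "\<one>\<^bsub>poly_ring V\<^esub> = 1" "\<zero>\<^bsub>poly_ring V\<^esub> = 0"
  by (simp_all add: poly_ring_def)

lemma poly_ring_mult_closed:
  fixes f g :: "('v, 'k::field) mpoly"
  assumes "f \<in> carrier (poly_ring V)" "g \<in> carrier (poly_ring V)"
  shows "f * g \<in> carrier (poly_ring V)"
proof -
  have "Poly_Mapping.keys m \<subseteq> V" if "m \<in> Poly_Mapping.keys (f * g)" for m
  proof -
    obtain a b where "m = a + b" "a \<in> Poly_Mapping.keys f" "b \<in> Poly_Mapping.keys g"
      using \<open>m \<in> Poly_Mapping.keys (f * g)\<close> keys_mult[of f g] by blast
    then show ?thesis
      using assms keys_add[of a b] by fastforce
  qed
  then show ?thesis by simp
qed

lemma cring_poly_ring: "cring (poly_ring V :: ('v, 'k::field) mpoly ring)"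
proof (rule cringI)
  show "abelian_group (poly_ring V :: ('v, 'k) mpoly ring)"
  proof (rule abelian_groupI)
    fix f g :: "('v, 'k) mpoly"
    assume "f \<in> carrier (poly_ring V)" "g \<in> carrier (poly_ring V)"
    then show "f \<oplus>\<^bsub>poly_ring V\<^esub> g \<in> carrier (poly_ring V)"
      using keys_add[of f g] by fastforce
  next
    fix f :: "('v, 'k) mpoly"
    assume "f \<in> carrier (poly_ring V)"
    then show "\<exists>g \<in> carrier (poly_ring V). g \<oplus>\<^bsub>poly_ring V\<^esub> f = \<zero>\<^bsub>poly_ring V\<^esub>"
      by (intro bexI[of _ "- f"]) auto
  qed (auto simp: ac_simps)
  show "Group.comm_monoid (poly_ring V :: ('v, 'k) mpoly ring)"
  proof (rule Group.comm_monoidI)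
    fix f g :: "('v, 'k) mpoly"
    assume "f \<in> carrier (poly_ring V)" "g \<in> carrier (poly_ring V)"
    then show "f \<otimes>\<^bsub>poly_ring V\<^esub> g \<in> carrier (poly_ring V)"
      using poly_ring_mult_closed[of f V g] unfolding poly_ring_simps(2) by blast
  next
    show "\<one>\<^bsub>poly_ring V\<^esub> \<in> carrier (poly_ring V :: ('v, 'k) mpoly ring)"
      by simp
  qed (simp_all add: mult.assoc mult.commute)
qed (simp add: distrib_right)

lemma poly_ring_pow [simp]: "f [^]\<^bsub>poly_ring V\<^esub> (n::nat) = f ^ n"
  by (induction n) (auto simp: nat_pow_def mult.commute)


section \<open>Symbolic powers\<close>

definition minimal_primes :: "('a, 'b) ring_scheme \<Rightarrow> 'a set \<Rightarrow> 'a set set" where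
  "minimal_primes R I = {P. primeideal P R \<and> I \<subseteq> P \<and>
     (\<forall>Q. primeideal Q R \<longrightarrow> I \<subseteq> Q \<longrightarrow> Q \<subseteq> P \<longrightarrow> Q = P)}"

text \<open>The contraction to \<open>R\<close> of the extension of \<open>I^m\<close> to the localization of \<open>R\<close> at
  the complement of the union of the minimal primes of \<open>I\<close>. For prime \<open>I\<close>, that complement is
  \<open>R - I\<close>, and taking associated primes instead gives the same ideal.\<close>

definition symbolic_power :: "('a, 'b) ring_scheme \<Rightarrow> 'a set \<Rightarrow> nat \<Rightarrow> 'a set" where
  "symbolic_power R I m = {f \<in> carrier R.
     \<exists>s \<in> carrier R - \<Union>(minimal_primes R I). s \<otimes>\<^bsub>R\<^esub> f \<in> I [^]\<^bsub>ideals_set R\<^esub> m}"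


section \<open>The ring of \<open>p\<close>-th roots and symbolic F-split ideals\<close>

text \<open>\<open>PRoot f\<close> is the formal symbol for the \<open>p\<close>-th root of \<open>f\<close>. In characteristic \<open>p\<close>, sums and
  products of \<open>p\<close>-th roots are computed on the radicands, and \<open>r\<close> is identified with the
  \<open>p\<close>-th root of its \<open>p\<close>-th power. For a polynomial ring, the lemmas below show that this is
  a ring containing \<open>R\<close>, each of whose elements \<open>PRoot f\<close> has \<open>p\<close>-th power \<open>f\<close>.\<close>

datatype 'a proot = PRoot (radicand: 'a)

definition root_ring :: "('a, 'b) ring_scheme \<Rightarrow> 'a proot ring" where
  "root_ring R = \<lparr>carrier = PRoot ` carrier R,
     monoid.mult = (\<lambda>x y. PRoot (radicand x \<otimes>\<^bsub>R\<^esub> radicand y)), one = PRoot \<one>\<^bsub>R\<^esub>,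
     zero = PRoot \<zero>\<^bsub>R\<^esub>, add = (\<lambda>x y. PRoot (radicand x \<oplus>\<^bsub>R\<^esub> radicand y))\<rparr>"

definition root_incl :: "nat \<Rightarrow> ('a, 'b) ring_scheme \<Rightarrow> 'a \<Rightarrow> 'a proot" where
  "root_incl p R r = PRoot (r [^]\<^bsub>R\<^esub> p)"

definition root_splitting :: "nat \<Rightarrow> ('a, 'b) ring_scheme \<Rightarrow> ('a proot \<Rightarrow> 'a) \<Rightarrow> bool" where
  "root_splitting p R \<phi> \<longleftrightarrow>
     \<phi> \<in> hom (add_monoid (root_ring R)) (add_monoid R) \<and>
     (\<forall>r \<in> carrier R. \<forall>x \<in> carrier (root_ring R).
        \<phi> (root_incl p R r \<otimes>\<^bsub>root_ring R\<^esub> x) = r \<otimes>\<^bsub>R\<^esub> \<phi> x) \<and>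
     (\<forall>r \<in> carrier R. \<phi> (root_incl p R r) = r)"

definition symbolic_F_split :: "'v set \<Rightarrow> ('v, 'k::field) mpoly set \<Rightarrow> bool" where
  "symbolic_F_split V I \<longleftrightarrow>
     homogeneous_ideal V I \<and>
     (\<exists>\<phi>. root_splitting CHAR('k) (poly_ring V) \<phi> \<and>
        (\<forall>n. \<phi> ` (PRoot ` symbolic_power (poly_ring V) I (n * CHAR('k) + 1))
              \<subseteq> symbolic_power (poly_ring V) I (n + 1)))"

definition F_finite :: "'k::field itself \<Rightarrow> bool" where
  "F_finite _ \<longleftrightarrow> (\<exists>B :: 'k set. finite B \<and>
     (\<forall>x. \<exists>c. x = (\<Sum>b \<in> B. c b ^ CHAR('k) * b)))"

lemma root_ring_simps [simp]:
  "carrier (root_ring R) = PRoot ` carrier R"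
  "PRoot f \<otimes>\<^bsub>root_ring R\<^esub> PRoot g = PRoot (f \<otimes>\<^bsub>R\<^esub> g)"
  "PRoot f \<oplus>\<^bsub>root_ring R\<^esub> PRoot g = PRoot (f \<oplus>\<^bsub>R\<^esub> g)"
  "\<one>\<^bsub>root_ring R\<^esub> = PRoot \<one>\<^bsub>R\<^esub>" "\<zero>\<^bsub>root_ring R\<^esub> = PRoot \<zero>\<^bsub>R\<^esub>"
  by (simp_all add: root_ring_def)

lemma cring_root_ring:
  assumes "cring R"
  shows "cring (root_ring R)"
proof -
  interpret cring R by fact
  show ?thesis
  proof (rule cringI)
    show "abelian_group (root_ring R)"
    proof (rule abelian_groupI)
      fix x assume "x \<in> carrier (root_ring R)"
      then obtain f where "x = PRoot f" "f \<in> carrier R" by auto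
      then show "\<exists>y \<in> carrier (root_ring R). y \<oplus>\<^bsub>root_ring R\<^esub> x = \<zero>\<^bsub>root_ring R\<^esub>"
        by (intro bexI[of _ "PRoot (\<ominus>\<^bsub>R\<^esub> f)"]) (auto simp: l_neg)
    qed (auto simp: a_ac)
    show "Group.comm_monoid (root_ring R)"
      by (rule Group.comm_monoidI) (auto simp: m_ac)
  qed (auto simp: l_distr)
qed

lemma CHAR_mpoly: "CHAR(('v, 'k::field) mpoly) = CHAR('k)"
proof -
  have "of_nat n = (0 :: ('v, 'k) mpoly) \<longleftrightarrow> of_nat n = (0 :: 'k)" for n
  proof -
    have of_nat: "(of_nat n :: ('v, 'k) mpoly) = Poly_Mapping.single (0 :: 'v \<Rightarrow>\<^sub>0 nat) (of_nat n)"
      by (induction n) (auto simp: single_add)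
    have inj: "Poly_Mapping.single (0 :: 'v \<Rightarrow>\<^sub>0 nat) x = 0 \<longleftrightarrow> x = 0" for x :: 'k
      by (metis lookup_single_eq lookup_zero single_zero)
    show ?thesis unfolding of_nat inj ..
  qed
  then show ?thesis by (simp add: semiring_char_def)
qed

lemma root_incl_ring_hom:
  assumes "CHAR('k::field) > 0"
  shows "root_incl CHAR('k) (poly_ring V :: ('v, 'k) mpoly ring)
           \<in> Ring.ring_hom (poly_ring V) (root_ring (poly_ring V))"
proof -
  have prime: "prime CHAR(('v, 'k) mpoly)"
    using assms by (simp add: CHAR_mpoly prime_CHAR_semidom)
  have closed: "f ^ n \<in> carrier (poly_ring V)"
    if "f \<in> carrier (poly_ring V)" for f :: "('v, 'k) mpoly" and n
  proof -
    interpret cring "poly_ring V :: ('v, 'k) mpoly ring" by (rule cring_poly_ring)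
    show ?thesis using nat_pow_closed[OF that, of n] by (simp only: poly_ring_pow)
  qed
  have add: "(f + g) ^ CHAR('k) = f ^ CHAR('k) + g ^ CHAR('k)" for f g :: "('v, 'k) mpoly"
    by (metis CHAR_mpoly freshmans_dream prime)
  show ?thesis
  proof (rule ring_hom_memI)
    fix f :: "('v, 'k) mpoly"
    assume "f \<in> carrier (poly_ring V)"
    then show "root_incl CHAR('k) (poly_ring V) f \<in> carrier (root_ring (poly_ring V))"
      using closed unfolding root_incl_def poly_ring_pow root_ring_simps(1) by blast
  next
    fix f g :: "('v, 'k) mpoly"
    show "root_incl CHAR('k) (poly_ring V) (f \<otimes>\<^bsub>poly_ring V\<^esub> g)
        = root_incl CHAR('k) (poly_ring V) f \<otimes>\<^bsub>root_ring (poly_ring V)\<^esub>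
          root_incl CHAR('k) (poly_ring V) g"
      by (simp add: root_incl_def power_mult_distrib)
    show "root_incl CHAR('k) (poly_ring V) (f \<oplus>\<^bsub>poly_ring V\<^esub> g)
        = root_incl CHAR('k) (poly_ring V) f \<oplus>\<^bsub>root_ring (poly_ring V)\<^esub>
          root_incl CHAR('k) (poly_ring V) g"
      by (simp add: root_incl_def add)
    show "root_incl CHAR('k) (poly_ring V) \<one>\<^bsub>poly_ring V\<^esub> = \<one>\<^bsub>root_ring (poly_ring V)\<^esub>"
      by (simp add: root_incl_def)
  qed
qed

lemma root_incl_inj:
  assumes "CHAR('k::field) > 0"
  shows "inj (root_incl CHAR('k) (poly_ring V :: ('v::linorder, 'k) mpoly ring))"
proof (rule injI)
  fix f g :: "('v, 'k) mpoly"
  assume "root_incl CHAR('k) (poly_ring V) f = root_incl CHAR('k) (poly_ring V) g"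
  then have eq: "f ^ CHAR('k) = g ^ CHAR('k)" by (simp add: root_incl_def)
  have prime: "prime CHAR(('v, 'k) mpoly)"
    using assms by (simp add: CHAR_mpoly prime_CHAR_semidom)
  have "f ^ CHAR('k) = ((f - g) + g) ^ CHAR('k)" by simp
  also have "\<dots> = (f - g) ^ CHAR('k) + g ^ CHAR('k)"
    by (metis CHAR_mpoly freshmans_dream prime)
  finally have "(f - g) ^ CHAR('k) = 0" using eq by simp
  then show "f = g" by simp
qed

lemma root_ring_pow:
  "PRoot f [^]\<^bsub>root_ring (poly_ring V)\<^esub> p = root_incl p (poly_ring V) f"
proof -
  have "PRoot f [^]\<^bsub>root_ring (poly_ring V)\<^esub> n = PRoot (f ^ n)" for n :: nat
    by (induction n) (auto simp: nat_pow_def mult.commute)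
  then show ?thesis by (simp add: root_incl_def)
qed


section \<open>Ladders\<close>

text \<open>The entry in row \<open>i\<close> and column \<open>j\<close> of the generic matrix is the variable with index \<open>(i, j)\<close>;
  rows and columns are numbered from 1, so index 0 is out of range.\<close>

definition ladder :: "nat \<Rightarrow> nat \<Rightarrow> (nat \<times> nat) set \<Rightarrow> bool" where
  "ladder k l L \<longleftrightarrow> L \<subseteq> {1..k} \<times> {1..l} \<and>
     (\<forall>i j i' j'. (i, j) \<in> L \<longrightarrow> (i', j') \<in> L \<longrightarrow> i \<le> i' \<longrightarrow> j' \<le> j \<longrightarrow>
        {i..i'} \<times> {j'..j} \<subseteq> L)"

definition upper_outside :: "(nat \<times> nat) set \<Rightarrow> (nat \<times> nat) set" where
  "upper_outside L = {(i, j) \<in> L. (i - 1, j) \<notin> L \<and> (i, j + 1) \<notin> L}"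

definition upper_corners ::
    "nat \<Rightarrow> (nat \<times> nat) set \<Rightarrow> nat \<Rightarrow> (nat \<Rightarrow> nat) \<Rightarrow> (nat \<Rightarrow> nat) \<Rightarrow> bool" where
  "upper_corners l L u b a \<longleftrightarrow> 1 \<le> u \<and>
     upper_outside L = (\<lambda>h. (b h, a h)) ` {1..u} \<and>
     b 1 = 1 \<and> strict_mono_on {1..u} b \<and> strict_mono_on {1..u} a \<and> a u = l"

definition lower_corners ::
    "nat \<Rightarrow> (nat \<times> nat) set \<Rightarrow> nat \<Rightarrow> (nat \<Rightarrow> nat) \<Rightarrow> (nat \<Rightarrow> nat) \<Rightarrow> bool" where
  "lower_corners k L v d c \<longleftrightarrow> 1 \<le> v \<and>
     mono_on {1..v} d \<and> d v = k \<and> c 1 = 1 \<and> mono_on {1..v} c \<and>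
     (\<forall>h \<in> {1..v}. (d h, c h) \<in> L \<and> ((d h + 1, c h) \<notin> L \<or> (d h, c h - 1) \<notin> L)) \<and>
     {(i, j) \<in> L. (i + 1, j) \<notin> L \<and> (i, j - 1) \<notin> L} \<subseteq> (\<lambda>h. (d h, c h)) ` {1..v}"

text \<open>All corners, upper and lower, are distinct; the upper ones already are pairwise distinct by
  strict monotonicity in \<open>upper_corners\<close>, which also puts them in different rows and in
  different columns.\<close>

definition distinct_corners ::
    "nat \<Rightarrow> (nat \<Rightarrow> nat) \<Rightarrow> (nat \<Rightarrow> nat) \<Rightarrow> nat \<Rightarrow> (nat \<Rightarrow> nat) \<Rightarrow> (nat \<Rightarrow> nat) \<Rightarrow> bool" where
  "distinct_corners u b a v d c \<longleftrightarrow>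
     inj_on (\<lambda>h. (d h, c h)) {1..v} \<and>
     (\<lambda>h. (b h, a h)) ` {1..u} \<inter> (\<lambda>h. (d h, c h)) ` {1..v} = {}"

definition subladder ::
    "(nat \<times> nat) set \<Rightarrow> (nat \<Rightarrow> nat) \<Rightarrow> (nat \<Rightarrow> nat) \<Rightarrow> nat \<Rightarrow> (nat \<times> nat) set" where
  "subladder L d c j = {(i, w) \<in> L. i \<le> d j \<and> c j \<le> w}"


section \<open>Mixed ladder determinantal ideals\<close>

definition minor_supports :: "nat \<Rightarrow> (nat \<times> nat) set \<Rightarrow> (nat set \<times> nat set) set" where
  "minor_supports t L' = {(A, B). card A = t \<and> card B = t \<and> A \<times> B \<subseteq> L'}"

definition generic_minor :: "nat set \<Rightarrow> nat set \<Rightarrow> (nat \<times> nat, 'k::field) mpoly" where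
  "generic_minor A B = det (mat (card A) (card B)
     (\<lambda>(i, j). mvar (sorted_list_of_set A ! i, sorted_list_of_set B ! j)))"

definition minor_ideal ::
    "(nat \<times> nat) set \<Rightarrow> nat \<Rightarrow> (nat \<times> nat) set \<Rightarrow> (nat \<times> nat, 'k::field) mpoly set" where
  "minor_ideal L t L' =
     Idl\<^bsub>poly_ring L\<^esub> {generic_minor A B | A B. (A, B) \<in> minor_supports t L'}"

definition mixed_ladder_ideal ::
    "(nat \<times> nat) set \<Rightarrow> nat \<Rightarrow> (nat \<Rightarrow> nat) \<Rightarrow> (nat \<Rightarrow> nat) \<Rightarrow> (nat \<Rightarrow> nat)
      \<Rightarrow> (nat \<times> nat, 'k::field) mpoly set" where
  "mixed_ladder_ideal L v d c t =
     (\<Oplus>\<^bsub>ideals_set (poly_ring L)\<^esub> j \<in> {1..v}. minor_ideal L (t j) (subladder L d c j))"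

end

(* The generic point of the ladder is x_ij = sum over q < rho(i, j) of e_iq v_jq, where rho(i, j) is
   the minimum of t_h - 1 over the subladders L_h containing the cell (i, j). Its weights can be
   chosen tight exactly on the level sets of longest antidiagonal chains; then the leading monomial
   of every polynomial vanishing at the generic point is divisible by the antidiagonal of a
   generating minor. So the ladder ideal I is the kernel of the generic point, and it is prime.

   Let Delta be the product of the lower left corner minors of size t_h - 1. Once Delta is inverted,
   a bordered minor solves for every cell outside a set of free cells, so I is generated by as many
   elements as there are non-free cells, say N. The product Phi of the minors on the full
   antidiagonals of L has the product of all variables as its leading term and lies, up to a power
   of Delta, in I^N. Hence g |-> Tr(Phi^(p-1) g), suitably normalized, is a splitting, and the
   pigeonhole principle shows that it maps I^(np+1) into I^(n+1) for symbolic powers. *)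
theory Submission
  imports Defs "HOL-Library.Product_Lexorder"
begin

section \<open>Polynomials\<close>

text \<open>The weights are natural numbers rather than a monomial order because the generic point
  is specialized to polynomials in one variable, where only orders of vanishing are visible. No such
  weight separates all monomials in several variables, so one is chosen for each bound on the
  degree. Equality of I with the kernel is used beyond primeness: no nonzero polynomial in the free
  variables vanishes at the generic point. This keeps Delta outside I, and after elimination it
  decides membership in I. Two demands on Phi pull in opposite directions. The pigeonhole argument
  loses N (p - 1) orders, so Phi must vanish to order N along I, which asks for many minors. The
  trace must send a multiple of Phi^(p-1) to 1, which asks for the monomial with all exponents p - 1
  and leaves no room for larger degree. Minors on the antidiagonals meet both demands, as each cell
  of L lies on exactly one antidiagonal and each antidiagonal accounts for the non-free cells on it.
  No localization is formed; powers of Delta are carried along as denominators.\<close>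

abbreviation keys where "keys \<equiv> Poly_Mapping.keys"
abbreviation lookup where "lookup \<equiv> Poly_Mapping.lookup"
abbreviation single where "single \<equiv> Poly_Mapping.single"

type_synonym 'k cell_poly = "(nat \<times> nat, 'k) mpoly"

text \<open>The \<open>single\<close> case is limited to exponents occurring in \<open>f\<close>, so
  that a support condition such as \<open>f \<in> pcarrier V\<close> is still at hand there.\<close>

lemma poly_mapping_keys_induct [case_names zero single add]:
  fixes f :: "'a \<Rightarrow>\<^sub>0 'b::comm_monoid_add"
  assumes zero: "P 0" and single: "\<And>m a. m \<in> keys f \<Longrightarrow> P (single m a)"
    and add: "\<And>g h. P g \<Longrightarrow> P h \<Longrightarrow> P (g + h)"
  shows "P f"
proof -
  have "P (\<Sum>m\<in>M. single m (lookup f m))"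
    if "finite M" "M \<subseteq> keys f" for M
    using that by (induction M rule: finite_induct) (auto intro: zero single add)
  moreover have "(\<Sum>m\<in>keys f. single m (lookup f m)) = f"
    by (rule poly_mapping_eqI)
       (simp add: lookup_sum lookup_single when_def in_keys_iff)
  ultimately show ?thesis by (metis finite_keys order_refl)
qed

section \<open>Evaluation homomorphisms on polynomial rings\<close>

definition monom_eval :: "('v \<Rightarrow> 'r) \<Rightarrow> ('v \<Rightarrow>\<^sub>0 nat) \<Rightarrow> 'r::comm_semiring_1" where
  "monom_eval s m = (\<Prod>x \<in> keys m. s x ^ lookup m x)"

lemma monom_eval_eq:
  assumes "finite X" "keys m \<subseteq> X"
  shows "monom_eval s m = (\<Prod>x \<in> X. s x ^ lookup m x)"
  unfolding monom_eval_def using assms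
  by (intro prod.mono_neutral_left) (auto simp: in_keys_iff)

lemma monom_eval_zero [simp]: "monom_eval s 0 = 1"
  by (simp add: monom_eval_def)

lemma monom_eval_add: "monom_eval s (m + n) = monom_eval s m * monom_eval s n"
proof -
  let ?X = "keys m \<union> keys n"
  have "monom_eval s (m + n) = (\<Prod>x \<in> ?X. s x ^ lookup (m + n) x)"
    using keys_add[of m n] by (intro monom_eval_eq) auto
  also have "\<dots> = (\<Prod>x \<in> ?X. s x ^ lookup m x) * (\<Prod>x \<in> ?X. s x ^ lookup n x)"
    by (simp add: lookup_add power_add prod.distrib)
  also have "\<dots> = monom_eval s m * monom_eval s n"
    by (simp add: monom_eval_eq[of ?X])
  finally show ?thesis .
qed

lemma monom_eval_single [simp]: "monom_eval s (single x n) = s x ^ n"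
  by (cases "n = 0") (simp_all add: monom_eval_def)

text \<open>The coefficient map \<open>c\<close> is a parameter because two targets occur: another
  polynomial ring, with \<open>c = single 0\<close>, and polynomials in one variable, with constants
  \<open>monom a 0\<close>.\<close>

definition mpoly_eval :: "('k \<Rightarrow> 'r) \<Rightarrow> ('v \<Rightarrow> 'r) \<Rightarrow> ('v, 'k::field) mpoly \<Rightarrow> 'r::comm_ring_1" where
  "mpoly_eval c s f = (\<Sum>m \<in> keys f. c (lookup f m) * monom_eval s m)"

context
  fixes c :: "'k::field \<Rightarrow> 'r::comm_ring_1" and s :: "'v \<Rightarrow> 'r"
  assumes c: "comm_ring_hom c"
begin

interpretation c: comm_ring_hom c by (rule c)

lemma mpoly_eval_eq:
  assumes "finite M" "keys f \<subseteq> M"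
  shows "mpoly_eval c s f = (\<Sum>m \<in> M. c (lookup f m) * monom_eval s m)"
  unfolding mpoly_eval_def using assms
  by (intro sum.mono_neutral_left) (auto simp: in_keys_iff)

lemma mpoly_eval_zero [simp]: "mpoly_eval c s 0 = 0"
  by (simp add: mpoly_eval_def)

lemma mpoly_eval_single [simp]: "mpoly_eval c s (single m a) = c a * monom_eval s m"
  by (cases "a = 0") (simp_all add: mpoly_eval_def)

lemma mpoly_eval_add [simp]: "mpoly_eval c s (f + g) = mpoly_eval c s f + mpoly_eval c s g"
proof -
  let ?M = "keys f \<union> keys g"
  have "mpoly_eval c s (f + g) = (\<Sum>m \<in> ?M. c (lookup (f + g) m) * monom_eval s m)"
    using keys_add[of f g] by (intro mpoly_eval_eq) auto
  also have "\<dots> = mpoly_eval c s f + mpoly_eval c s g"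
    by (simp add: mpoly_eval_eq[of ?M] lookup_add c.hom_add distrib_right sum.distrib)
  finally show ?thesis .
qed

lemma mpoly_eval_mult [simp]: "mpoly_eval c s (f * g) = mpoly_eval c s f * mpoly_eval c s g"
proof (induction f rule: poly_mapping_keys_induct)
  case (single m a)
  show ?case
  proof (induction g rule: poly_mapping_keys_induct)
    case (single n b)
    then show ?case by (simp add: mult_single monom_eval_add c.hom_mult ac_simps)
  qed (simp_all add: distrib_left)
qed (simp_all add: distrib_right)

lemma mpoly_eval_one [simp]: "mpoly_eval c s 1 = 1"
  by (metis c.hom_one monom_eval_zero mpoly_eval_single mult_1 single_one)

lemma comm_ring_hom_mpoly_eval: "comm_ring_hom (mpoly_eval c s)"
  by unfold_locales simp_all

lemma mpoly_eval_mvar [simp]: "mpoly_eval c s (mvar x) = s x"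
  by (simp add: mvar_def)

end

lemma comm_ring_hom_const:
  "comm_ring_hom (single 0 :: 'k::field \<Rightarrow> ('v, 'k) mpoly)"
  by unfold_locales (simp_all add: single_add mult_single)

text \<open>Specializing the generic point is a composite of two evaluations, so a polynomial killed
  by the first is killed by every specialization.\<close>

lemma mpoly_eval_compose:
  fixes f :: "('v, 'k::field) mpoly" and s :: "'v \<Rightarrow> ('w, 'k) mpoly"
  assumes c: "comm_ring_hom c"
  shows "mpoly_eval c s' (mpoly_eval (single 0) s f)
       = mpoly_eval c (\<lambda>x. mpoly_eval c s' (s x)) f"
proof -
  interpret e: comm_ring_hom "mpoly_eval c s'" by (rule comm_ring_hom_mpoly_eval[OF c])
  have mon: "mpoly_eval c s' (monom_eval s m) = monom_eval (\<lambda>x. mpoly_eval c s' (s x)) m" for m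
    by (simp add: monom_eval_def e.hom_prod e.hom_power)
  show ?thesis
    by (induction f rule: poly_mapping_keys_induct)
       (simp_all add: c comm_ring_hom_const mon)
qed

section \<open>Polynomials in a given set of variables, and subrings\<close>

abbreviation pcarrier :: "'v set \<Rightarrow> ('v, 'k::field) mpoly set" where
  "pcarrier V \<equiv> carrier (poly_ring V)"

text \<open>Constants and variables generate \<open>pcarrier V\<close> under sums and products; with
  \<open>S = eliminable\<close> this reduces the elimination of a polynomial to that of a single
  variable.\<close>

lemma mpoly_subring_induct:
  fixes f :: "('v, 'k::field) mpoly"
  assumes "f \<in> pcarrier V"
    and const: "\<And>a. single 0 a \<in> S" and var: "\<And>x. x \<in> V \<Longrightarrow> mvar x \<in> S"
    and add: "\<And>g h. g \<in> S \<Longrightarrow> h \<in> S \<Longrightarrow> g + h \<in> S"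
    and mult: "\<And>g h. g \<in> S \<Longrightarrow> h \<in> S \<Longrightarrow> g * h \<in> S"
  shows "f \<in> S"
proof (induction f rule: poly_mapping_keys_induct)
  case zero
  show ?case using const[of 0] by simp
next
  case (single m a)
  have pow: "h ^ n \<in> S" if "h \<in> S" for h and n :: nat
    using that const[of 1] by (induction n) (auto intro: mult)
  have "single m (1::'k) \<in> S"
  proof (induction m rule: poly_mapping_keys_induct)
    case (single x n)
    then have "x \<in> V" using \<open>m \<in> _\<close> assms(1) by auto
    have "mvar x ^ n = (single (single x n) 1 :: ('v, 'k) mpoly)"
      by (induction n) (auto simp: mvar_def mult_single simp flip: single_add)
    then show ?case using pow[OF var[OF \<open>x \<in> V\<close>], of n] by simp
  next
    case (add m1 m2)
    then show ?case using mult[OF add] by (simp add: mult_single)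
  qed (use const[of 1] in simp)
  from mult[OF const[of a] this] show ?case by (simp add: mult_single)
qed (auto intro: add)

text \<open>A carrier-free notion of subring: both \<open>pcarrier V\<close> and
  \<open>eliminable\<close> are instances, and the Leibniz formula puts determinants into
  either.\<close>

definition subring_set :: "'a::comm_ring_1 set \<Rightarrow> bool" where
  "subring_set S \<longleftrightarrow> 1 \<in> S \<and> (\<forall>a\<in>S. - a \<in> S) \<and> (\<forall>a\<in>S. \<forall>b\<in>S. a + b \<in> S \<and> a * b \<in> S)"

context
  fixes S :: "'a::comm_ring_1 set"
  assumes S: "subring_set S"
begin

lemma subring_set_1: "1 \<in> S" and subring_set_uminus: "a \<in> S \<Longrightarrow> - a \<in> S"
  and subring_set_add: "a \<in> S \<Longrightarrow> b \<in> S \<Longrightarrow> a + b \<in> S"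
  and subring_set_mult: "a \<in> S \<Longrightarrow> b \<in> S \<Longrightarrow> a * b \<in> S"
  using S by (auto simp: subring_set_def)

lemma subring_set_0: "0 \<in> S"
  using subring_set_add[OF subring_set_1 subring_set_uminus[OF subring_set_1]] by simp

lemma subring_set_diff: "a \<in> S \<Longrightarrow> b \<in> S \<Longrightarrow> a - b \<in> S"
  using subring_set_add[of a "- b"] subring_set_uminus[of b] by simp

lemma subring_set_power: "a \<in> S \<Longrightarrow> a ^ n \<in> S"
  by (induction n) (auto intro: subring_set_1 subring_set_mult)

lemma subring_set_sum: "(\<And>x. x \<in> X \<Longrightarrow> f x \<in> S) \<Longrightarrow> sum f X \<in> S"
  by (induction X rule: infinite_finite_induct) (auto intro: subring_set_0 subring_set_add)

lemma subring_set_prod: "(\<And>x. x \<in> X \<Longrightarrow> f x \<in> S) \<Longrightarrow> prod f X \<in> S"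
  by (induction X rule: infinite_finite_induct) (auto intro: subring_set_1 subring_set_mult)

lemma subring_set_signof: "signof \<pi> \<in> S"
  by (cases \<pi> rule: sign_cases) (auto intro: subring_set_1 subring_set_uminus)

lemma subring_set_det:
  assumes "A \<in> carrier_mat n n" "\<And>i j. i < n \<Longrightarrow> j < n \<Longrightarrow> A $$ (i, j) \<in> S"
  shows "det A \<in> S"
  unfolding det_def'[OF assms(1)]
  by (intro subring_set_sum subring_set_mult subring_set_signof subring_set_prod assms(2))
     (auto dest: permutes_in_image)

end

lemma subring_set_pcarrier: "subring_set (pcarrier V :: ('v, 'k::field) mpoly set)"
proof -
  have "f + g \<in> pcarrier V" if "f \<in> pcarrier V" "g \<in> pcarrier V" for f g :: "('v, 'k) mpoly"
    using that keys_add[of f g] by fastforce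
  moreover have "f * g \<in> pcarrier V" if "f \<in> pcarrier V" "g \<in> pcarrier V"
    for f g :: "('v, 'k) mpoly"
    using that by (rule poly_ring_mult_closed)
  moreover have "- f \<in> pcarrier V" if "f \<in> pcarrier V" for f :: "('v, 'k) mpoly"
    using that by simp
  moreover have "(1 :: ('v, 'k) mpoly) \<in> pcarrier V" by simp
  ultimately show ?thesis unfolding subring_set_def by blast
qed

lemmas pcarrier_closed =
  subring_set_1[OF subring_set_pcarrier] subring_set_0[OF subring_set_pcarrier]
  subring_set_uminus[OF subring_set_pcarrier] subring_set_add[OF subring_set_pcarrier]
  subring_set_mult[OF subring_set_pcarrier] subring_set_diff[OF subring_set_pcarrier]
  subring_set_power[OF subring_set_pcarrier]

lemma const_in_pcarrier: "single 0 a \<in> pcarrier V"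
  by simp

lemma mvar_in_pcarrier: "x \<in> V \<Longrightarrow> mvar x \<in> pcarrier V"
  by (simp add: mvar_def)

lemma pcarrier_mono: "V \<subseteq> W \<Longrightarrow> pcarrier V \<subseteq> pcarrier W"
  by auto

lemma single_in_pcarrier: "keys m \<subseteq> V \<Longrightarrow> single m a \<in> pcarrier V"
  by simp

subsection \<open>Weights and leading terms\<close>

definition weight :: "('v \<Rightarrow> nat) \<Rightarrow> ('v \<Rightarrow>\<^sub>0 nat) \<Rightarrow> nat" where
  "weight \<omega> m = (\<Sum>x \<in> keys m. \<omega> x * lookup m x)"

lemma weight_eq:
  assumes "finite X" "keys m \<subseteq> X"
  shows "weight \<omega> m = (\<Sum>x \<in> X. \<omega> x * lookup m x)"
  unfolding weight_def using assms
  by (intro sum.mono_neutral_left) (auto simp: in_keys_iff)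

lemma weight_zero [simp]: "weight \<omega> 0 = 0"
  by (simp add: weight_def)

lemma weight_single [simp]: "weight \<omega> (single x n) = \<omega> x * n"
  by (cases "n = 0") (simp_all add: weight_def)

lemma weight_add [simp]: "weight \<omega> (m + n) = weight \<omega> m + weight \<omega> n"
proof -
  let ?X = "keys m \<union> keys n"
  have "weight \<omega> (m + n) = (\<Sum>x \<in> ?X. \<omega> x * lookup (m + n) x)"
    using keys_add[of m n] by (intro weight_eq) auto
  also have "\<dots> = weight \<omega> m + weight \<omega> n"
    by (simp add: weight_eq[of ?X] lookup_add distrib_left sum.distrib)
  finally show ?thesis .
qed

lemma weight_sum: "weight \<omega> (\<Sum>i\<in>I. f i) = (\<Sum>i\<in>I. weight \<omega> (f i))"
  by (induction I rule: infinite_finite_induct) simp_all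

lemma monom_degree_eq_weight: "monom_degree m = weight (\<lambda>_. 1) m"
  by (simp add: monom_degree_def weight_def)

definition leads :: "('v \<Rightarrow> nat) \<Rightarrow> ('v, 'k::field) mpoly \<Rightarrow> ('v \<Rightarrow>\<^sub>0 nat) \<Rightarrow> 'k \<Rightarrow> bool" where
  "leads \<omega> f m a \<longleftrightarrow> lookup f m = a \<and>
     (\<forall>n \<in> keys f. n \<noteq> m \<longrightarrow> weight \<omega> m < weight \<omega> n)"

lemma leads_iff:
  "leads \<omega> f m a \<longleftrightarrow>
     (\<exists>g. f = single m a + g \<and> (\<forall>n \<in> keys g. weight \<omega> m < weight \<omega> n))"
    (is "?l \<longleftrightarrow> ?r")
proof
  assume ?l
  let ?g = "f - single m a"
  have "weight \<omega> m < weight \<omega> n" if "n \<in> keys ?g" for n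
  proof -
    have "n \<noteq> m" using that \<open>?l\<close> by (auto simp: leads_def in_keys_iff lookup_minus)
    then have "n \<in> keys f" using that
      by (auto simp: in_keys_iff lookup_minus lookup_single)
    then show ?thesis using \<open>?l\<close> \<open>n \<noteq> m\<close> by (auto simp: leads_def)
  qed
  then show ?r by (intro exI[of _ ?g]) auto
next
  assume ?r
  then obtain g where g: "f = single m a + g"
    "\<forall>n \<in> keys g. weight \<omega> m < weight \<omega> n" by blast
  then have "m \<notin> keys g" by blast
  then have "lookup g m = 0" by (simp add: in_keys_iff)
  moreover have "n \<in> keys g" if "n \<in> keys f" "n \<noteq> m" for n
    using that by (simp add: g(1) in_keys_iff lookup_add lookup_single when_def)
  ultimately show ?l using g(2) by (simp add: leads_def g(1) lookup_add)
qed

lemma leads_mult: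
  assumes "leads \<omega> f m a" "leads \<omega> g n b"
  shows "leads \<omega> (f * g) (m + n) (a * b)"
proof -
  obtain f' where f': "f = single m a + f'"
    "\<And>n. n \<in> keys f' \<Longrightarrow> weight \<omega> m < weight \<omega> n"
    using assms(1) unfolding leads_iff by blast
  obtain g' where g': "g = single n b + g'"
    "\<And>m. m \<in> keys g' \<Longrightarrow> weight \<omega> n < weight \<omega> m"
    using assms(2) unfolding leads_iff by blast
  define r where "r = single m a * g' + f' * g"
  have fg: "f * g = single (m + n) (a * b) + r"
  proof -
    have "f * g = single m a * g + f' * g" by (simp add: f'(1) distrib_right)
    also have "single m a * g = single (m + n) (a * b) + single m a * g'"
      by (subst g'(1)) (simp add: distrib_left mult_single)
    finally show ?thesis by (simp add: r_def add.assoc)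
  qed
  have g_ge: "weight \<omega> n \<le> weight \<omega> k" if "k \<in> keys g" for k
    using assms(2) that by (cases "k = n") (auto simp: leads_def intro: less_imp_le)
  have "weight \<omega> (m + n) < weight \<omega> k" if k: "k \<in> keys r" for k
  proof -
    consider "k \<in> keys (single m a * g')" | "k \<in> keys (f' * g)"
      using k keys_add[of "single m a * g'" "f' * g"] unfolding r_def by blast
    then show ?thesis
    proof cases
      case 1
      then obtain x y where "k = x + y" "x \<in> keys (single m a)"
        "y \<in> keys g'" using keys_mult[of "single m a" g'] by blast
      then show ?thesis using g'(2)[of y] by (auto split: if_splits)
    next
      case 2
      then obtain x y where "k = x + y" "x \<in> keys f'"
        "y \<in> keys g" using keys_mult[of f' g] by blast
      then show ?thesis using f'(2)[of x] g_ge[of y] by auto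
    qed
  qed
  with fg show ?thesis unfolding leads_iff by blast
qed

lemma leads_one: "leads \<omega> 1 0 1"
  by (simp add: leads_def)

lemma leads_single: "leads \<omega> (single m a) m a"
  by (simp add: leads_def)

lemma leads_prod:
  assumes "\<And>i. i \<in> I \<Longrightarrow> leads \<omega> (f i) (m i) (a i)"
  shows "leads \<omega> (\<Prod>i\<in>I. f i) (\<Sum>i\<in>I. m i) (\<Prod>i\<in>I. a i)"
  using assms
  by (induction I rule: infinite_finite_induct) (auto intro: leads_one leads_mult)

section \<open>Ideals of polynomial rings and their powers\<close>

lemma ideal_poly_iff:
  fixes I :: "('v, 'k::field) mpoly set"
  shows "ideal I (poly_ring V) \<longleftrightarrow> I \<subseteq> pcarrier V \<and> 0 \<in> I \<and> (\<forall>f\<in>I. \<forall>g\<in>I. f + g \<in> I) \<and>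
     (\<forall>f\<in>pcarrier V. \<forall>g\<in>I. f * g \<in> I)" (is "_ \<longleftrightarrow> ?r")
proof
  assume "ideal I (poly_ring V)"
  then interpret I: ideal I "poly_ring V" .
  have "0 \<in> I" using additive_subgroup.zero_closed[OF I.additive_subgroup_axioms]
    by (simp only: poly_ring_simps)
  moreover have "f + g \<in> I" if "f \<in> I" "g \<in> I" for f g
    using additive_subgroup.a_closed[OF I.additive_subgroup_axioms that]
      by (simp only: poly_ring_simps)
  moreover have "f * g \<in> I" if "f \<in> pcarrier V" "g \<in> I" for f g
    using I.I_l_closed[OF that(2,1)] by (simp only: poly_ring_simps)
  ultimately show ?r using I.a_subset by blast
next
  assume r: ?r
  interpret R: cring "poly_ring V :: ('v, 'k) mpoly ring" by (rule cring_poly_ring)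
  have uminus: "- f \<in> I" if "f \<in> I" for f
  proof -
    have "(- 1) * f \<in> I" using r that pcarrier_closed(3)[OF pcarrier_closed(1)[of V]] by blast
    then show ?thesis by simp
  qed
  show "ideal I (poly_ring V)"
  proof (rule idealI)
    show "ring (poly_ring V :: ('v, 'k) mpoly ring)" by (rule R.ring_axioms)
    show "subgroup I (add_monoid (poly_ring V))"
    proof (rule R.add.subgroupI)
      fix f assume "f \<in> I"
      then have "f \<in> pcarrier V" using r by blast
      have "\<ominus>\<^bsub>poly_ring V\<^esub> f = - f"
        using R.minus_equality[of "- f" f] pcarrier_closed(3)[of f V] \<open>f \<in> pcarrier V\<close>
        unfolding poly_ring_simps(3,5) by simp
      then show "\<ominus>\<^bsub>poly_ring V\<^esub> f \<in> I" using uminus[OF \<open>f \<in> I\<close>] by simp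
    next
      show "I \<subseteq> carrier (poly_ring V)" using r by blast
      show "I \<noteq> {}" using r by blast
      show "f \<oplus>\<^bsub>poly_ring V\<^esub> g \<in> I" if "f \<in> I" "g \<in> I" for f g
        using r that unfolding poly_ring_simps(3) by blast
    qed
  next
    fix f g :: "('v, 'k) mpoly" assume "f \<in> I" "g \<in> pcarrier V"
    then show "g \<otimes>\<^bsub>poly_ring V\<^esub> f \<in> I" "f \<otimes>\<^bsub>poly_ring V\<^esub> g \<in> I"
      using r by (simp_all only: poly_ring_simps(2) mult.commute[of f g])
  qed
qed

context
  fixes I :: "('v, 'k::field) mpoly set" and V :: "'v set"
  assumes I: "ideal I (poly_ring V)"
begin

lemma ideal_poly_carrier: "f \<in> I \<Longrightarrow> f \<in> pcarrier V"
  and ideal_poly_zero: "0 \<in> I"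
  and ideal_poly_add: "f \<in> I \<Longrightarrow> g \<in> I \<Longrightarrow> f + g \<in> I"
  and ideal_poly_mult: "h \<in> pcarrier V \<Longrightarrow> f \<in> I \<Longrightarrow> h * f \<in> I"
  using I unfolding ideal_poly_iff by blast+

lemma ideal_poly_uminus: "f \<in> I \<Longrightarrow> - f \<in> I"
  using ideal_poly_mult[OF pcarrier_closed(3)[OF pcarrier_closed(1)], of f] by simp

lemma ideal_poly_diff: "f \<in> I \<Longrightarrow> g \<in> I \<Longrightarrow> f - g \<in> I"
  using ideal_poly_add[of f "- g"] ideal_poly_uminus[of g] by simp

lemma ideal_poly_sum: "(\<And>x. x \<in> X \<Longrightarrow> F x \<in> I) \<Longrightarrow> sum F X \<in> I"
  by (induction X rule: infinite_finite_induct) (auto intro: ideal_poly_zero ideal_poly_add)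

end

text \<open>Elements are built by adding one multiple of a generator at a time, so that membership
  can be used by induction; \<open>genideal_eq_ideal_span\<close> identifies the result with
  \<open>Idl\<close>.\<close>

inductive_set ideal_span :: "'v set \<Rightarrow> ('v, 'k::field) mpoly set \<Rightarrow> ('v, 'k) mpoly set"
  for V T where
  zero: "0 \<in> ideal_span V T"
| step: "h \<in> pcarrier V \<Longrightarrow> t \<in> T \<Longrightarrow> f \<in> ideal_span V T \<Longrightarrow> h * t + f \<in> ideal_span V T"

lemma ideal_ideal_span:
  fixes T :: "('v, 'k::field) mpoly set"
  assumes "T \<subseteq> pcarrier V"
  shows "ideal (ideal_span V T) (poly_ring V)"
proof -
  have "f \<in> pcarrier V" if "f \<in> ideal_span V T" for f
    using that
  proof induction
    case (step h t f)
    then show ?case using assms by (intro pcarrier_closed(4) pcarrier_closed(5)) blast+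
  qed (rule pcarrier_closed)
  moreover have "f + g \<in> ideal_span V T" if "f \<in> ideal_span V T" "g \<in> ideal_span V T" for f g
    using that
  proof induction
    case (step h t f)
    then show ?case using ideal_span.step[of h V t T "f + g"] by (simp add: add.assoc)
  qed simp
  moreover have "h * f \<in> ideal_span V T" if "f \<in> ideal_span V T" "h \<in> pcarrier V" for f h
    using that
  proof induction
    case (step h' t f)
    then show ?case using ideal_span.step[of "h * h'" V t T "h * f"] pcarrier_closed(5)[of h V h']
      by (simp add: distrib_left mult.assoc del: poly_ring_simps)
  qed (simp add: ideal_span.zero)
  ultimately show ?thesis
    unfolding ideal_poly_iff
    by (intro conjI subsetI ballI ideal_span.zero)
qed

lemma ideal_span_subset:
  assumes "ideal J (poly_ring V)" "T \<subseteq> J"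
  shows "ideal_span V T \<subseteq> J"
proof
  fix f assume "f \<in> ideal_span V T"
  then show "f \<in> J"
  proof induction
    case (step h t f)
    then show ?case
      using assms(2) by (intro ideal_poly_add[OF assms(1)] ideal_poly_mult[OF assms(1)]) blast+
  qed (rule ideal_poly_zero[OF assms(1)])
qed

lemma ideal_span_generator: "t \<in> T \<Longrightarrow> t \<in> ideal_span V T"
  using ideal_span.step[OF pcarrier_closed(1) _ ideal_span.zero, of t T V] by simp

lemma genideal_eq_ideal_span:
  fixes T :: "('v, 'k::field) mpoly set"
  assumes "T \<subseteq> pcarrier V"
  shows "Idl\<^bsub>poly_ring V\<^esub> T = ideal_span V T"
proof -
  interpret R: cring "poly_ring V :: ('v, 'k) mpoly ring" by (rule cring_poly_ring)
  show ?thesis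
  proof (rule antisym)
    show "Idl\<^bsub>poly_ring V\<^esub> T \<subseteq> ideal_span V T"
      by (rule R.genideal_minimal[OF ideal_ideal_span[OF assms]]) (auto intro: ideal_span_generator)
    show "ideal_span V T \<subseteq> Idl\<^bsub>poly_ring V\<^esub> T"
      by (rule ideal_span_subset[OF R.genideal_ideal[OF assms] R.genideal_self[OF assms]])
  qed
qed

text \<open>The mixed ladder ideal is a finite sum in the semiring of ideals; the neutral element
  there is the zero ideal, which is the span of no generators.\<close>

lemma finsum_ideal_span:
  fixes T :: "'i \<Rightarrow> ('v, 'k::field) mpoly set"
  assumes "finite X" "\<And>x. x \<in> X \<Longrightarrow> T x \<subseteq> pcarrier V"
  shows "(\<Oplus>\<^bsub>ideals_set (poly_ring V)\<^esub> x \<in> X. ideal_span V (T x)) = ideal_span V (\<Union>x\<in>X. T x)"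
  using assms
proof (induction X rule: finite_induct)
  interpret R: cring "poly_ring V :: ('v, 'k) mpoly ring" by (rule cring_poly_ring)
  interpret S: semiring "ideals_set (poly_ring V :: ('v, 'k) mpoly ring)"
    by (rule R.ideals_set_is_semiring)
  {
    case empty
    have "f = 0" if "f \<in> ideal_span V {}" for f :: "('v, 'k) mpoly"
      using that by induction auto
    then have "ideal_span V {} = {0 :: ('v, 'k) mpoly}" by (auto intro: ideal_span.zero)
    moreover have "\<zero>\<^bsub>ideals_set (poly_ring V)\<^esub> = {0 :: ('v, 'k) mpoly}"
      by (simp add: ideals_set_def)
    ultimately show ?case by simp
  next
    case (insert x X)
    have id: "ideal (ideal_span V (T y)) (poly_ring V)" if "y \<in> insert x X" for y
      using insert.prems that by (intro ideal_ideal_span)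
    have id': "ideal (ideal_span V (\<Union>x\<in>X. T x)) (poly_ring V)"
      and id'': "ideal (ideal_span V (\<Union>x\<in>insert x X. T x)) (poly_ring V)"
      using insert.prems by (intro ideal_ideal_span; blast)+
    have "(\<Oplus>\<^bsub>ideals_set (poly_ring V)\<^esub> x \<in> insert x X. ideal_span V (T x))
        = ideal_span V (T x) <+>\<^bsub>poly_ring V\<^esub> ideal_span V (\<Union>x\<in>X. T x)"
      using insert id by (subst S.finsum_insert) (auto simp: ideals_set_def)
    also have "\<dots> = ideal_span V (\<Union>x\<in>insert x X. T x)"
    proof (rule antisym)
      have "ideal_span V (T x) \<subseteq> ideal_span V (\<Union>x\<in>insert x X. T x)"
        "ideal_span V (\<Union>x\<in>X. T x) \<subseteq> ideal_span V (\<Union>x\<in>insert x X. T x)"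
        by (intro ideal_span_subset[OF id'']; auto intro: ideal_span_generator)+
      then show "ideal_span V (T x) <+>\<^bsub>poly_ring V\<^esub> ideal_span V (\<Union>x\<in>X. T x)
          \<subseteq> ideal_span V (\<Union>x\<in>insert x X. T x)"
        using ideal_poly_add[OF id''] by (auto simp: set_add_def' simp del: UN_insert)
    next
      show "ideal_span V (\<Union>x\<in>insert x X. T x) \<subseteq> ideal_span V (T x) <+>\<^bsub>poly_ring V\<^esub> ideal_span V
        (\<Union>x\<in>X. T x)"
      proof (rule ideal_span_subset)
        show "ideal (ideal_span V (T x) <+>\<^bsub>poly_ring V\<^esub> ideal_span V (\<Union>x\<in>X. T x)) (poly_ring V)"
          using id id' by (intro R.add_ideals) auto
        show "(\<Union>x\<in>insert x X. T x) \<subseteq> ideal_span V (T x) <+>\<^bsub>poly_ring V\<^esub> ideal_span V (\<Union>x\<in>X. T x)"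
        proof
          fix f assume "f \<in> (\<Union>x\<in>insert x X. T x)"
          then consider "f \<in> ideal_span V (T x)" | "f \<in> ideal_span V (\<Union>x\<in>X. T x)"
            by (auto intro: ideal_span_generator)
          then show "f \<in> ideal_span V (T x) <+>\<^bsub>poly_ring V\<^esub> ideal_span V (\<Union>x\<in>X. T x)"
          proof cases
            case 1
            then show ?thesis unfolding set_add_def' poly_ring_simps
              by (intro UN_I[OF 1] UN_I[OF ideal_span.zero]) auto
          next
            case 2
            then show ?thesis unfolding set_add_def' poly_ring_simps
              by (intro UN_I[OF ideal_span.zero] UN_I[OF 2]) auto
          qed
        qed
      qed
    qed
    finally show ?case .
  }
qed

section \<open>Powers of an ideal\<close>

abbreviation ideal_pow :: "'v set \<Rightarrow> ('v, 'k::field) mpoly set \<Rightarrow> nat \<Rightarrow> ('v, 'k) mpoly set" where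
  "ideal_pow V I n \<equiv> I [^]\<^bsub>ideals_set (poly_ring V)\<^esub> n"

context
  fixes I :: "('v, 'k::field) mpoly set" and V :: "'v set"
  assumes I: "ideal I (poly_ring V)"
begin

interpretation R: cring "poly_ring V :: ('v, 'k) mpoly ring" by (rule cring_poly_ring)
interpretation S: Group.comm_monoid "ideals_set (poly_ring V :: ('v, 'k) mpoly ring)"
  by (rule R.ideals_set_is_comm_monoid)

lemma ideal_pow_0: "ideal_pow V I 0 = pcarrier V"
  using S.nat_pow_0[of I] by (simp add: ideals_set_def)

lemma ideal_pow_Suc: "ideal_pow V I (Suc n) = ideal_prod (poly_ring V) (ideal_pow V I n) I"
  using S.nat_pow_Suc[of I n] by (simp add: ideals_set_def)

lemma ideal_ideal_pow: "ideal (ideal_pow V I n) (poly_ring V)"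
  using S.nat_pow_closed[of I n] I by (simp add: ideals_set_def)

lemma one_in_ideal_pow_0: "1 \<in> ideal_pow V I 0"
  unfolding ideal_pow_0 by (rule pcarrier_closed(1))

lemma ideal_pow_1: "ideal_pow V I 1 = I"
  using S.nat_pow_Suc[of I 0] S.nat_pow_0[of I] S.l_one[of I] I by (simp add: ideals_set_def)

lemma ideal_pow_add:
  "ideal_prod (poly_ring V) (ideal_pow V I m) (ideal_pow V I n) = ideal_pow V I (m + n)"
  using S.nat_pow_mult[of I m n] I by (simp add: ideals_set_def)

lemma ideal_pow_mult_mem:
  "f \<in> ideal_pow V I m \<Longrightarrow> g \<in> ideal_pow V I n \<Longrightarrow> f * g \<in> ideal_pow V I (m + n)"
  using ideal_prod.prod[of f "ideal_pow V I m" g "ideal_pow V I n" "poly_ring V"] ideal_pow_add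
  by simp

lemma ideal_pow_antimono: "m \<le> n \<Longrightarrow> ideal_pow V I n \<subseteq> ideal_pow V I m"
proof -
  assume "m \<le> n"
  then have "ideal_pow V I n = ideal_prod (poly_ring V) (ideal_pow V I m) (ideal_pow V I (n - m))"
    by (simp add: ideal_pow_add)
  then show ?thesis
    using R.ideal_prod_inter[OF ideal_ideal_pow ideal_ideal_pow, of m "n - m"] by blast
qed

lemma ideal_pow_power_mem: "f \<in> ideal_pow V I m \<Longrightarrow> f ^ n \<in> ideal_pow V I (m * n)"
proof (induction n)
  case 0
  show ?case using one_in_ideal_pow_0 by simp
next
  case (Suc n)
  then show ?case using ideal_pow_mult_mem[of f m "f ^ n" "m * n"] by simp
qed

lemma ideal_pow_prod_mem:
  assumes "\<And>x. x \<in> X \<Longrightarrow> F x \<in> ideal_pow V I (e x)"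
  shows "prod F X \<in> ideal_pow V I (sum e X)"
  using assms
proof (induction X rule: infinite_finite_induct)
  case (insert x X)
  then show ?case using ideal_pow_mult_mem[of "F x" "e x" "prod F X" "sum e X"] by simp
qed (use one_in_ideal_pow_0 in simp_all)

lemma prod_in_ideal_pow:
  assumes "finite X" "Y \<subseteq> X" "\<And>x. x \<in> X \<Longrightarrow> F x \<in> pcarrier V" "\<And>y. y \<in> Y \<Longrightarrow> F y \<in> I"
  shows "prod F X \<in> ideal_pow V I (card Y)"
proof -
  have "prod F X \<in> ideal_pow V I (\<Sum>x\<in>X. if x \<in> Y then 1 else 0)"
  proof (rule ideal_pow_prod_mem)
    fix x assume "x \<in> X"
    then show "F x \<in> ideal_pow V I (if x \<in> Y then 1 else 0)"
      using assms(3,4)[of x] ideal_pow_1 ideal_pow_0 by auto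
  qed
  also have "(\<Sum>x\<in>X. if x \<in> Y then 1 else 0) = card Y"
    using assms(1,2) by (simp add: sum.If_cases inf.absorb2)
  finally show ?thesis .
qed

end

lemma ideal_pow_mono:
  fixes I J :: "('v, 'k::field) mpoly set"
  assumes I: "ideal I (poly_ring V)" and J: "ideal J (poly_ring V)" and "I \<subseteq> J"
  shows "ideal_pow V I n \<subseteq> ideal_pow V J n"
proof (induction n)
  case (Suc n)
  show ?case
  proof
    fix f assume "f \<in> ideal_pow V I (Suc n)"
    then have "f \<in> ideal_prod (poly_ring V) (ideal_pow V I n) I" by (simp only: ideal_pow_Suc[OF I])
    then have "f \<in> ideal_prod (poly_ring V) (ideal_pow V J n) J"
      by induction (use Suc assms(3) in \<open>auto intro: ideal_prod.intros simp del: poly_ring_simps\<close>)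
    then show "f \<in> ideal_pow V J (Suc n)" by (simp only: ideal_pow_Suc[OF J])
  qed
qed (simp only: ideal_pow_0[OF I] ideal_pow_0[OF J] order_refl)

section \<open>Determinants in powers of ideals\<close>

text \<open>By a Schur complement, the determinant equals that of the block matrix \<open>W\<close>
  with blocks 1, \<open>- Y\<close>, \<open>K\<close>, \<open>E\<close>, of size
  \<open>r + m\<close>. Every permutation of \<open>r + m\<close> indices has to pick at least
  \<open>card A + card B - m - r\<close> entries from the part of \<open>E\<close> lying in
  \<open>I\<close>. Enlarging the matrix by \<open>r\<close> is the price for removing the product
  of rank at most \<open>r\<close>.\<close>

lemma det_add_product_in_ideal_pow:
  fixes E :: "('v::linorder, 'k::field) mpoly mat"
  assumes I: "ideal I (poly_ring V)"
    and K: "K \<in> carrier_mat m r" and Y: "Y \<in> carrier_mat r m" and E: "E \<in> carrier_mat m m"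
    and K': "\<And>i j. i < m \<Longrightarrow> j < r \<Longrightarrow> K $$ (i, j) \<in> pcarrier V"
    and Y': "\<And>i j. i < r \<Longrightarrow> j < m \<Longrightarrow> Y $$ (i, j) \<in> pcarrier V"
    and E': "\<And>i j. i < m \<Longrightarrow> j < m \<Longrightarrow> E $$ (i, j) \<in> pcarrier V"
    and "A \<subseteq> {..<m}" "B \<subseteq> {..<m}"
    and EI: "\<And>i j. i \<in> A \<Longrightarrow> j \<in> B \<Longrightarrow> E $$ (i, j) \<in> I"
  shows "det (K * Y + E) \<in> ideal_pow V I (card A + card B - m - r)"
proof -
  define M1 where "M1 = four_block_mat (1\<^sub>m r) (0\<^sub>m r m) K (1\<^sub>m m)"
  define M2 where "M2 = four_block_mat (1\<^sub>m r) (- Y) (0\<^sub>m m r) (K * Y + E)"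
  define W where "W = four_block_mat (1\<^sub>m r) (- Y) K E"
  have KY: "K * Y \<in> carrier_mat m m" using K Y by simp
  have "M1 * M2 = W"
  proof -
    have "M1 * M2 = four_block_mat (1\<^sub>m r * 1\<^sub>m r + 0\<^sub>m r m * 0\<^sub>m m r)
        (1\<^sub>m r * (- Y) + 0\<^sub>m r m * (K * Y + E)) (K * 1\<^sub>m r + 1\<^sub>m m * 0\<^sub>m m r)
        (K * (- Y) + 1\<^sub>m m * (K * Y + E))"
      unfolding M1_def M2_def using K Y E
      by (intro mult_four_block_mat) auto
    also have "1\<^sub>m r * 1\<^sub>m r + 0\<^sub>m r m * 0\<^sub>m m r = (1\<^sub>m r :: ('v, 'k) mpoly mat)" by simp
    also have "1\<^sub>m r * (- Y) + 0\<^sub>m r m * (K * Y + E) = - Y" using K Y E by simp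
    also have "K * 1\<^sub>m r + 1\<^sub>m m * 0\<^sub>m m r = K" using K by simp
    also have "K * (- Y) + 1\<^sub>m m * (K * Y + E) = E"
    proof -
      have "K * (- Y) = - (K * Y)" using K Y by simp
      then show ?thesis using KY E K Y by (intro eq_matI) auto
    qed
    finally show ?thesis by (simp add: W_def)
  qed
  have c1: "M1 \<in> carrier_mat (r + m) (r + m)" and c2: "M2 \<in> carrier_mat (r + m) (r + m)"
    and cW: "W \<in> carrier_mat (r + m) (r + m)"
    using K Y E by (auto simp: M1_def M2_def W_def)
  have "det M1 = 1"
    unfolding M1_def using K by (subst det_four_block_mat_upper_right_zero[of _ r _ m]) auto
  moreover have "det M2 = det (K * Y + E)"
    unfolding M2_def using K Y E by (subst det_four_block_mat_lower_left_zero[of _ r _ m]) auto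
  ultimately have "det (K * Y + E) = det W"
    using det_mult[OF c1 c2] \<open>M1 * M2 = W\<close> by simp
  also have "\<dots> \<in> ideal_pow V I (card A + card B - m - r)"
    unfolding det_def'[OF cW]
  proof (intro ideal_poly_sum[OF ideal_ideal_pow[OF I]] ideal_poly_mult[OF ideal_ideal_pow[OF I]])
    fix \<pi> assume "\<pi> \<in> {\<pi>. \<pi> permutes {0..<r + m}}"
    then have \<pi>: "\<pi> permutes {0..<r + m}" by simp
    \<comment> \<open>Rows whose chosen entry lies in the \<open>A\<close>-by-\<open>B\<close> part
      of \<open>E\<close>. Indices are shifted by \<open>r\<close>, where the block \<open>E\<close>
      begins, and \<open>r \<le> i\<close> guards the truncated subtraction.\<close>
    define Q where "Q = {i \<in> {0..<r + m}. i - r \<in> A \<and> r \<le> i \<and> \<pi> i - r \<in> B \<and> r \<le> \<pi> i}"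
    have W_carrier: "W $$ (i, j) \<in> pcarrier V" if "i < r + m" "j < r + m" for i j
      using that K Y E K' pcarrier_closed(3)[OF Y'] E' pcarrier_closed(1,2)
      by (auto simp: W_def four_block_mat_def Let_def simp del: poly_ring_simps)
    have "(\<Prod>i = 0..<r + m. W $$ (i, \<pi> i)) \<in> ideal_pow V I (card Q)"
    proof (rule prod_in_ideal_pow[OF I])
      show "W $$ (i, \<pi> i) \<in> pcarrier V" if "i \<in> {0..<r + m}" for i
        using that permutes_in_image[OF \<pi>, of i] by (intro W_carrier) auto
      show "W $$ (i, \<pi> i) \<in> I" if "i \<in> Q" for i
        using that permutes_in_image[OF \<pi>, of i] K Y E EI[of "i - r" "\<pi> i - r"]
        by (auto simp: W_def Q_def four_block_mat_def Let_def)
    qed (auto simp: Q_def)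
    moreover have "card A + card B - m - r \<le> card Q"
    proof -
      let ?A = "(+) r ` A" and ?B = "(+) r ` B"
      have fin: "finite A" "finite B" using assms(8,9) finite_subset by blast+
      have sub: "?A \<subseteq> {0..<r + m}" "?B \<subseteq> {0..<r + m}" using assms(8,9) by auto
      \<comment> \<open>Rows of \<open>A\<close> outside \<open>Q\<close> are sent by
        \<open>\<pi>\<close> to columns outside \<open>B\<close>, of which there are only
        \<open>r + m - card B\<close>.\<close>
      have "?A - Q \<subseteq> {i \<in> {0..<r + m}. \<pi> i \<in> {0..<r + m} - ?B}"
      proof
        fix i assume "i \<in> ?A - Q"
        then obtain a where a: "i = r + a" "a \<in> A" "a < m" using assms(8) by auto
        then have "\<not> (\<pi> i - r \<in> B \<and> r \<le> \<pi> i)" using \<open>i \<in> ?A - Q\<close> by (auto simp: Q_def)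
        then have "\<pi> i \<notin> ?B" by auto
        then show "i \<in> {i \<in> {0..<r + m}. \<pi> i \<in> {0..<r + m} - ?B}"
          using a permutes_in_image[OF \<pi>, of i] by auto
      qed
      then have "card (?A - Q) \<le> card {i \<in> {0..<r + m}. \<pi> i \<in> {0..<r + m} - ?B}"
        by (rule card_mono[rotated]) simp
      also have "\<dots> \<le> card ({0..<r + m} - ?B)"
        using permutes_inj_on[OF \<pi>]
        by (intro card_inj_on_le[of \<pi>]) (auto intro: inj_on_subset)
      also have "\<dots> = r + m - card B"
        using sub fin by (subst card_Diff_subset) (auto simp: card_image)
      finally have "card (?A - Q) \<le> r + m - card B" .
      moreover have "card ?A \<le> card (?A - Q) + card Q"
      proof -
        have "card ?A \<le> card ((?A - Q) \<union> Q)"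
          using fin by (intro card_mono) (auto simp: Q_def)
        also have "\<dots> \<le> card (?A - Q) + card Q" by (rule card_Un_le)
        finally show ?thesis .
      qed
      moreover have "card ?A = card A" by (simp add: card_image)
      moreover have "card B \<le> m" using card_mono[OF _ assms(9)] by simp
      ultimately show ?thesis by linarith
    qed
    ultimately show "(\<Prod>i = 0..<r + m. W $$ (i, \<pi> i)) \<in> ideal_pow V I (card A + card B - m - r)"
      using ideal_pow_antimono[OF I] by blast
    show "signof \<pi> \<in> pcarrier V" by (rule subring_set_signof[OF subring_set_pcarrier])
  qed
  finally show ?thesis .
qed

section \<open>Minors\<close>

abbreviation sl :: "nat set \<Rightarrow> nat list" where "sl \<equiv> sorted_list_of_set"

lemma sl_nth_in: "i < card A \<Longrightarrow> sl A ! i \<in> A"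
  by (metis card.infinite length_sorted_list_of_set not_less_zero nth_mem set_sorted_list_of_set)

lemma sl_nth_mono: "i < j \<Longrightarrow> j < card A \<Longrightarrow> sl A ! i < sl A ! j"
  using sorted_wrt_nth_less[of "(<)" "sl A" i j]
    sorted_list_of_set.strict_sorted_key_list_of_set[of A] by simp

lemma sl_nth_ge: "a \<le> b \<Longrightarrow> b < card A \<Longrightarrow> sl A ! a + (b - a) \<le> sl A ! b"
proof (induction "b - a" arbitrary: b)
  case (Suc n)
  then have "sl A ! a + (b - 1 - a) \<le> sl A ! (b - 1)" by (intro Suc.hyps(1)) auto
  moreover have "sl A ! (b - 1) < sl A ! b" using Suc by (intro sl_nth_mono) auto
  ultimately show ?case using Suc.hyps(2) by linarith
qed simp

definition minor_mat :: "nat set \<Rightarrow> nat set \<Rightarrow> 'k::field cell_poly mat" where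
  "minor_mat A B = mat (card A) (card B) (\<lambda>(i, j). mvar (sl A ! i, sl B ! j))"

lemma generic_minor_def': "generic_minor A B = det (minor_mat A B)"
  by (simp add: generic_minor_def minor_mat_def)

lemma minor_mat_carrier: "card A = n \<Longrightarrow> card B = n \<Longrightarrow> minor_mat A B \<in> carrier_mat n n"
  by (simp add: minor_mat_def)

lemma generic_minor_in_pcarrier:
  assumes "card A = card B" "A \<times> B \<subseteq> V"
  shows "generic_minor A B \<in> pcarrier V"
  unfolding generic_minor_def'
proof (rule subring_set_det[OF subring_set_pcarrier minor_mat_carrier])
  show "minor_mat A B $$ (i, j) \<in> pcarrier V" if "i < card A" "j < card A" for i j
    using that assms sl_nth_in[of i A] sl_nth_in[of j B]
    by (auto simp: minor_mat_def simp del: poly_ring_simps intro!: mvar_in_pcarrier)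
qed (use assms in auto)

lemma sl_remove_nth:
  assumes "i < card A" "i' < card A - 1"
  shows "sl (A - {sl A ! i}) ! i' = sl A ! insert_index i i'"
proof -
  have fin: "finite A" using assms(1) by (metis card.infinite not_less_zero)
  have "sl (A - {sl A ! i}) = remove1 (sl A ! i) (sl A)"
    using fin by (rule sorted_list_of_set_remove)
  also have "\<dots> = take i (sl A) @ drop (Suc i) (sl A)"
  proof -
    have "sl A = take i (sl A) @ sl A ! i # drop (Suc i) (sl A)"
      using assms(1) by (simp add: id_take_nth_drop)
    moreover have "sl A ! i \<notin> set (take i (sl A))"
    proof
      assume "sl A ! i \<in> set (take i (sl A))"
      then obtain j where "j < i" "sl A ! j = sl A ! i" by (auto simp: in_set_conv_nth)
      then show False using sl_nth_mono[of j i A] assms(1) by simp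
    qed
    ultimately show ?thesis by (metis remove1.simps(2) remove1_append)
  qed
  finally show ?thesis
    using assms by (auto simp: nth_append insert_index_def min_def)
qed

lemma mat_delete_minor_mat:
  assumes "i < card A" "j < card B"
  shows "mat_delete (minor_mat A B) i j = (minor_mat (A - {sl A ! i}) (B - {sl B ! j}) :: 'k::field
    cell_poly mat)"
proof -
  have fin: "finite A" "finite B" using assms by (metis card.infinite not_less_zero)+
  have card: "card (A - {sl A ! i}) = card A - 1" "card (B - {sl B ! j}) = card B - 1"
    using assms sl_nth_in[of i A] sl_nth_in[of j B] fin by auto
  show ?thesis
  proof (rule eq_matI)
    fix i' j' assume "i' < dim_row (minor_mat (A - {sl A ! i}) (B - {sl B ! j}) :: 'k cell_poly
      mat)"
      "j' < dim_col (minor_mat (A - {sl A ! i}) (B - {sl B ! j}) :: 'k cell_poly mat)"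
    then have "i' < card A - 1" "j' < card B - 1" by (auto simp: minor_mat_def card)
    then show "mat_delete (minor_mat A B) i j $$ (i', j')
        = (minor_mat (A - {sl A ! i}) (B - {sl B ! j}) :: 'k cell_poly mat) $$ (i', j')"
      using assms
      by (auto simp: mat_delete_def minor_mat_def card sl_remove_nth insert_index_def)
  qed (simp_all add: mat_delete_def minor_mat_def card)
qed

text \<open>Repeated Laplace expansion along columns outside \<open>B'\<close>: the minors left at
  the end have column set exactly \<open>B'\<close>, while their rows can be any subset of
  \<open>A\<close> of the right size.\<close>

lemma generic_minor_in_ideal_columns:
  fixes I :: "'k::field cell_poly set"
  assumes I: "ideal I (poly_ring V)"
  shows "finite A \<Longrightarrow> finite B \<Longrightarrow> card A = card B \<Longrightarrow> A \<times> B \<subseteq> V \<Longrightarrow> B' \<subseteq> B \<Longrightarrow>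
    (\<And>A'. A' \<subseteq> A \<Longrightarrow> card A' = card B' \<Longrightarrow> generic_minor A' B' \<in> I) \<Longrightarrow> generic_minor A B \<in> I"
proof (induction "card (B - B')" arbitrary: A B)
  case 0
  then have "B = B'" by auto
  then show ?case using 0 by blast
next
  case (Suc n)
  then obtain b where b: "b \<in> B" "b \<notin> B'" by (metis DiffE card.empty ex_in_conv nat.distinct(1))
  then obtain j where j: "j < card B" "sl B ! j = b"
    using Suc.prems by (metis in_set_conv_nth length_sorted_list_of_set set_sorted_list_of_set)
  let ?M = "minor_mat A B :: 'k cell_poly mat"
  have M: "?M \<in> carrier_mat (card B) (card B)" using Suc.prems by (simp add: minor_mat_carrier)
  have "generic_minor A B = (\<Sum>i<card B. ?M $$ (i, j) * cofactor ?M i j)"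
    unfolding generic_minor_def' by (rule laplace_expansion_column[OF M j(1)])
  also have "\<dots> \<in> I"
  proof (intro ideal_poly_sum[OF I] ideal_poly_mult[OF I])
    fix i assume "i \<in> {..<card B}"
    then have i: "i < card A" using Suc.prems by simp
    then show "?M $$ (i, j) \<in> pcarrier V"
      using j Suc.prems sl_nth_in[of i A] b
      by (auto simp: minor_mat_def simp del: poly_ring_simps intro!: mvar_in_pcarrier)
    have "generic_minor (A - {sl A ! i}) (B - {b}) \<in> I"
    proof (rule Suc.hyps(1))
      have "B - {b} - B' = (B - B') - {b}" by auto
      then show "n = card (B - {b} - B')"
        using Suc.hyps(2) b Suc.prems by simp
      show "card (A - {sl A ! i}) = card (B - {b})"
        using Suc.prems b sl_nth_in[OF i] by simp
      show "generic_minor A' B' \<in> I" if "A' \<subseteq> A - {sl A ! i}" "card A' = card B'" for A'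
        using that by (intro Suc.prems(6)) auto
    qed (use Suc.prems(1-5) b in auto)
    then have "(- 1) ^ (i + j) * generic_minor (A - {sl A ! i}) (B - {b}) \<in> I"
      by (intro ideal_poly_mult[OF I] pcarrier_closed(7) pcarrier_closed(3) pcarrier_closed(1))
    then show "cofactor ?M i j \<in> I"
      using i j by (simp add: cofactor_def mat_delete_minor_mat generic_minor_def')
  qed
  finally show ?case .
qed

text \<open>The transposed expansion. The two together provide the inclusions between determinantal
  ideals of different subladders.\<close>

lemma generic_minor_in_ideal_rows:
  fixes I :: "'k::field cell_poly set"
  assumes I: "ideal I (poly_ring V)"
  shows "finite A \<Longrightarrow> finite B \<Longrightarrow> card A = card B \<Longrightarrow> A \<times> B \<subseteq> V \<Longrightarrow> A' \<subseteq> A \<Longrightarrow>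
    (\<And>B'. B' \<subseteq> B \<Longrightarrow> card A' = card B' \<Longrightarrow> generic_minor A' B' \<in> I) \<Longrightarrow> generic_minor A B \<in> I"
proof (induction "card (A - A')" arbitrary: A B)
  case 0
  then have "A = A'" by auto
  then show ?case using 0 by blast
next
  case (Suc n)
  then obtain a where a: "a \<in> A" "a \<notin> A'" by (metis DiffE card.empty ex_in_conv nat.distinct(1))
  then obtain i where i: "i < card A" "sl A ! i = a"
    using Suc.prems by (metis in_set_conv_nth length_sorted_list_of_set set_sorted_list_of_set)
  let ?M = "minor_mat A B :: 'k cell_poly mat"
  have M: "?M \<in> carrier_mat (card A) (card A)" using Suc.prems by (simp add: minor_mat_carrier)
  have "generic_minor A B = (\<Sum>j<card A. ?M $$ (i, j) * cofactor ?M i j)"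
    unfolding generic_minor_def' by (rule laplace_expansion_row[OF M i(1)])
  also have "\<dots> \<in> I"
  proof (intro ideal_poly_sum[OF I] ideal_poly_mult[OF I])
    fix j assume "j \<in> {..<card A}"
    then have j: "j < card B" using Suc.prems by simp
    then show "?M $$ (i, j) \<in> pcarrier V"
      using i Suc.prems sl_nth_in[of j B] a
      by (auto simp: minor_mat_def simp del: poly_ring_simps intro!: mvar_in_pcarrier)
    have "generic_minor (A - {a}) (B - {sl B ! j}) \<in> I"
    proof (rule Suc.hyps(1))
      have "A - {a} - A' = (A - A') - {a}" by auto
      then show "n = card (A - {a} - A')"
        using Suc.hyps(2) a Suc.prems by simp
      show "card (A - {a}) = card (B - {sl B ! j})"
        using Suc.prems a sl_nth_in[OF j] by simp
      show "generic_minor A' B' \<in> I" if "B' \<subseteq> B - {sl B ! j}" "card A' = card B'" for B'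
        using that by (intro Suc.prems(6)) auto
    qed (use Suc.prems(1-5) a in auto)
    then have "(- 1) ^ (i + j) * generic_minor (A - {a}) (B - {sl B ! j}) \<in> I"
      by (intro ideal_poly_mult[OF I] pcarrier_closed(7) pcarrier_closed(3) pcarrier_closed(1))
    then show "cofactor ?M i j \<in> I"
      using i j by (simp add: cofactor_def mat_delete_minor_mat generic_minor_def')
  qed
  finally show ?case .
qed

subsection \<open>The leading term of a minor\<close>

text \<open>An exchange argument: in a permutation of least weight no pair of positions can
  increase, since swapping it would lower the sum. So every minimizer is decreasing, hence is the
  reversal, and its uniqueness makes the inequality strict.\<close>

lemma sum_antidiagonal_less:
  fixes W :: "nat \<Rightarrow> nat \<Rightarrow> nat"
  assumes W: "\<And>i i' j j'. i < i' \<Longrightarrow> i' < n \<Longrightarrow> j < j' \<Longrightarrow> j' < n \<Longrightarrow> W i j' + W i' j < W i j + W i' j'"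
    and \<pi>: "\<pi> permutes {0..<n}" and ne: "\<exists>i<n. \<pi> i \<noteq> n - 1 - i"
  shows "(\<Sum>i = 0..<n. W i (n - 1 - i)) < (\<Sum>i = 0..<n. W i (\<pi> i))"
proof -
  define w where "w \<pi> = (\<Sum>i = 0..<n. W i (\<pi> i))" for \<pi>
  define P where "P = {\<pi>. \<pi> permutes {0..<n}}"
  have minimal: "\<sigma> i = n - 1 - i" if \<sigma>: "\<sigma> \<in> P" and min: "\<And>\<tau>. \<tau> \<in> P \<Longrightarrow> w \<sigma> \<le> w \<tau>" and "i < n" for \<sigma> i
  proof -
    have \<sigma>p: "\<sigma> permutes {0..<n}" using \<sigma> by (simp add: P_def)
    have dec: "\<sigma> y < \<sigma> x" if "x < y" "y < n" for x y
    proof (rule ccontr)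
      assume "\<not> \<sigma> y < \<sigma> x"
      moreover have "\<sigma> x \<noteq> \<sigma> y" using that permutes_inj[OF \<sigma>p] by (metis injD nat_neq_iff)
      ultimately have "\<sigma> x < \<sigma> y" by simp
      define \<tau> where "\<tau> = \<sigma> \<circ> transpose x y"
      have "\<tau> \<in> P" using that \<sigma>p unfolding P_def \<tau>_def
        by (auto intro!: permutes_compose permutes_swap_id)
      have split: "(\<Sum>i = 0..<n. f i) = f x + f y + (\<Sum>i \<in> {0..<n} - {x, y}. f i)"
        for f :: "nat \<Rightarrow> nat"
        using that by (subst sum.subset_diff[of "{x, y}"]) auto
      have "w \<tau> = W x (\<sigma> y) + W y (\<sigma> x) + (\<Sum>i \<in> {0..<n} - {x, y}. W i (\<tau> i))"
        unfolding w_def by (subst split) (simp add: \<tau>_def)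
      also have "(\<Sum>i \<in> {0..<n} - {x, y}. W i (\<tau> i)) = (\<Sum>i \<in> {0..<n} - {x, y}. W i (\<sigma> i))"
        by (intro sum.cong) (auto simp: \<tau>_def transpose_def)
      also have "W x (\<sigma> y) + W y (\<sigma> x) + (\<Sum>i \<in> {0..<n} - {x, y}. W i (\<sigma> i)) < w \<sigma>"
        unfolding w_def using W[OF that \<open>\<sigma> x < \<sigma> y\<close>] permutes_in_image[OF \<sigma>p, of y] that
        by (subst split) auto
      finally show False using min[OF \<open>\<tau> \<in> P\<close>] by simp
    qed
    \<comment> \<open>A strictly decreasing map of \<open>{0..<n}\<close> into itself is pinned from
      both ends: it starts at most at \<open>n - 1\<close>, ends at least at 0, and drops by at
      least 1 in each step.\<close>
    have up: "\<sigma> x + x \<le> n - 1" if "x < n" for x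
      using that
    proof (induction x)
      case 0
      then show ?case using permutes_in_image[OF \<sigma>p, of 0] by auto
    next
      case (Suc x)
      then show ?case using dec[of x "Suc x"] by auto
    qed
    have lo: "d \<le> \<sigma> (n - 1 - d)" if "d < n" for d
      using that
    proof (induction d)
      case (Suc d)
      have "n - 1 - d = Suc (n - 1 - Suc d)" using Suc.prems by simp
      moreover have "n - 1 - d < n" using Suc.prems by simp
      ultimately have "\<sigma> (n - 1 - d) < \<sigma> (n - 1 - Suc d)" by (intro dec) simp_all
      then show ?case using Suc by simp
    qed simp
    show ?thesis using up[of i] lo[of "n - 1 - i"] \<open>i < n\<close> by simp
  qed
  have fin: "finite P" "P \<noteq> {}" using \<pi> by (auto simp: P_def finite_permutations)
  obtain \<sigma> where \<sigma>: "\<sigma> \<in> P" "\<And>\<tau>. \<tau> \<in> P \<Longrightarrow> w \<sigma> \<le> w \<tau>"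
    using ex_min_if_finite[of "w ` P"] fin by (auto simp: not_less)
  have w\<sigma>: "w \<sigma> = (\<Sum>i = 0..<n. W i (n - 1 - i))"
    unfolding w_def using minimal[OF \<sigma>] by (intro sum.cong) auto
  have "\<pi> \<in> P" using \<pi> by (simp add: P_def)
  moreover have "w \<pi> \<noteq> w \<sigma>"
    using minimal[of \<pi>] \<sigma> ne \<open>\<pi> \<in> P\<close> by metis
  ultimately have "w \<sigma> < w \<pi>" using \<sigma>(2)[of \<pi>] by simp
  then show ?thesis unfolding w\<sigma> by (simp add: w_def)
qed

definition antidiagonal :: "nat set \<Rightarrow> nat set \<Rightarrow> (nat \<times> nat) \<Rightarrow>\<^sub>0 nat" where
  "antidiagonal A B = (\<Sum>i = 0..<card A. single (sl A ! i, sl B ! (card A - 1 - i)) 1)"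

text \<open>The strict inverse Monge condition: in each 2-minor the antidiagonal term is lighter
  than the diagonal one. By exchange this passes to minors of every size.\<close>

definition monge_on :: "(nat \<times> nat) set \<Rightarrow> (nat \<times> nat \<Rightarrow> nat) \<Rightarrow> bool" where
  "monge_on X \<omega> \<longleftrightarrow> (\<forall>i i' j j'. i < i' \<longrightarrow> j < j' \<longrightarrow> {(i, j), (i', j'), (i, j'), (i', j)} \<subseteq> X \<longrightarrow>
     \<omega> (i, j') + \<omega> (i', j) < \<omega> (i, j) + \<omega> (i', j'))"

lemma generic_minor_expand:
  assumes "card A = card B"
  shows "generic_minor A B = (\<Sum>\<pi> | \<pi> permutes {0..<card A}.
     single (\<Sum>i = 0..<card A. single (sl A ! i, sl B ! \<pi> i) 1) (signof \<pi> :: 'k::field))"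
proof -
  have prod: "(\<Prod>i\<in>X. mvar (f i)) = (single (\<Sum>i\<in>X. single (f i) 1) 1 :: 'k cell_poly)"
    for X :: "nat set" and f
    by (induction X rule: infinite_finite_induct) (simp_all add: mvar_def mult_single)
  have sign: "signof \<pi> * single m 1 = (single m (signof \<pi>) :: 'k cell_poly)" for \<pi> :: "nat \<Rightarrow> nat"
    and m
    by (cases \<pi> rule: sign_cases) (simp_all add: single_uminus)
  show ?thesis
    unfolding generic_minor_def' det_def'[OF minor_mat_carrier[OF refl assms[symmetric]]]
  proof (rule sum.cong[OF refl])
    fix \<pi> assume "\<pi> \<in> {\<pi>. \<pi> permutes {0..<card A}}"
    then have "\<pi> permutes {0..<card A}" by simp
    then have "(\<Prod>i = 0..<card A. (minor_mat A B :: 'k cell_poly mat) $$ (i, \<pi> i))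
        = (\<Prod>i = 0..<card A. mvar (sl A ! i, sl B ! \<pi> i))"
      using permutes_in_image[of \<pi> "{0..<card A}"] assms
      by (intro prod.cong) (auto simp: minor_mat_def)
    then show "signof \<pi> * (\<Prod>i = 0..<card A. minor_mat A B $$ (i, \<pi> i))
        = single (\<Sum>i = 0..<card A. single (sl A ! i, sl B ! \<pi> i) 1) (signof \<pi> :: 'k)"
      by (simp add: prod sign)
  qed
qed

lemma degree_generic_minor:
  assumes "card A = card B" "m \<in> keys (generic_minor A B :: 'k::field cell_poly)"
  shows "monom_degree m = card A"
proof -
  obtain \<pi> :: "nat \<Rightarrow> nat" where "m = (\<Sum>i = 0..<card A. single (sl A ! i, sl B ! \<pi> i) 1)"
    using assms(2) keys_sum unfolding generic_minor_expand[OF assms(1)] by (force split: if_splits)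
  then show ?thesis by (simp add: monom_degree_eq_weight weight_sum)
qed

text \<open>By \<open>sum_antidiagonal_less\<close> each Leibniz term other than the reversal is
  heavier; those terms need not be compared with one another. The coefficient is a sign, hence its
  own inverse, which is what the division algorithm uses.\<close>

lemma leads_generic_minor:
  assumes "card A = card B" "monge_on (A \<times> B) \<omega>"
  obtains a where "leads \<omega> (generic_minor A B) (antidiagonal A B) a" "a = 1 \<or> a
    = (- 1 :: 'k::field)"
proof -
  define n where "n = card A"
  \<comment> \<open>The reversal is continued by the identity, as \<open>permutes\<close> demands
    fixed points outside \<open>{0..<n}\<close>.\<close>
  define rv where "rv i = (if i < n then n - 1 - i else i)" for i :: nat
  define mon where "mon \<pi> = (\<Sum>i = 0..<n. single (sl A ! i, sl B ! \<pi> i) (1::nat))"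
    for \<pi> :: "nat \<Rightarrow> nat"
  have rv: "rv permutes {0..<n}"
    by (rule bij_imp_permutes, rule bij_betw_byWitness[of _ rv]) (auto simp: rv_def)
  have anti: "mon rv = antidiagonal A B"
    unfolding mon_def antidiagonal_def by (intro sum.cong) (auto simp: rv_def n_def)
  let ?g = "\<Sum>\<pi> \<in> {\<pi>. \<pi> permutes {0..<n}} - {rv}. single (mon \<pi>) (signof \<pi> :: 'k)"
  have eq: "generic_minor A B = single (mon rv) (signof rv :: 'k) + ?g"
    unfolding generic_minor_expand[OF assms(1)] mon_def[symmetric] n_def[symmetric]
    using rv by (intro sum.remove) (auto simp: finite_permutations)
  have "weight \<omega> (mon rv) < weight \<omega> m" if m: "m \<in> keys ?g" for m
  proof -
    obtain \<pi> where \<pi>: "\<pi> permutes {0..<n}" "\<pi> \<noteq> rv" "m = mon \<pi>"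
      using m keys_sum[of "\<lambda>\<pi>. single (mon \<pi>) (signof \<pi> :: 'k)" "{\<pi>. \<pi> permutes {0..<n}} - {rv}"]
      by (force split: if_splits)
    have w: "weight \<omega> (mon \<pi>) = (\<Sum>i = 0..<n. \<omega> (sl A ! i, sl B ! \<pi> i))" for \<pi>
      by (simp add: mon_def weight_sum)
    have "\<exists>i<n. \<pi> i \<noteq> n - 1 - i"
    proof (rule ccontr)
      assume "\<not> (\<exists>i<n. \<pi> i \<noteq> n - 1 - i)"
      then have "\<pi> i = rv i" for i
        using permutes_not_in[OF \<pi>(1), of i] by (auto simp: rv_def)
      then show False using \<pi>(2) by blast
    qed
    then have "(\<Sum>i = 0..<n. \<omega> (sl A ! i, sl B ! (n - 1 - i))) < (\<Sum>i = 0..<n. \<omega> (sl A ! i,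
      sl B ! \<pi> i))"
    proof (rule sum_antidiagonal_less[where W = "\<lambda>i j. \<omega> (sl A ! i, sl B ! j)", OF _ \<pi>(1), rotated])
      fix i i' j j' assume "i < i'" "i' < n" "j < j'" "j' < n"
      then show "\<omega> (sl A ! i, sl B ! j') + \<omega> (sl A ! i', sl B ! j)
          < \<omega> (sl A ! i, sl B ! j) + \<omega> (sl A ! i', sl B ! j')"
        using assms sl_nth_mono[of i i' A] sl_nth_mono[of j j' B] sl_nth_in[of i A]
          sl_nth_in[of i' A]
          sl_nth_in[of j B] sl_nth_in[of j' B]
        unfolding monge_on_def n_def by auto
    qed
    moreover have "(\<Sum>i = 0..<n. \<omega> (sl A ! i, sl B ! (n - 1 - i))) = weight \<omega> (mon rv)"
      unfolding w by (intro sum.cong) (auto simp: rv_def)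
    ultimately show ?thesis using \<pi>(3) w by simp
  qed
  then have "leads \<omega> (generic_minor A B) (antidiagonal A B) (signof rv :: 'k)"
    unfolding leads_iff anti[symmetric] using eq by blast
  moreover have "signof rv = (1::'k) \<or> signof rv = (- 1 :: 'k)"
    by (cases rv rule: sign_cases) simp_all
  ultimately show ?thesis by (rule that)
qed

section \<open>Weights with prescribed tight positions\<close>

text \<open>Tropical rank one matrices: a matrix with entries \<open>x^(\<alpha> i + \<beta> j)\<close> can attain the weights
  exactly on any prescribed set without strict antidiagonal pairs.\<close>

lemma monge_potential:
  fixes W :: "nat \<Rightarrow> nat \<Rightarrow> nat"
  assumes monge: "\<And>i i' j j'. i < i' \<Longrightarrow> j < j' \<Longrightarrow> W i j' + W i' j \<le> W i j + W i' j'"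
    and mono: "\<And>i j. W i j \<le> W (Suc i) j" "\<And>i j. W i j \<le> W i (Suc j)"
    and S: "\<And>i j i' j'. (i, j) \<in> S \<Longrightarrow> (i', j') \<in> S \<Longrightarrow> i < i' \<Longrightarrow> j \<le> j'"
  shows "\<exists>\<alpha> \<beta>. (\<forall>i\<le>k. \<forall>j\<le>l. W i j \<le> \<alpha> i + \<beta> j \<and> ((i, j) \<in> insert (k, l) S \<longrightarrow> W i j = \<alpha> i + \<beta> j))"
proof (induction "k + l" arbitrary: k l)
  case 0
  then show ?case by (intro exI[of _ "\<lambda>_. W 0 0"] exI[of _ "\<lambda>_. 0"]) simp
next
  case (Suc n)
  \<comment> \<open>\<open>S\<close> has no strict antidiagonal pairs, so the last column or the
    last row contains no cell of \<open>S\<close> except possibly \<open>(k, l)\<close> and can be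
    split off. Keeping \<open>(k, l)\<close> tight even if it is not in \<open>S\<close> is what
    drives the induction.\<close>
  consider (col) l' where "l = Suc l'" "\<forall>i<k. (i, l) \<notin> S" | (row) k'
    where "k = Suc k'" "\<forall>j<l. (k, j) \<notin> S"
  proof (cases "l = 0 \<or> (\<exists>i<k. (i, l) \<in> S)")
    case True
    have "\<forall>j<l. (k, j) \<notin> S" using True S by fastforce
    moreover obtain k' where "k = Suc k'" using True Suc.hyps(2) by (cases k) auto
    ultimately show ?thesis by (rule that(2)[rotated])
  next
    case False
    then obtain l' where "l = Suc l'" by (cases l) auto
    then show ?thesis using False by (intro that(1)) auto
  qed
  then show ?case
  proof cases
    case col
    then have "n = k + l'" using Suc.hyps(2) by simp
    from Suc.hyps(1)[OF this] obtain \<alpha> \<beta> where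
      le: "\<And>i j. i \<le> k \<Longrightarrow> j \<le> l' \<Longrightarrow> W i j \<le> \<alpha> i + \<beta> j" and
      eq: "\<And>i j. i \<le> k \<Longrightarrow> j \<le> l' \<Longrightarrow> (i, j) \<in> insert (k, l') S \<Longrightarrow> W i j = \<alpha> i + \<beta> j"
      by blast
    have kl': "W k l' = \<alpha> k + \<beta> l'" using eq by simp
    \<comment> \<open>Tightness at \<open>(k, l)\<close> forces this value, and the subtraction is
      exact since \<open>W k l\<close> is at least \<open>W k l' = \<alpha> k + \<beta> l'\<close>.
      The Monge inequality and the tight cell \<open>(k, l')\<close> then bound the rest of the new
      column.\<close>
    define \<beta>' where "\<beta>' = \<beta>(l := W k l - \<alpha> k)"
    have kl: "W k l = \<alpha> k + \<beta>' l" using mono(2)[of k l'] kl' col by (simp add: \<beta>'_def)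
    have top: "W i l \<le> \<alpha> i + \<beta>' l" if "i < k" for i
      using monge[OF that, of l' l] le[of i l'] that kl kl' col by simp
    have "W i j \<le> \<alpha> i + \<beta>' j \<and> ((i, j) \<in> insert (k, l) S \<longrightarrow> W i j = \<alpha> i + \<beta>' j)"
      if "i \<le> k" "j \<le> l" for i j
    proof (cases "j = l")
      case True
      then show ?thesis using top[of i] that kl col by (cases "i = k") auto
    next
      case False
      then have "j \<le> l'" "\<beta>' j = \<beta> j" using that col by (auto simp: \<beta>'_def)
      then show ?thesis using le[of i j] eq[of i j] that False by auto
    qed
    then show ?thesis by blast
  next
    case row
    then have "n = k' + l" using Suc.hyps(2) by simp
    from Suc.hyps(1)[OF this] obtain \<alpha> \<beta> where
      le: "\<And>i j. i \<le> k' \<Longrightarrow> j \<le> l \<Longrightarrow> W i j \<le> \<alpha> i + \<beta> j" and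
      eq: "\<And>i j. i \<le> k' \<Longrightarrow> j \<le> l \<Longrightarrow> (i, j) \<in> insert (k', l) S \<Longrightarrow> W i j = \<alpha> i + \<beta> j"
      by blast
    have kl': "W k' l = \<alpha> k' + \<beta> l" using eq by simp
    define \<alpha>' where "\<alpha>' = \<alpha>(k := W k l - \<beta> l)"
    have kl: "W k l = \<alpha>' k + \<beta> l" using mono(1)[of k' l] kl' row by (simp add: \<alpha>'_def)
    have left: "W k j \<le> \<alpha>' k + \<beta> j" if "j < l" for j
      using monge[of k' k j l] le[of k' j] that kl kl' row by simp
    have "W i j \<le> \<alpha>' i + \<beta> j \<and> ((i, j) \<in> insert (k, l) S \<longrightarrow> W i j = \<alpha>' i + \<beta> j)"
      if "i \<le> k" "j \<le> l" for i j
    proof (cases "i = k")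
      case True
      then show ?thesis using left[of j] that kl row by (cases "j = l") auto
    next
      case False
      then have "i \<le> k'" "\<alpha>' i = \<alpha> i" using that row by (auto simp: \<alpha>'_def)
      then show ?thesis using le[of i j] eq[of i j] that False by auto
    qed
    then show ?thesis by blast
  qed
qed

text \<open>Strict growth in both directions lets the potentials be natural numbers: it makes the
  subtractions in \<open>monge_potential\<close> exact.\<close>

definition good_weight :: "(nat \<times> nat \<Rightarrow> nat) \<Rightarrow> bool" where
  "good_weight \<omega> \<longleftrightarrow> monge_on UNIV \<omega> \<and> (\<forall>i j. \<omega> (i, j) < \<omega> (Suc i, j) \<and> \<omega> (i, j) < \<omega> (i, Suc j))"

lemma good_weight_potential:
  assumes "good_weight \<omega>"
    and S: "\<And>i j i' j'. (i, j) \<in> S \<Longrightarrow> (i', j') \<in> S \<Longrightarrow> i < i' \<Longrightarrow> j \<le> j'"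
  obtains \<alpha> \<beta> :: "nat \<Rightarrow> nat" where
    "\<And>i j. i \<le> k \<Longrightarrow> j \<le> l \<Longrightarrow> (i, j) \<in> S \<Longrightarrow> \<alpha> i + \<beta> j = 2 * \<omega> (i, j)"
    "\<And>i j. i \<le> k \<Longrightarrow> j \<le> l \<Longrightarrow> (i, j) \<notin> S \<Longrightarrow> 2 * \<omega> (i, j) < \<alpha> i + \<beta> j"
proof -
  \<comment> \<open>Doubling makes room for strictness. Off \<open>S\<close> one unit is added; the
    Monge gap, at least 2 after doubling, absorbs the two units that can appear on the smaller
    side.\<close>
  define W where "W i j = 2 * \<omega> (i, j) + (if (i, j) \<in> S then 0 else 1)" for i j
  have "W i j' + W i' j \<le> W i j + W i' j'" if "i < i'" "j < j'" for i i' j j'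
  proof -
    have "\<omega> (i, j') + \<omega> (i', j) < \<omega> (i, j) + \<omega> (i', j')"
      using assms(1) that by (simp add: good_weight_def monge_on_def)
    then show ?thesis by (simp add: W_def)
  qed
  moreover have "W i j \<le> W (Suc i) j" "W i j \<le> W i (Suc j)" for i j
  proof -
    have "\<omega> (i, j) < \<omega> (Suc i, j)" "\<omega> (i, j) < \<omega> (i, Suc j)"
      using assms(1) by (simp_all add: good_weight_def)
    then show "W i j \<le> W (Suc i) j" "W i j \<le> W i (Suc j)" by (simp_all add: W_def)
  qed
  ultimately obtain \<alpha> \<beta> where ab: "\<forall>i\<le>k. \<forall>j\<le>l. W i j \<le> \<alpha> i + \<beta> j \<and>
      ((i, j) \<in> insert (k, l) S \<longrightarrow> W i j = \<alpha> i + \<beta> j)"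
    using monge_potential[of W S k l] S by metis
  show ?thesis
  proof (rule that)
    fix i j assume "i \<le> k" "j \<le> l" "(i, j) \<in> S"
    then have "W i j = \<alpha> i + \<beta> j" using ab by blast
    then show "\<alpha> i + \<beta> j = 2 * \<omega> (i, j)" using \<open>(i, j) \<in> S\<close> by (simp add: W_def)
  next
    fix i j assume "i \<le> k" "j \<le> l" "(i, j) \<notin> S"
    then have "W i j \<le> \<alpha> i + \<beta> j" using ab by blast
    then show "2 * \<omega> (i, j) < \<alpha> i + \<beta> j" using \<open>(i, j) \<notin> S\<close> by (simp add: W_def)
  qed
qed

section \<open>Weights separating the monomials of bounded degree\<close>

lemma digits_unique:
  fixes f g :: "nat \<Rightarrow> nat"
  assumes "\<And>a. a < n \<Longrightarrow> f a < N" "\<And>a. a < n \<Longrightarrow> g a < N" "(\<Sum>a<n. N ^ a * f a) = (\<Sum>a<n. N ^ a * g a)"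
  shows "\<forall>a<n. f a = g a"
proof -
  have bound: "(\<Sum>a<n. N ^ a * f a) < N ^ n" if "\<And>a. a < n \<Longrightarrow> f a < N" for f n
    using that
  proof (induction n)
    case (Suc n)
    then have "(\<Sum>a<n. N ^ a * f a) < N ^ n" "f n < N" by simp_all
    then have "(\<Sum>a<Suc n. N ^ a * f a) < N ^ n + N ^ n * f n" by simp
    also have "\<dots> = N ^ n * Suc (f n)" by simp
    also have "\<dots> \<le> N ^ n * N" using \<open>f n < N\<close> by (intro mult_left_mono) auto
    finally show ?case by (simp add: mult.commute)
  qed simp
  show ?thesis
    using assms
  proof (induction n)
    case (Suc n)
    have b: "(\<Sum>a<n. N ^ a * f a) < N ^ n" "(\<Sum>a<n. N ^ a * g a) < N ^ n"
      using bound[of n] Suc.prems by simp_all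
    have eq: "(\<Sum>a<n. N ^ a * f a) + N ^ n * f n = (\<Sum>a<n. N ^ a * g a) + N ^ n * g n"
      using Suc.prems(3) by simp
    have div: "(r + P * x) div P = x" if "r < P" for r P x :: nat
      using that by (simp add: div_mult_self2)
    have "f n = g n" using div[OF b(1), of "f n"] div[OF b(2), of "g n"] eq by simp
    moreover have "\<forall>a<n. f a = g a" using Suc eq \<open>f n = g n\<close> by simp
    ultimately show ?case by (simp add: less_Suc_eq)
  qed simp
qed

text \<open>The product of the shifted indices is strictly inverse Monge and strictly increasing. It
  is scaled by \<open>N ^ E\<close>, and a digit \<open>N ^ enc x\<close> is added for each cell of
  \<open>X\<close>, so that the weight modulo \<open>N ^ E\<close> reveals all exponents of a
  monomial of degree at most \<open>D\<close>.\<close>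

lemma good_weight_exists:
  assumes "finite X"
  obtains \<omega> where "good_weight \<omega>"
    "\<And>m n. keys m \<subseteq> X \<Longrightarrow> keys n \<subseteq> X \<Longrightarrow> monom_degree m \<le> D \<Longrightarrow>
      monom_degree n \<le> D \<Longrightarrow> weight \<omega> m = weight \<omega> n \<Longrightarrow> m = n"
proof -
  \<comment> \<open>Exponents are at most \<open>D\<close>, hence base \<open>N\<close> digits. The
    summand 3 gives \<open>3 * g x \<le> N ^ E\<close>, so that two perturbations together stay
    below the gap \<open>N ^ E\<close> of the main term.\<close>
  define E N where "E = card X" and "N = D + 3"
  obtain enc where enc: "bij_betw enc X {..<E}"
    using ex_bij_betw_finite_nat[OF assms] by (auto simp: E_def lessThan_atLeast0)
  define g where "g x = (if x \<in> X then N ^ enc x else 0)" for x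
  define \<omega> where "\<omega> x = N ^ E * (Suc (fst x) * Suc (snd x)) + g x" for x
  have g: "3 * g x \<le> N ^ E" for x
  proof (cases "x \<in> X")
    case True
    then have "enc x < E" using enc by (auto simp: bij_betw_def)
    have "3 * N ^ enc x \<le> N ^ Suc (enc x)" by (simp add: N_def)
    also have "\<dots> \<le> N ^ E" using \<open>enc x < E\<close> by (intro power_increasing) (auto simp: N_def)
    finally show ?thesis using True by (simp add: g_def)
  qed (simp add: g_def)
  have "N ^ E > 0" by (simp add: N_def)
  have "good_weight \<omega>"
    unfolding good_weight_def monge_on_def
  proof (intro conjI allI impI)
    fix i i' j j' :: nat assume "i < i'" "j < j'"
    then obtain a b where ab: "i' = i + Suc a" "j' = j + Suc b"
      by (metis add_Suc_right less_iff_Suc_add)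
    have "Suc i * Suc j' + Suc i' * Suc j + 1 \<le> Suc i * Suc j + Suc i' * Suc j'"
      unfolding ab by (simp add: algebra_simps)
    then have "N ^ E * (Suc i * Suc j' + Suc i' * Suc j + 1) \<le> N ^ E * (Suc i * Suc j
      + Suc i' * Suc j')"
      by (rule mult_left_mono) simp
    then have "N ^ E * (Suc i * Suc j') + N ^ E * (Suc i' * Suc j) + N ^ E
        \<le> N ^ E * (Suc i * Suc j) + N ^ E * (Suc i' * Suc j')"
      by (simp only: distrib_left mult_1_right)
    moreover have "g (i, j') + g (i', j) < N ^ E"
      using g[of "(i, j')"] g[of "(i', j)"] \<open>N ^ E > 0\<close> by linarith
    ultimately show "\<omega> (i, j') + \<omega> (i', j) < \<omega> (i, j) + \<omega> (i', j')"
      unfolding \<omega>_def fst_conv snd_conv by linarith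
  next
    fix i j
    have "g (i, j) < N ^ E" using g[of "(i, j)"] \<open>N ^ E > 0\<close> by linarith
    moreover have "N ^ E * (Suc i * Suc j) + N ^ E \<le> N ^ E * (Suc (Suc i) * Suc j)"
      "N ^ E * (Suc i * Suc j) + N ^ E \<le> N ^ E * (Suc i * Suc (Suc j))"
      by (simp_all add: algebra_simps)
    ultimately show "\<omega> (i, j) < \<omega> (Suc i, j)" "\<omega> (i, j) < \<omega> (i, Suc j)"
      unfolding \<omega>_def fst_conv snd_conv by linarith+
  qed
  moreover have "m = n" if m: "keys m \<subseteq> X" "monom_degree m \<le> D"
    and n: "keys n \<subseteq> X" "monom_degree n \<le> D" and eq: "weight \<omega> m = weight \<omega> n" for m n
  proof -
    define dec where "dec = the_inv_into X enc"
    have dec: "bij_betw dec {..<E} X" "\<And>a. a < E \<Longrightarrow> enc (dec a) = a"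
      using enc unfolding dec_def by (auto intro: bij_betw_the_inv_into f_the_inv_into_f_bij_betw)
    have B: "(\<Sum>x\<in>X. g x * lookup m x) = (\<Sum>a<E. N ^ a * lookup m (dec a))" for m
    proof -
      have "(\<Sum>x\<in>X. g x * lookup m x) = (\<Sum>a<E. g (dec a) * lookup m (dec a))"
        by (rule sum.reindex_bij_betw[symmetric, OF dec(1)])
      also have "\<dots> = (\<Sum>a<E. N ^ a * lookup m (dec a))"
        using dec by (intro sum.cong) (auto simp: g_def bij_betw_def)
      finally show ?thesis .
    qed
    have digit: "lookup m x \<le> monom_degree m" for m :: "nat \<times> nat \<Rightarrow>\<^sub>0 nat" and x
    proof (cases "x \<in> keys m")
      case True
      then show ?thesis unfolding monom_degree_def by (intro member_le_sum) auto
    qed (simp add: in_keys_iff)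
    have w: "\<exists>A. weight \<omega> m = N ^ E * A + (\<Sum>a<E. N ^ a * lookup m (dec a))"
      if "keys m \<subseteq> X" for m
    proof -
      have "weight \<omega> m = N ^ E * (\<Sum>x\<in>X. Suc (fst x) * Suc (snd x) * lookup m x)
          + (\<Sum>x\<in>X. g x * lookup m x)"
        unfolding weight_eq[OF assms that] \<omega>_def
        by (simp add: distrib_right sum.distrib sum_distrib_left mult.assoc del: mult_Suc
          mult_Suc_right)
      then show ?thesis unfolding B by blast
    qed
    have small: "(\<Sum>a<E. N ^ a * lookup m (dec a)) < N ^ E" if "monom_degree m \<le> D"
      for m :: "nat \<times> nat \<Rightarrow>\<^sub>0 nat"
    proof -
      have "(\<Sum>a<e. N ^ a * lookup m (dec a)) < N ^ e" for e
      proof (induction e)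
        case (Suc e)
        have "lookup m (dec e) < N" using digit[of m "dec e"] that by (simp add: N_def)
        have "(\<Sum>a<Suc e. N ^ a * lookup m (dec a)) < N ^ e + N ^ e * lookup m (dec e)"
          using Suc by simp
        also have "\<dots> = N ^ e * Suc (lookup m (dec e))" by simp
        also have "\<dots> \<le> N ^ e * N"
          using \<open>lookup m (dec e) < N\<close> by (intro mult_left_mono) auto
        finally show ?case by (simp add: mult.commute)
      qed simp
      then show ?thesis .
    qed
    obtain A A' where "weight \<omega> m = N ^ E * A + (\<Sum>a<E. N ^ a * lookup m (dec a))"
      "weight \<omega> n = N ^ E * A' + (\<Sum>a<E. N ^ a * lookup n (dec a))"
      using w[OF m(1)] w[OF n(1)] by blast
    then have "(N ^ E * A + (\<Sum>a<E. N ^ a * lookup m (dec a))) mod N ^ E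
        = (N ^ E * A' + (\<Sum>a<E. N ^ a * lookup n (dec a))) mod N ^ E"
      using eq by simp
    then have "(\<Sum>a<E. N ^ a * lookup m (dec a)) = (\<Sum>a<E. N ^ a * lookup n (dec a))"
      using small[OF m(2)] small[OF n(2)] by simp
    then have "\<forall>a<E. lookup m (dec a) = lookup n (dec a)"
    proof (intro digits_unique[of E _ N])
      show "lookup m (dec a) < N" "lookup n (dec a) < N" for a
        using digit[of m "dec a"] digit[of n "dec a"] m(2) n(2) by (simp_all add: N_def)
    qed
    then have "\<forall>x\<in>X. lookup m x = lookup n x"
      using dec(1) by (auto simp: bij_betw_def)
    then show "m = n"
      using m(1) n(1) by (intro poly_mapping_eqI) (metis in_keys_iff subsetD)
  qed
  ultimately show ?thesis by (rule that) blast+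
qed

section \<open>Evaluation in one variable\<close>

text \<open>For \<open>a = 0\<close> this only says that \<open>p\<close> is divisible by the power
  \<open>Suc n\<close> of the variable, which keeps estimates of sums and products uniform.\<close>

definition lowest :: "nat \<Rightarrow> 'k \<Rightarrow> 'k::field poly \<Rightarrow> bool" where
  "lowest n a p \<longleftrightarrow> (\<exists>q. p = monom a n + monom 1 (Suc n) * q)"

lemma lowest_monom: "lowest n a (monom a n)"
  unfolding lowest_def by (rule exI[of _ 0]) simp

lemma lowest_higher:
  assumes "lowest n a p" "n' < n"
  shows "lowest n' 0 p"
proof -
  obtain q where q: "p = monom a n + monom 1 (Suc n) * q" using assms(1) lowest_def by blast
  obtain e where e: "n = Suc n' + e" using assms(2) less_iff_Suc_add by (metis add_Suc)
  have "p = monom 1 (Suc n') * (monom a e + monom 1 (Suc e) * q)"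
    by (simp add: q e distrib_left mult_monom mult.assoc[symmetric])
  then show ?thesis unfolding lowest_def by auto
qed

lemma lowest_add: "lowest n a p \<Longrightarrow> lowest n b q \<Longrightarrow> lowest n (a + b) (p + q)"
  unfolding lowest_def
proof (elim exE)
  fix r s assume "p = monom a n + monom 1 (Suc n) * r" "q = monom b n + monom 1 (Suc n) * s"
  then have "p + q = monom (a + b) n + monom 1 (Suc n) * (r + s)"
    by (simp add: add_monom[symmetric] distrib_left)
  then show "\<exists>r. p + q = monom (a + b) n + monom 1 (Suc n) * r" by blast
qed

lemma lowest_zero: "lowest n 0 0"
  unfolding lowest_def by (rule exI[of _ 0]) simp

lemma lowest_sum: "(\<And>x. x \<in> X \<Longrightarrow> lowest n (a x) (p x)) \<Longrightarrow> lowest n (sum a X) (sum p X)"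
  by (induction X rule: infinite_finite_induct) (auto intro: lowest_zero lowest_add)

lemma lowest_mult: "lowest n a p \<Longrightarrow> lowest n' b q \<Longrightarrow> lowest (n + n') (a * b) (p * q)"
  unfolding lowest_def
proof (elim exE)
  fix r s assume p: "p = monom a n + monom 1 (Suc n) * r"
    and q: "q = monom b n' + monom 1 (Suc n') * s"
  have "p * q = monom (a * b) (n + n') + monom 1 (Suc (n + n')) * (monom a 0 * s + monom b 0 * r
    + monom 1 1 * (r * s))"
  proof -
    have m: "monom a n = monom a 0 * monom 1 n" "monom b n' = monom b 0 * monom 1 n'"
      "monom (a * b) (n + n') = monom a 0 * monom b 0 * monom 1 n * monom 1 n'"
      "monom (1::'a) (Suc n) = monom 1 1 * monom 1 n" "monom (1::'a) (Suc n')
        = monom 1 1 * monom 1 n'"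
      "monom (1::'a) (Suc (n + n')) = monom 1 1 * monom 1 n * monom 1 n'"
      by (simp_all add: mult_monom)
    show ?thesis unfolding p q m by (simp add: algebra_simps)
  qed
  then show "\<exists>r. p * q = monom (a * b) (n + n') + monom 1 (Suc (n + n')) * r" by blast
qed

lemma lowest_one: "lowest 0 1 1"
  using lowest_monom[of 0 1] by simp

lemma lowest_power: "lowest n a p \<Longrightarrow> lowest (n * e) (a ^ e) (p ^ e)"
  by (induction e) (auto intro: lowest_one lowest_mult)

lemma lowest_prod: "(\<And>x. x \<in> X \<Longrightarrow> lowest (n x) (a x) (p x)) \<Longrightarrow> lowest (sum n X) (prod a X) (prod p X)"
  by (induction X rule: infinite_finite_induct) (auto intro: lowest_one lowest_mult)

lemma lowest_nonzero: "lowest n a p \<Longrightarrow> a \<noteq> 0 \<Longrightarrow> p \<noteq> 0"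
proof -
  assume "lowest n a p" "a \<noteq> 0"
  then obtain q where "p = monom a n + monom 1 (Suc n) * q" by (auto simp: lowest_def)
  then have "coeff p n = a" by (simp add: coeff_monom_mult)
  then show "p \<noteq> 0" using \<open>a \<noteq> 0\<close> by auto
qed

lemma comm_ring_hom_const_poly: "comm_ring_hom (\<lambda>a. monom (a :: 'k::field) 0)"
  by unfold_locales (simp_all add: add_monom mult_monom)

text \<open>A monomial \<open>n\<close> goes to order at least \<open>e * weight \<omega> n\<close>.
  Variables of \<open>m\<close> attain their order with coefficient 1 and all others exceed it, so
  at order \<open>e * weight \<omega> m\<close> only the leading term is left. The factor
  \<open>e\<close> accommodates the doubled weights of the potentials.\<close>

lemma leads_eval_nonzero:
  fixes f :: "('v, 'k::field) mpoly"
  assumes lead: "leads \<omega> f m a" "a \<noteq> 0" and f: "f \<in> pcarrier V" and "0 < e"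
    and s: "\<And>x. x \<in> V \<Longrightarrow> lowest (e * \<omega> x) (if x \<in> keys m then 1 else 0) (s x)"
  shows "mpoly_eval (\<lambda>a. monom a 0) s f \<noteq> 0"
proof -
  define b :: "'v \<Rightarrow> 'k" where "b x = (if x \<in> keys m then 1 else 0)" for x
  have mon: "lowest (e * weight \<omega> n) (\<Prod>x\<in>keys n. b x ^ lookup n x) (monom_eval s n)"
    if "keys n \<subseteq> V" for n
  proof -
    have "lowest (\<Sum>x\<in>keys n. e * \<omega> x * lookup n x)
        (\<Prod>x\<in>keys n. b x ^ lookup n x) (monom_eval s n)"
      unfolding monom_eval_def b_def using that by (intro lowest_prod lowest_power s) auto
    then show ?thesis by (simp add: weight_def sum_distrib_left mult.assoc)
  qed
  have trm: "lowest (e * weight \<omega> m) (if n = m then a else 0)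
      (monom (lookup f n) 0 * monom_eval s n)" if n: "n \<in> keys f" for n
  proof -
    have "keys n \<subseteq> V" using f n by simp
    from lowest_mult[OF lowest_monom mon[OF this], of 0 "lookup f n"]
    have low: "lowest (e * weight \<omega> n) (lookup f n * (\<Prod>x\<in>keys n. b x ^ lookup n x))
        (monom (lookup f n) 0 * monom_eval s n)" by simp
    show ?thesis
    proof (cases "n = m")
      case True
      then show ?thesis using low lead(1) by (simp add: b_def leads_def)
    next
      case False
      then have "e * weight \<omega> m < e * weight \<omega> n" using lead(1) n \<open>0 < e\<close> by (simp add: leads_def)
      then show ?thesis using lowest_higher[OF low] False by simp
    qed
  qed
  have "lowest (e * weight \<omega> m) (\<Sum>n\<in>keys f. if n = m then a else 0) (mpoly_eval (\<lambda>a.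
    monom a 0) s f)"
    unfolding mpoly_eval_def by (intro lowest_sum trm)
  moreover have "m \<in> keys f" using lead by (simp add: leads_def in_keys_iff)
  ultimately have "lowest (e * weight \<omega> m) a (mpoly_eval (\<lambda>a. monom a 0) s f)" by simp
  then show ?thesis using lead(2) by (rule lowest_nonzero)
qed

section \<open>Descending chains and their levels\<close>

text \<open>Cells run from top right to bottom left, the order in which the antidiagonal of a minor
  is read.\<close>

definition desc :: "(nat \<times> nat) list \<Rightarrow> bool" where
  "desc ps \<longleftrightarrow> sorted_wrt (\<lambda>p p'. fst p < fst p' \<and> snd p' < snd p) ps"

lemma desc_antidiagonal:
  assumes "desc ps"
  shows "card (fst ` set ps) = length ps" "card (snd ` set ps) = length ps"
    "antidiagonal (fst ` set ps) (snd ` set ps) = (\<Sum>p\<in>set ps. single p 1)"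
proof -
  have "sorted_wrt (<) (map fst ps)" and "sorted_wrt (<) (rev (map snd ps))"
    using assms unfolding desc_def sorted_wrt_map sorted_wrt_rev
    by (auto elim: sorted_wrt_mono_rel[rotated])
  then have A: "sl (fst ` set ps) = map fst ps" and B: "sl (snd ` set ps) = rev (map snd ps)"
    using sorted_list_of_set.idem_if_sorted_distinct[of "map fst ps"]
      sorted_list_of_set.idem_if_sorted_distinct[of "rev (map snd ps)"]
    by (simp_all add: strict_sorted_iff)
  show cA: "card (fst ` set ps) = length ps" using A by (metis length_map length_sorted_list_of_set)
  show "card (snd ` set ps) = length ps" using B
    by (metis length_map length_rev length_sorted_list_of_set)
  have dist: "distinct ps"
    using \<open>sorted_wrt (<) (map fst ps)\<close> by (metis distinct_map strict_sorted_iff)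
  have "antidiagonal (fst ` set ps) (snd ` set ps) = (\<Sum>i = 0..<length ps. single (ps ! i) 1)"
    unfolding antidiagonal_def cA A B by (intro sum.cong) (auto simp: rev_nth)
  also have "\<dots> = (\<Sum>p\<leftarrow>ps. single p 1)"
    by (simp add: sum_list_sum_nth)
  also have "\<dots> = (\<Sum>p\<in>set ps. single p 1)"
    by (rule sum_list_distinct_conv_sum_set[OF dist])
  finally show "antidiagonal (fst ` set ps) (snd ` set ps) = (\<Sum>p\<in>set ps. single p 1)" .
qed

definition chain :: "(nat \<times> nat) set \<Rightarrow> nat \<times> nat \<Rightarrow> nat \<Rightarrow> bool" where
  "chain F x q \<longleftrightarrow> (\<exists>ps. length ps = Suc q \<and> desc ps \<and> set ps \<subseteq> F \<and> last ps = x)"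

text \<open>The rank in the antidiagonal order, as in Mirsky's theorem. Cells of equal level form no
  strict antidiagonal pair, which is the condition on \<open>S\<close> in
  \<open>monge_potential\<close>.\<close>

definition level :: "(nat \<times> nat) set \<Rightarrow> nat \<times> nat \<Rightarrow> nat" where
  "level F x = Max {q. chain F x q}"

lemma desc_distinct: "desc ps \<Longrightarrow> distinct ps"
  unfolding desc_def by (induction ps) auto

lemma finite_chain: "finite F \<Longrightarrow> finite {q. chain F x q}"
proof (rule finite_subset[of _ "{..card F}"])
  show "{q. chain F x q} \<subseteq> {..card F}" if "finite F"
  proof
    fix q assume "q \<in> {q. chain F x q}"
    then obtain ps where ps: "length ps = Suc q" "desc ps" "set ps \<subseteq> F" by (auto simp: chain_def)
    then have "Suc q = card (set ps)" using distinct_card[OF desc_distinct] by metis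
    also have "\<dots> \<le> card F" using ps(3) that by (simp add: card_mono)
    finally show "q \<in> {..card F}" by simp
  qed
qed simp

lemma chain_level: "finite F \<Longrightarrow> x \<in> F \<Longrightarrow> chain F x (level F x)"
proof -
  assume "finite F" "x \<in> F"
  then have "chain F x 0" unfolding chain_def by (intro exI[of _ "[x]"]) (simp add: desc_def)
  then have "level F x \<in> {q. chain F x q}"
    unfolding level_def by (intro Max_in finite_chain \<open>finite F\<close>) blast
  then show ?thesis by simp
qed

lemma level_less:
  assumes "finite F" "(i, j) \<in> F" "(i', j') \<in> F" "i < i'" "j' < j"
  shows "level F (i, j) < level F (i', j')"
proof -
  obtain ps where ps: "length ps = Suc (level F (i, j))" "desc ps" "set ps \<subseteq> F" "last ps = (i, j)"
    using chain_level[OF assms(1,2)] by (auto simp: chain_def)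
  have before: "fst p \<le> i \<and> j \<le> snd p" if "p \<in> set ps" for p
  proof -
    have bl: "ps = butlast ps @ [(i, j)]"
      using ps by (metis append_butlast_last_id length_0_conv nat.distinct(1))
    have "sorted_wrt (\<lambda>p p'. fst p < fst p' \<and> snd p' < snd p) (butlast ps @ [(i, j)])"
      using ps(2) bl unfolding desc_def by metis
    then have *: "fst x < i \<and> j < snd x" if "x \<in> set (butlast ps)" for x
      using that by (auto simp: sorted_wrt_append)
    have "p \<in> set (butlast ps @ [(i, j)])" using that bl by metis
    then show ?thesis using *[of p] by auto
  qed
  have "desc (ps @ [(i', j')])"
    unfolding desc_def sorted_wrt_append
  proof (intro conjI ballI)
    show "sorted_wrt (\<lambda>p p'. fst p < fst p' \<and> snd p' < snd p) ps" using ps(2)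
      by (simp add: desc_def)
    fix p p' assume "p \<in> set ps" "p' \<in> set [(i', j')]"
    then show "fst p < fst p'" "snd p' < snd p" using before[of p] assms(4,5) by auto
  qed simp
  then have "chain F (i', j') (Suc (level F (i, j)))"
    unfolding chain_def using ps assms(3) by (intro exI[of _ "ps @ [(i', j')]"]) simp
  then have "Suc (level F (i, j)) \<le> level F (i', j')"
    unfolding level_def[of F "(i', j')"] using finite_chain[OF assms(1)] by (intro Max_ge) simp_all
  then show ?thesis by simp
qed

section \<open>The generic point of a ladder determinantal variety\<close>

text \<open>The standing assumptions in numerical form: \<open>cover\<close> comes from every entry
  being involved in a generating minor, \<open>d_t\<close> and \<open>c_t\<close> from the absence
  of inclusions between the summands, and \<open>top\<close> from the existence of a
  \<open>t h\<close>-minor in each subladder.\<close>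

locale ladder_data =
  fixes L :: "(nat \<times> nat) set" and v :: nat and d c t :: "nat \<Rightarrow> nat"
  assumes finite_L: "finite L"
    and rect: "\<And>i j i' j' x y. (i, j) \<in> L \<Longrightarrow> (i', j') \<in> L \<Longrightarrow> i \<le> x \<Longrightarrow> x \<le> i' \<Longrightarrow> j' \<le> y \<Longrightarrow> y \<le> j \<Longrightarrow>
      (x, y) \<in> L"
    and corner: "\<And>h. h \<in> {1..v} \<Longrightarrow> (d h, c h) \<in> L"
    and d_mono: "\<And>h h'. h \<in> {1..v} \<Longrightarrow> h' \<in> {1..v} \<Longrightarrow> h \<le> h' \<Longrightarrow> d h \<le> d h'"
    and c_mono: "\<And>h h'. h \<in> {1..v} \<Longrightarrow> h' \<in> {1..v} \<Longrightarrow> h \<le> h' \<Longrightarrow> c h \<le> c h'"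
    and t_pos: "\<And>h. h \<in> {1..v} \<Longrightarrow> 0 < t h"
    and cover: "\<And>x. x \<in> L \<Longrightarrow> \<exists>h\<in>{1..v}. x \<in> subladder L d c h"
    and outer: "\<And>h. h \<in> {1..v} \<Longrightarrow> (d h + 1, c h) \<notin> L \<or> (d h, c h - 1) \<notin> L"
    and d_t: "\<And>h h'. h \<in> {1..v} \<Longrightarrow> h' \<in> {1..v} \<Longrightarrow> h < h' \<Longrightarrow> d h + t h' < d h' + t h"
    and c_t: "\<And>h h'. h \<in> {1..v} \<Longrightarrow> h' \<in> {1..v} \<Longrightarrow> h < h' \<Longrightarrow> c h + t h < c h' + t h'"
    and top: "\<And>h. h \<in> {1..v} \<Longrightarrow> t h \<le> d h \<and> (d h + 1 - t h, c h + t h - 1) \<in> L"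
begin

abbreviation sub :: "nat \<Rightarrow> (nat \<times> nat) set" where "sub \<equiv> subladder L d c"

lemma sub_iff: "(i, j) \<in> sub h \<longleftrightarrow> (i, j) \<in> L \<and> i \<le> d h \<and> c h \<le> j"
  by (auto simp: subladder_def)

definition minors :: "'k::field cell_poly set" where
  "minors = (\<Union>h\<in>{1..v}. {generic_minor A B | A B. (A, B) \<in> minor_supports (t h) (sub h)})"

definition ladder_ideal :: "'k::field cell_poly set" where
  "ladder_ideal = ideal_span L minors"

lemma minors_subset: "minors \<subseteq> (pcarrier L :: 'k::field cell_poly set)"
proof
  fix f :: "'k cell_poly" assume "f \<in> minors"
  then obtain h A B where "f = generic_minor A B" "card A = card B" "A \<times> B \<subseteq> sub h"
    unfolding minors_def minor_supports_def by auto
  moreover have "sub h \<subseteq> L" by (auto simp: subladder_def)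
  ultimately show "f \<in> pcarrier L" using generic_minor_in_pcarrier[of A B L] by blast
qed

lemma ideal_ladder_ideal: "ideal (ladder_ideal :: 'k::field cell_poly set) (poly_ring L)"
  unfolding ladder_ideal_def by (rule ideal_ideal_span[OF minors_subset])

text \<open>This is \<open>q < \<rho>(x)\<close>, with \<open>q + 1\<close> on the left to avoid
  subtracting from \<open>t h\<close>. Outside all subladders every \<open>q\<close> is allowed, and
  the infinite sum in \<open>psi_var\<close> is 0 by convention; \<open>cover\<close> rules this out
  on \<open>L\<close>.\<close>

definition allowed :: "nat \<times> nat \<Rightarrow> nat \<Rightarrow> bool" where
  "allowed x q \<longleftrightarrow> (\<forall>h\<in>{1..v}. x \<in> sub h \<longrightarrow> q + 1 < t h)"

text \<open>The leading tags 0 and 1 separate the row variables e_iq from the column variables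
  v_jq.\<close>

definition psi_var :: "nat \<times> nat \<Rightarrow> (nat \<times> nat \<times> nat, 'k::field) mpoly" where
  "psi_var x = (\<Sum>q | allowed x q. mvar (0, fst x, q) * mvar (1, snd x, q))"

definition psi :: "'k::field cell_poly \<Rightarrow> (nat \<times> nat \<times> nat, 'k) mpoly" where
  "psi = mpoly_eval (single 0) psi_var"

lemma comm_ring_hom_psi: "comm_ring_hom psi"
  unfolding psi_def by (rule comm_ring_hom_mpoly_eval[OF comm_ring_hom_const])

lemma psi_mvar: "psi (mvar x) = psi_var x"
  unfolding psi_def by (rule mpoly_eval_mvar[OF comm_ring_hom_const])

text \<open>On cells of \<open>sub h\<close>, membership in \<open>sub h'\<close> depends only on
  the row if \<open>h' \<le> h\<close> and only on the column if \<open>h \<le> h'\<close>, by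
  monotonicity of the corners. So \<open>allowed\<close> splits into a row and a column condition,
  and the matrix of the minor factors through rank at most \<open>t h - 1\<close>.\<close>

lemma psi_minor:
  assumes h: "h \<in> {1..v}" and AB: "(A, B) \<in> minor_supports (t h) (sub h)"
  shows "psi (generic_minor A B :: 'k::field cell_poly) = 0"
proof -
  interpret psi: comm_ring_hom "psi :: 'k cell_poly \<Rightarrow> _" by (rule comm_ring_hom_psi)
  define r where "r = t h"
  have card: "card A = r" "card B = r" and sub: "A \<times> B \<subseteq> sub h"
    using AB by (auto simp: minor_supports_def r_def)
  have "0 < r" using t_pos[OF h] by (simp add: r_def)
  define row where "row i q \<longleftrightarrow> (\<forall>h'\<in>{1..v}. h' \<le> h \<longrightarrow> i \<le> d h' \<longrightarrow> q + 1 < t h')" for i q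
  define col where "col j q \<longleftrightarrow> (\<forall>h'\<in>{1..v}. h \<le> h' \<longrightarrow> c h' \<le> j \<longrightarrow> q + 1 < t h')" for j q
  define U :: "(nat \<times> nat \<times> nat, 'k) mpoly mat" where
    "U = mat r r (\<lambda>(a, q). if q + 1 < r \<and> row (sl A ! a) q then mvar (0, sl A ! a, q) else 0)"
  define V :: "(nat \<times> nat \<times> nat, 'k) mpoly mat" where
    "V = mat r r (\<lambda>(q, b). if col (sl B ! b) q then mvar (1, sl B ! b, q) else 0)"
  have U: "U \<in> carrier_mat r r" and V: "V \<in> carrier_mat r r" by (simp_all add: U_def V_def)
  have allowed: "allowed (i, j) q \<longleftrightarrow> q + 1 < r \<and> row i q \<and> col j q" if ij: "(i, j) \<in> sub h" for i j q
  proof -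
    have low: "(i, j) \<in> sub h'" if "h' \<in> {1..v}" "h' \<le> h" "i \<le> d h'" for h'
      using ij that c_mono[OF that(1) h that(2)] unfolding sub_iff by linarith
    have high: "(i, j) \<in> sub h'" if "h' \<in> {1..v}" "h \<le> h'" "c h' \<le> j" for h'
      using ij that d_mono[OF h that(1,2)] unfolding sub_iff by linarith
    show ?thesis
    proof
      assume al: "allowed (i, j) q"
      have "q + 1 < t h'" if "h' \<in> {1..v}" "(i, j) \<in> sub h'" for h'
        using al that unfolding allowed_def by blast
      then show "q + 1 < r \<and> row i q \<and> col j q"
        using h ij low high unfolding row_def col_def r_def by blast
    next
      assume rc: "q + 1 < r \<and> row i q \<and> col j q"
      show "allowed (i, j) q"
        unfolding allowed_def
      proof (intro ballI impI)
        fix h' assume h': "h' \<in> {1..v}" "(i, j) \<in> sub h'"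
        then have "i \<le> d h'" "c h' \<le> j" by (simp_all add: sub_iff)
        then show "q + 1 < t h'"
          using rc h'(1) unfolding row_def col_def by (cases "h' \<le> h") auto
      qed
    qed
  qed
  have "map_mat psi (minor_mat A B) = U * V"
  proof (rule eq_matI)
    fix a b assume "a < dim_row (U * V)" "b < dim_col (U * V)"
    then have ab: "a < r" "b < r" using U V by auto
    then have in_sub: "(sl A ! a, sl B ! b) \<in> sub h"
      using sub sl_nth_in[of a A] sl_nth_in[of b B] card by auto
    have "psi_var (sl A ! a, sl B ! b) = (\<Sum>q | allowed (sl A ! a, sl B ! b) q. U $$ (a, q) *
      V $$ (q, b))"
      unfolding psi_var_def allowed[OF in_sub] using ab
      by (intro sum.cong) (auto simp: U_def V_def)
    also have "\<dots> = (\<Sum>q\<in>{0..<r}. U $$ (a, q) * V $$ (q, b))"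
      unfolding allowed[OF in_sub] using ab
      by (intro sum.mono_neutral_left) (auto simp: U_def V_def)
    also have "\<dots> = (U * V) $$ (a, b)" using ab U V by (simp add: scalar_prod_def)
    finally show "map_mat psi (minor_mat A B) $$ (a, b) = (U * V) $$ (a, b)"
      using ab card by (simp add: minor_mat_def psi_mvar)
  qed (use U V card in \<open>simp_all add: minor_mat_def\<close>)
  \<comment> \<open>Column \<open>r - 1\<close> of \<open>U\<close> vanishes because
    \<open>q + 1 < r\<close> fails there. Padding to square size replaces a rank argument by
    multiplicativity of the determinant.\<close>
  moreover have "det U = 0"
    using laplace_expansion_column[OF U, of "r - 1"] \<open>0 < r\<close>
    by (simp add: U_def)
  ultimately have "det (map_mat psi (minor_mat A B :: 'k cell_poly mat)) = 0"
    using det_mult[OF U V] by simp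
  then show ?thesis by (simp add: generic_minor_def')
qed

lemma psi_ladder_ideal:
  fixes f :: "'k::field cell_poly"
  assumes "f \<in> ladder_ideal"
  shows "psi f = 0"
proof -
  interpret psi: comm_ring_hom "psi :: 'k cell_poly \<Rightarrow> _" by (rule comm_ring_hom_psi)
  from assms
  have "f \<in> ideal_span L minors" by (simp add: ladder_ideal_def)
  then show ?thesis
  proof induction
    case (step g m f)
    then obtain h A B where "h \<in> {1..v}" "(A, B) \<in> minor_supports (t h) (sub h)" "m
      = generic_minor A B"
      unfolding minors_def by blast
    then have "psi m = 0" by (simp only: psi_minor)
    then show ?case using step by (simp add: psi.hom_add psi.hom_mult)
  qed simp
qed

text \<open>A cell with the row of one chain cell and the column of another is a corner of the
  rectangle they span, and the ladder condition puts that rectangle into \<open>L\<close>.\<close>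

lemma desc_minor_supports:
  assumes ps: "desc ps" "set ps \<subseteq> sub h"
  shows "(fst ` set ps, snd ` set ps) \<in> minor_supports (length ps) (sub h)"
proof -
  have "(i, j) \<in> sub h" if p: "(i, y) \<in> set ps" "(x, j) \<in> set ps" for i j x y
  proof -
    have L: "(i, y) \<in> sub h" "(x, j) \<in> sub h" using p ps(2) by auto
    obtain a b where ab: "ps ! a = (i, y)" "a < length ps" "ps ! b = (x, j)" "b < length ps"
      using p by (meson in_set_conv_nth)
    have mono: "fst (ps ! a) < fst (ps ! b) \<and> snd (ps ! b) < snd (ps ! a)"
      if "a < b" "b < length ps" for a b
      using that ps(1) sorted_wrt_nth_less[of _ ps a b] unfolding desc_def by blast
    consider "a = b" | "a < b" | "b < a" by linarith
    then show ?thesis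
    proof cases
      case 1
      then show ?thesis using ab L by simp
    next
      case 2
      then show ?thesis using mono[of a b] ab L rect[of i y x j i j] by (auto simp: sub_iff)
    next
      case 3
      then show ?thesis using mono[of b a] ab L rect[of x j i y i j] by (auto simp: sub_iff)
    qed
  qed
  then have "fst ` set ps \<times> snd ` set ps \<subseteq> sub h" by auto
  then show ?thesis by (simp add: minor_supports_def desc_antidiagonal(1,2)[OF ps(1)])
qed

text \<open>If the leading monomial avoids all antidiagonals, its support splits into few levels, each of
  which is the tight set of a tropical rank one matrix; specializing the generic point
  accordingly isolates the leading term.\<close>

lemma leading_monomial_contains_antidiagonal:
  fixes f :: "'k::field cell_poly"
  assumes f: "f \<in> pcarrier L" "psi f = 0" and lead: "leads \<omega> f m a" "a \<noteq> 0" and \<omega>: "good_weight \<omega>"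
  shows "\<exists>h\<in>{1..v}. \<exists>(A, B) \<in> minor_supports (t h) (sub h). \<exists>m'. m = antidiagonal A B + m'"
proof (rule ccontr)
  assume none: "\<not> ?thesis"
  define F where "F = keys m"
  have "m \<in> keys f" using lead by (simp add: leads_def in_keys_iff)
  then have F: "finite F" "F \<subseteq> L" using f(1) by (auto simp: F_def)
  obtain k l where kl: "L \<subseteq> {..k} \<times> {..l}"
  proof
    show "L \<subseteq> {..Max (fst ` L)} \<times> {..Max (snd ` L)}"
    proof
      fix x assume "x \<in> L"
      then have "fst x \<le> Max (fst ` L)" "snd x \<le> Max (snd ` L)"
        using finite_L by simp_all
      then show "x \<in> {..Max (fst ` L)} \<times> {..Max (snd ` L)}" by (cases x) simp
    qed
  qed
  \<comment> \<open>If the level were too large, a longest chain ending at \<open>x\<close> would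
    stay inside \<open>sub h\<close>, and its first \<open>t h\<close> cells would form an
    antidiagonal dividing \<open>m\<close>.\<close>
  have allowed_level: "allowed x (level F x)" if xF: "x \<in> F" for x
    unfolding allowed_def
  proof (intro ballI impI, rule ccontr)
    fix h assume h: "h \<in> {1..v}" "x \<in> sub h" and "\<not> level F x + 1 < t h"
    obtain ps where ps: "length ps = Suc (level F x)" "desc ps" "set ps \<subseteq> F" "last ps = x"
      using chain_level[OF F(1) xF] by (auto simp: chain_def)
    have inside: "p \<in> sub h" if p: "p \<in> set ps" for p
    proof -
      obtain i where i: "i < length ps" "ps ! i = p" using p by (meson in_set_conv_nth)
      have last: "x = ps ! (length ps - 1)"
        using ps(1) unfolding ps(4)[symmetric] by (intro last_conv_nth) auto
      have "fst p \<le> fst x \<and> snd x \<le> snd p"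
      proof (cases "i = length ps - 1")
        case True
        then show ?thesis using i(2) last by simp
      next
        case False
        then have "i < length ps - 1" "length ps - 1 < length ps" using i(1) by auto
        from sorted_wrt_nth_less[OF ps(2)[unfolded desc_def] this]
        show ?thesis unfolding i(2) last[symmetric] by simp
      qed
      moreover have "p \<in> L" using p ps(3) F(2) by auto
      ultimately show ?thesis
        using h(2) sub_iff[of "fst p" "snd p" h] sub_iff[of "fst x" "snd x" h] by simp
    qed
    define qs where "qs = take (t h) ps"
    have qs: "desc qs" "length qs = t h" "set qs \<subseteq> set ps"
      using ps(1,2) \<open>\<not> level F x + 1 < t h\<close> unfolding qs_def desc_def
      by (simp_all add: set_take_subset)
    have "set qs \<subseteq> sub h" using qs(3) inside by blast
    from desc_minor_supports[OF qs(1) this]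
    have supp: "(fst ` set qs, snd ` set qs) \<in> minor_supports (t h) (sub h)" by (simp only: qs(2))
    define \<mu> where "\<mu> = antidiagonal (fst ` set qs) (snd ` set qs)"
    have "m = \<mu> + (m - \<mu>)"
    proof (rule poly_mapping_eqI)
      fix p
      have "lookup \<mu> p = (if p \<in> set qs then 1 else 0)"
        unfolding \<mu>_def desc_antidiagonal(3)[OF qs(1)]
          by (simp add: lookup_sum lookup_single when_def)
      moreover have "1 \<le> lookup m p" if "p \<in> set qs"
      proof -
        have "p \<in> keys m" using that qs(3) ps(3) unfolding F_def by blast
        then show ?thesis by (simp add: in_keys_iff)
      qed
      ultimately show "lookup m p = lookup (\<mu> + (m - \<mu>)) p"
        unfolding lookup_add lookup_minus by (cases "p \<in> set qs") simp_all
    qed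
    then have "\<exists>h\<in>{1..v}. \<exists>(A, B) \<in> minor_supports (t h) (sub h). \<exists>m'. m = antidiagonal A B + m'"
      unfolding \<mu>_def by (intro bexI[OF _ h(1)] bexI[OF _ supp] case_prodI exI)
    then show False using none by contradiction
  qed
  define S where "S q = {x \<in> F. level F x = q}" for q
  have mono: "j \<le> j'" if "(i, j) \<in> S q" "(i', j') \<in> S q" "i < i'" for q i j i' j'
  proof (rule ccontr)
    assume "\<not> j \<le> j'"
    then have "level F (i, j) < level F (i', j')"
      using that by (intro level_less[OF F(1)]) (simp_all add: S_def)
    then show False using that by (simp add: S_def)
  qed
  have "\<exists>\<alpha> \<beta>. \<forall>i\<le>k. \<forall>j\<le>l. ((i, j) \<in> S q \<longrightarrow> \<alpha> i + \<beta> j = 2 * \<omega> (i, j)) \<and>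
      ((i, j) \<notin> S q \<longrightarrow> 2 * \<omega> (i, j) < \<alpha> i + \<beta> j)" for q
  proof -
    show ?thesis
    proof (rule good_weight_potential[OF \<omega>, of "S q" k l])
      fix i j i' j' assume "(i, j) \<in> S q" "(i', j') \<in> S q" "i < i'"
      then show "j \<le> j'" by (rule mono)
    next
      fix \<alpha> \<beta> :: "nat \<Rightarrow> nat"
      assume "\<And>i j. i \<le> k \<Longrightarrow> j \<le> l \<Longrightarrow> (i, j) \<in> S q \<Longrightarrow> \<alpha> i + \<beta> j = 2 * \<omega> (i, j)"
        "\<And>i j. i \<le> k \<Longrightarrow> j \<le> l \<Longrightarrow> (i, j) \<notin> S q \<Longrightarrow> 2 * \<omega> (i, j) < \<alpha> i + \<beta> j"
      then show ?thesis by (intro exI[of _ \<alpha>] exI[of _ \<beta>]) simp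
    qed
  qed
  then have "\<forall>q. \<exists>p. \<forall>i\<le>k. \<forall>j\<le>l. ((i, j) \<in> S q \<longrightarrow> fst p i + snd p j = 2 * \<omega> (i, j)) \<and>
      ((i, j) \<notin> S q \<longrightarrow> 2 * \<omega> (i, j) < fst p i + snd p j)" by simp
  from choice[OF this] obtain P where P: "\<forall>q. \<forall>i\<le>k. \<forall>j\<le>l. ((i, j) \<in> S q \<longrightarrow> fst (P q) i + snd (P q) j
    = 2 * \<omega> (i, j)) \<and>
      ((i, j) \<notin> S q \<longrightarrow> 2 * \<omega> (i, j) < fst (P q) i + snd (P q) j)" by (rule exE)
  define \<alpha> \<beta> where "\<alpha> q = fst (P q)" and "\<beta> q = snd (P q)" for q
  have ab: "\<And>q i j. i \<le> k \<Longrightarrow> j \<le> l \<Longrightarrow> (i, j) \<in> S q \<Longrightarrow> \<alpha> q i + \<beta> q j = 2 * \<omega> (i, j)"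
    "\<And>q i j. i \<le> k \<Longrightarrow> j \<le> l \<Longrightarrow> (i, j) \<notin> S q \<Longrightarrow> 2 * \<omega> (i, j) < \<alpha> q i + \<beta> q j"
    using P by (simp_all add: \<alpha>_def \<beta>_def)
  \<comment> \<open>Variables with index \<open>q\<close> are specialized by the potentials of
    \<open>S q\<close>. The summand \<open>q\<close> at a cell \<open>x\<close> then has order
    \<open>2 * \<omega> x\<close> if \<open>x \<in> S q\<close>, and larger order otherwise.\<close>
  define \<sigma> :: "nat \<times> nat \<times> nat \<Rightarrow> 'k poly" where
    "\<sigma> = (\<lambda>(e, i, q). if e = 0 then monom 1 (\<alpha> q i) else monom 1 (\<beta> q i))"
  define s where "s = (\<lambda>x. mpoly_eval (\<lambda>a. monom a 0) \<sigma> (psi_var x))"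
  note cp = comm_ring_hom_const_poly
  interpret ev: comm_ring_hom "mpoly_eval (\<lambda>a. monom a 0) \<sigma>"
    by (rule comm_ring_hom_mpoly_eval[OF cp])
  have s: "s (i, j) = (\<Sum>q | allowed (i, j) q. monom 1 (\<alpha> q i + \<beta> q j))" for i j
    unfolding s_def psi_var_def ev.hom_sum ev.hom_mult mpoly_eval_mvar[OF cp]
    by (simp add: \<sigma>_def mult_monom)
  have low: "lowest (2 * \<omega> x) (if x \<in> keys m then 1 else 0) (s x)" if xL: "x \<in> L" for x
  proof -
    obtain i j where x: "x = (i, j)" by (cases x)
    have ij: "i \<le> k" "j \<le> l" using xL kl x by auto
    have "lowest (2 * \<omega> (i, j)) (if (i, j) \<in> S q then 1 else 0) (monom (1::'k) (\<alpha> q i + \<beta> q j))"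
      for q
    proof (cases "(i, j) \<in> S q")
      case True
      then show ?thesis using ab(1)[OF ij True] lowest_monom[of "2 * \<omega> (i, j)" "1::'k"] by simp
    next
      case False
      then show ?thesis
        using lowest_higher[OF lowest_monom ab(2)[OF ij False], of "1::'k"] by simp
    qed
    then have sum: "lowest (2 * \<omega> x) (\<Sum>q | allowed x q. if x \<in> S q then 1 else 0) (s x)"
      unfolding x s by (rule lowest_sum)
    \<comment> \<open>A cell of \<open>F\<close> lies in exactly one level set, so the lowest
      coefficient is 1 and not a multiplicity that could vanish in positive characteristic. That
      level does occur in the sum, by \<open>allowed_level\<close>.\<close>
    have card: "(\<Sum>q | allowed x q. if x \<in> S q then 1 else (0::'k)) = (if x \<in> F then 1 else 0)"
    proof (cases "x \<in> F")
      case True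
      obtain h where h: "h \<in> {1..v}" "x \<in> sub h" using cover[OF xL] by blast
      have "q + 1 < t h" if "allowed x q" for q
        using that h unfolding allowed_def by blast
      then have "{q. allowed x q} \<subseteq> {..<t h}" by (auto dest: Suc_lessD)
      then have "finite {q. allowed x q}" by (rule finite_subset) simp
      moreover have "(if x \<in> S q then 1 else (0::'k)) = (if q = level F x then 1 else 0)" for q
        using True by (auto simp: S_def)
      ultimately show ?thesis using True allowed_level[OF True] by simp
    qed (simp add: S_def)
    show ?thesis using sum unfolding card unfolding F_def .
  qed
  have "mpoly_eval (\<lambda>a. monom a 0) s f = mpoly_eval (\<lambda>a. monom a 0) \<sigma> (psi f)"
    unfolding psi_def s_def
    by (rule mpoly_eval_compose[OF cp, of \<sigma> psi_var f, symmetric])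
  also have "\<dots> = 0" using f(2) by simp
  finally show False
    using leads_eval_nonzero[OF lead f(1) _ low] by simp
qed

subsection \<open>The ideal of a ladder is the kernel of the generic point\<close>

lemma leads_exists:
  fixes f :: "'k::field cell_poly"
  assumes "f \<in> pcarrier L" "f \<noteq> 0" "\<And>m. m \<in> keys f \<Longrightarrow> monom_degree m \<le> D"
    and inj: "\<And>m n. keys m \<subseteq> L \<Longrightarrow> keys n \<subseteq> L \<Longrightarrow> monom_degree m \<le> D \<Longrightarrow>
      monom_degree n \<le> D \<Longrightarrow> weight \<omega> m = weight \<omega> n \<Longrightarrow> m = n"
  obtains m a where "leads \<omega> f m a" "a \<noteq> 0"
proof -
  let ?K = "keys f"
  have K: "finite ?K" "?K \<noteq> {}" using assms(2) by auto
  define w where "w = Min (weight \<omega> ` ?K)"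
  have "w \<in> weight \<omega> ` ?K" unfolding w_def using K by (intro Min_in) auto
  then obtain m where m: "m \<in> ?K" "weight \<omega> m = w" by auto
  have "weight \<omega> m < weight \<omega> n" if n: "n \<in> ?K" "n \<noteq> m" for n
  proof -
    have "w \<le> weight \<omega> n" unfolding w_def using K n by (intro Min_le) auto
    moreover have "weight \<omega> m \<noteq> weight \<omega> n"
    proof
      assume "weight \<omega> m = weight \<omega> n"
      then have "m = n" using assms(1) m(1) n(1) assms(3) by (intro inj) auto
      then show False using n(2) by simp
    qed
    ultimately show ?thesis using m(2) by simp
  qed
  then have "leads \<omega> f m (lookup f m)" by (simp add: leads_def)
  moreover have "lookup f m \<noteq> 0" using m(1) by (simp add: in_keys_iff)
  ultimately show ?thesis by (rule that)
qed

lemma degree_bounded: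
  fixes f :: "'k::field cell_poly"
  obtains D where "\<And>m. m \<in> keys f \<Longrightarrow> monom_degree m \<le> D"
proof (rule that)
  fix m assume "m \<in> keys f"
  then show "monom_degree m \<le> Max (monom_degree ` keys f)" by (intro Max_ge) auto
qed

lemma kernel_contains_antidiagonal:
  fixes f :: "'k::field cell_poly"
  assumes "f \<in> pcarrier L" "f \<noteq> 0" "psi f = 0"
  obtains m h A B m' where "m \<in> keys f" "h \<in> {1..v}"
    "(A, B) \<in> minor_supports (t h) (sub h)" "m = antidiagonal A B + m'"
proof -
  obtain D where D: "\<And>m. m \<in> keys f \<Longrightarrow> monom_degree m \<le> D"
    using degree_bounded[of f] by metis
  obtain \<omega> where \<omega>: "good_weight \<omega>"
    "\<And>m n. keys m \<subseteq> L \<Longrightarrow> keys n \<subseteq> L \<Longrightarrow> monom_degree m \<le> D \<Longrightarrow>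
      monom_degree n \<le> D \<Longrightarrow> weight \<omega> m = weight \<omega> n \<Longrightarrow> m = n"
    using good_weight_exists[OF finite_L] by blast
  obtain m a where m: "leads \<omega> f m a" "a \<noteq> 0"
    by (rule leads_exists[OF assms(1,2) D \<omega>(2)])
  from leading_monomial_contains_antidiagonal[OF assms(1,3) m \<omega>(1)]
  obtain h A B m' where "h \<in> {1..v}" "(A, B) \<in> minor_supports (t h) (sub h)" "m = antidiagonal A B
    + m'"
    by blast
  moreover have "m \<in> keys f" using m by (simp add: leads_def in_keys_iff)
  ultimately show ?thesis using that by blast
qed

text \<open>A division algorithm: subtracting a multiple of a generating minor cancels the lightest
  term and brings in only heavier ones. Minors are homogeneous, so degrees stay at most
  \<open>D\<close> and weights below \<open>M\<close>. The induction variable \<open>n\<close>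
  measures the room left below \<open>M\<close>.\<close>

lemma kernel_subset_ladder_ideal:
  fixes f :: "'k::field cell_poly"
  assumes "f \<in> pcarrier L" "psi f = 0"
  shows "f \<in> ladder_ideal"
proof -
  interpret psi: comm_ring_hom "psi :: 'k cell_poly \<Rightarrow> _" by (rule comm_ring_hom_psi)
  obtain D where D: "\<And>m. m \<in> keys f \<Longrightarrow> monom_degree m \<le> D"
    using degree_bounded[of f] by metis
  obtain \<omega> where \<omega>: "good_weight \<omega>"
    "\<And>m n. keys m \<subseteq> L \<Longrightarrow> keys n \<subseteq> L \<Longrightarrow> monom_degree m \<le> D \<Longrightarrow>
      monom_degree n \<le> D \<Longrightarrow> weight \<omega> m = weight \<omega> n \<Longrightarrow> m = n"
    using good_weight_exists[OF finite_L] by blast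
  define M where "M = sum \<omega> L * D + 1"
  have M: "weight \<omega> m < M" if "keys m \<subseteq> L" "monom_degree m \<le> D" for m
  proof -
    have "weight \<omega> m \<le> (\<Sum>x\<in>keys m. sum \<omega> L * lookup m x)"
      unfolding weight_def using that(1) finite_L
      by (intro sum_mono mult_right_mono member_le_sum) auto
    also have "\<dots> = sum \<omega> L * monom_degree m" by (simp add: monom_degree_def sum_distrib_left)
    also have "\<dots> < M" using that(2) by (simp add: M_def less_Suc_eq_le)
    finally show ?thesis .
  qed
  have "g \<in> ladder_ideal" if "g \<in> pcarrier L" "psi g = 0"
    "\<And>m. m \<in> keys g \<Longrightarrow> monom_degree m \<le> D"
    "\<And>m. m \<in> keys g \<Longrightarrow> M \<le> weight \<omega> m + n" for n and g :: "'k cell_poly"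
    using that
  proof (induction n arbitrary: g)
    case 0
    have "m \<notin> keys g" for m
    proof
      assume m: "m \<in> keys g"
      then have "keys m \<subseteq> L" using 0(1) by simp
      then show False using M[of m] 0(3,4)[OF m] by simp
    qed
    then have "g = 0" by (metis keys_eq_empty ex_in_conv)
    then show ?case using ideal_poly_zero[OF ideal_ladder_ideal] by simp
  next
    case (Suc n)
    show ?case
    proof (cases "g = 0")
      case True
      then show ?thesis using ideal_poly_zero[OF ideal_ladder_ideal] by simp
    next
      case False
      obtain m a where m: "leads \<omega> g m a" "a \<noteq> 0"
        by (rule leads_exists[OF Suc.prems(1) False Suc.prems(3) \<omega>(2)])
      from leading_monomial_contains_antidiagonal[OF Suc.prems(1,2) m \<omega>(1)]
      obtain h A B m' where h: "h \<in> {1..v}" "(A, B) \<in> minor_supports (t h) (sub h)"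
        "m = antidiagonal A B + m'"
        by blast
      let ?g = "generic_minor A B :: 'k cell_poly"
      have card: "card A = card B" using h(2) by (simp add: minor_supports_def)
      have "monge_on (A \<times> B) \<omega>" using \<omega>(1) by (auto simp: good_weight_def monge_on_def)
      then obtain e where e: "leads \<omega> ?g (antidiagonal A B) e" "e = 1 \<or> e = (- 1 :: 'k)"
        by (rule leads_generic_minor[OF card])
      \<comment> \<open>\<open>e\<close> is 1 or -1, hence its own inverse, so the leading
        coefficient of \<open>r\<close> is \<open>a\<close>.\<close>
      define r where "r = single m' (a * e) * ?g"
      have r: "leads \<omega> r m a"
        using leads_mult[OF leads_single[of \<omega> m' "a * e"] e(1)] e(2)
        by (auto simp: r_def h(3) add.commute)
      have "m \<in> keys g" using m by (simp add: leads_def in_keys_iff)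
      then have deg_m: "monom_degree m \<le> D" and keys_m: "keys m \<subseteq> L"
        using Suc.prems(1,3) by simp_all
      have "antidiagonal A B \<in> keys ?g" using e by (auto simp: leads_def in_keys_iff)
      then have "monom_degree (antidiagonal A B) = card A" by (rule degree_generic_minor[OF card])
      then have deg_eq: "monom_degree m = card A + monom_degree m'"
        by (simp add: h(3) monom_degree_eq_weight)
      have "keys m' \<subseteq> L"
        using keys_m unfolding h(3) by (auto simp: in_keys_iff lookup_add)
      have "?g \<in> minors" using h unfolding minors_def by blast
      then have "?g \<in> ladder_ideal" unfolding ladder_ideal_def by (rule ideal_span_generator)
      then have rI: "r \<in> ladder_ideal"
        unfolding r_def using \<open>keys m' \<subseteq> L\<close>
        by (intro ideal_poly_mult[OF ideal_ladder_ideal] single_in_pcarrier)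
      have "g - r \<in> ladder_ideal"
      proof (rule Suc.IH)
        show "g - r \<in> pcarrier L"
          using Suc.prems(1) ideal_poly_carrier[OF ideal_ladder_ideal rI]
            by (rule pcarrier_closed(6))
        show "psi (g - r) = 0" using Suc.prems(2) psi_ladder_ideal[OF rI]
          by (simp add: psi.hom_minus)
        fix k assume k: "k \<in> keys (g - r)"
        then have "k \<noteq> m" using m(1) r by (auto simp: in_keys_iff lookup_minus leads_def)
        have "k \<in> keys g \<or> k \<in> keys r"
          using k by (auto simp: in_keys_iff lookup_minus)
        then have "monom_degree k \<le> D \<and> weight \<omega> m < weight \<omega> k"
        proof
          assume "k \<in> keys g"
          then show ?thesis using Suc.prems(3) m(1) \<open>k \<noteq> m\<close> by (simp add: leads_def)
        next
          assume kr: "k \<in> keys r"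
          then obtain y where "k = m' + y" "y \<in> keys ?g"
            using keys_mult[of "single m' (a * e)" ?g] by (auto simp: r_def split: if_splits)
          then have "monom_degree k = monom_degree m"
            using degree_generic_minor[OF card, of y] deg_eq by (simp add: monom_degree_eq_weight)
          then show ?thesis using r kr \<open>k \<noteq> m\<close> deg_m by (simp add: leads_def)
        qed
        then show "monom_degree k \<le> D" "M \<le> weight \<omega> k + n"
          using Suc.prems(4)[OF \<open>m \<in> keys g\<close>] by auto
      qed
      then have "(g - r) + r \<in> ladder_ideal" by (rule ideal_poly_add[OF ideal_ladder_ideal _ rI])
      then show ?thesis by simp
    qed
  qed
  from this[of f M] show ?thesis using assms D by simp
qed

lemma ladder_ideal_iff:
  "f \<in> ladder_ideal \<longleftrightarrow> f \<in> pcarrier L \<and> psi f = (0 :: (nat \<times> nat \<times> nat, 'k::field) mpoly)"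
  using kernel_subset_ladder_ideal[of f] psi_ladder_ideal[of f]
    ideal_poly_carrier[OF ideal_ladder_ideal]
  by blast

lemma ladder_ideal_mult_iff:
  fixes f g :: "'k::field cell_poly"
  assumes "f \<in> pcarrier L" "g \<in> pcarrier L"
  shows "f * g \<in> ladder_ideal \<longleftrightarrow> f \<in> ladder_ideal \<or> g \<in> ladder_ideal"
proof -
  interpret psi: comm_ring_hom "psi :: 'k cell_poly \<Rightarrow> _" by (rule comm_ring_hom_psi)
  have "f * g \<in> pcarrier L" using assms by (rule pcarrier_closed(5))
  then show ?thesis using assms unfolding ladder_ideal_iff psi.hom_mult by simp
qed

lemma one_notin_ladder_ideal: "(1 :: 'k::field cell_poly) \<notin> ladder_ideal"
proof -
  interpret psi: comm_ring_hom "psi :: 'k cell_poly \<Rightarrow> _" by (rule comm_ring_hom_psi)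
  show ?thesis unfolding ladder_ideal_iff psi.hom_one by simp
qed

lemma primeideal_ladder_ideal:
  "primeideal (ladder_ideal :: 'k::field cell_poly set) (poly_ring L)"
proof (rule primeidealI[OF ideal_ladder_ideal cring_poly_ring])
  show "pcarrier L \<noteq> (ladder_ideal :: 'k cell_poly set)"
    using one_notin_ladder_ideal pcarrier_closed(1) by blast
  show "f \<in> ladder_ideal \<or> g \<in> ladder_ideal"
    if "f \<in> pcarrier L" "g \<in> pcarrier L" "f \<otimes>\<^bsub>poly_ring L\<^esub> g \<in> ladder_ideal"
    for f g :: "'k cell_poly"
    using that(3) unfolding poly_ring_simps(2) ladder_ideal_mult_iff[OF that(1,2)] .
qed

subsection \<open>Corner minors\<close>

definition lrows :: "nat \<Rightarrow> nat set" where "lrows h = {d h + 2 - t h..<d h + 1}"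
definition lcols :: "nat \<Rightarrow> nat set" where "lcols h = {c h..<c h + t h - 1}"

text \<open>A cell fails to be free if, ends included, there are at least \<open>t h\<close> rows
  from it down to row \<open>d h\<close> and \<open>t h\<close> columns from column
  \<open>c h\<close> up to it. It is then the top right entry of a \<open>t h\<close>-minor in
  \<open>sub h\<close>.\<close>

definition free_cells :: "(nat \<times> nat) set" where
  "free_cells = {(i, j) \<in> L. \<forall>h\<in>{1..v}. \<not> (i + t h \<le> d h + 1 \<and> c h + t h \<le> j + 1)}"

definition corner_minor :: "nat \<Rightarrow> 'k::field cell_poly" where
  "corner_minor h = generic_minor (lrows h) (lcols h)"

definition corner_product :: "'k::field cell_poly" where
  "corner_product = (\<Prod>h\<in>{1..v}. corner_minor h)"

lemma card_lrows: "h \<in> {1..v} \<Longrightarrow> card (lrows h) = t h - 1"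
  and card_lcols: "h \<in> {1..v} \<Longrightarrow> card (lcols h) = t h - 1"
  using t_pos[of h] top[of h] by (auto simp: lrows_def lcols_def)

lemma sl_lrows_nth: "h \<in> {1..v} \<Longrightarrow> a < t h - 1 \<Longrightarrow> sl (lrows h) ! a = d h + 2 - t h + a"
  and sl_lcols_nth: "h \<in> {1..v} \<Longrightarrow> a < t h - 1 \<Longrightarrow> sl (lcols h) ! a = c h + a"
  using t_pos[of h] top[of h] by (auto simp: lrows_def lcols_def simp del: upt_Suc)

text \<open>The strict inequalities \<open>d_t\<close> and \<open>c_t\<close> keep the corner block
  of \<open>h\<close> out of the non-free region of every other corner. This is why the corner
  minors are polynomials in the free variables.\<close>

lemma block_free_cells: "h \<in> {1..v} \<Longrightarrow> lrows h \<times> lcols h \<subseteq> free_cells"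
proof
  fix x assume h: "h \<in> {1..v}" and "x \<in> lrows h \<times> lcols h"
  then obtain i j where x: "x = (i, j)" and ij: "d h + 2 - t h \<le> i" "i \<le> d h" "c h \<le> j" "j < c h
    + t h - 1"
    by (auto simp: lrows_def lcols_def)
  note th = t_pos[OF h] top[OF h]
  have "(i, j) \<in> L"
    using rect[of "d h + 1 - t h" "c h + t h - 1" "d h" "c h" i j] th corner[OF h] ij by auto
  moreover have "\<not> (i + t h' \<le> d h' + 1 \<and> c h' + t h' \<le> j + 1)" if h': "h' \<in> {1..v}" for h'
  proof -
    consider "h' < h" | "h' = h" | "h < h'" by linarith
    then show ?thesis
    proof cases
      case 1
      then show ?thesis using d_t[OF h' h 1] ij th t_pos[OF h'] by linarith
    next
      case 2
      then show ?thesis using ij th by auto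
    next
      case 3
      then show ?thesis using c_t[OF h h' 3] ij th by linarith
    qed
  qed
  ultimately show "x \<in> free_cells" by (simp add: x free_cells_def)
qed

lemma free_cells_subset: "free_cells \<subseteq> L"
  by (auto simp: free_cells_def)

lemma corner_minor_in_pcarrier: "h \<in> {1..v} \<Longrightarrow> corner_minor h \<in> pcarrier free_cells"
  unfolding corner_minor_def
  by (rule generic_minor_in_pcarrier[OF _ block_free_cells]) (simp_all add: card_lrows card_lcols)

lemma corner_product_in_pcarrier: "corner_product \<in> pcarrier free_cells"
  unfolding corner_product_def
  by (intro subring_set_prod[OF subring_set_pcarrier] corner_minor_in_pcarrier)

lemma antidiagonal_nth_in_keys:
  assumes "i < card A" "card A = card B"
  shows "(sl A ! i, sl B ! (card A - 1 - i)) \<in> keys (antidiagonal A B + m)"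
proof -
  let ?f = "\<lambda>i. single (sl A ! i, sl B ! (card A - 1 - i)) (1::nat)"
  have "1 \<le> (\<Sum>i' = 0..<card A. lookup (?f i') (sl A ! i, sl B ! (card A - 1 - i)))"
    using assms by (intro order.trans[OF _ member_le_sum[of i]]) auto
  then have "lookup (antidiagonal A B) (sl A ! i, sl B ! (card A - 1 - i)) \<noteq> 0"
    unfolding antidiagonal_def lookup_sum by linarith
  then show ?thesis unfolding in_keys_iff lookup_add by simp
qed

text \<open>The first antidiagonal cell, top right in the minor, has at least \<open>t h - 1\<close>
  further rows down to row \<open>d h\<close> and as many columns back to column \<open>c h\<close>,
  so it is not free.\<close>

lemma antidiagonal_meets_complement:
  assumes h: "h \<in> {1..v}" and AB: "(A, B) \<in> minor_supports (t h) (sub h)"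
  shows "\<not> keys (antidiagonal A B + m) \<subseteq> free_cells"
proof -
  have AB': "card A = t h" "card B = t h" "A \<times> B \<subseteq> sub h" using AB
    by (auto simp: minor_supports_def)
  define i j where "i = sl A ! 0" and "j = sl B ! (t h - 1)"
  have th: "0 < t h" by (rule t_pos[OF h])
  have "i + (t h - 1) \<le> sl A ! (t h - 1)" "sl B ! 0 + (t h - 1) \<le> j"
    using sl_nth_ge[of 0 "t h - 1" A] sl_nth_ge[of 0 "t h - 1" B] AB' th by (auto simp: i_def j_def)
  moreover have "sl A ! (t h - 1) \<le> d h" "c h \<le> sl B ! 0"
    using sl_nth_in[of "t h - 1" A] sl_nth_in[of 0 B] AB' th by (auto simp: sub_iff)
  ultimately have "i + t h \<le> d h + 1" "c h + t h \<le> j + 1" using th by linarith+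
  then have "(i, j) \<notin> free_cells" using h unfolding free_cells_def by blast
  moreover have "(i, j) \<in> keys (antidiagonal A B + m)"
    using antidiagonal_nth_in_keys[of 0 A B m] AB' th by (simp add: i_def j_def)
  ultimately show ?thesis by blast
qed

text \<open>Algebraic independence of the free variables at the generic point: a kernel element
  would contain a monomial divisible by an antidiagonal, and every antidiagonal has a non-free
  cell.\<close>

lemma free_kernel_trivial:
  fixes f :: "'k::field cell_poly"
  assumes "f \<in> pcarrier free_cells" "psi f = 0"
  shows "f = 0"
proof (rule ccontr)
  assume "f \<noteq> 0"
  have "f \<in> pcarrier L" using assms(1) pcarrier_mono[OF free_cells_subset] by blast
  then obtain m h A B m' where m: "m \<in> keys f" "h \<in> {1..v}"
    "(A, B) \<in> minor_supports (t h) (sub h)" "m = antidiagonal A B + m'"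
    by (rule kernel_contains_antidiagonal[OF _ \<open>f \<noteq> 0\<close> assms(2)])
  then show False
    using antidiagonal_meets_complement[OF m(2,3), of m'] assms(1) by auto
qed

lemma corner_minor_nonzero: "h \<in> {1..v} \<Longrightarrow> corner_minor h \<noteq> (0 :: 'k::field cell_poly)"
proof
  assume h: "h \<in> {1..v}" and z: "corner_minor h = (0 :: 'k cell_poly)"
  obtain \<omega> where \<omega>: "good_weight \<omega>" using good_weight_exists[OF finite_L] by metis
  then have "monge_on (lrows h \<times> lcols h) \<omega>" by (auto simp: good_weight_def monge_on_def)
  moreover have "card (lrows h) = card (lcols h)" by (simp add: card_lrows[OF h] card_lcols[OF h])
  ultimately obtain a where "leads \<omega> (corner_minor h :: 'k cell_poly) (antidiagonal (lrows h) (lcols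
    h)) a" "a = 1 \<or> a = (- 1 :: 'k)"
    unfolding corner_minor_def using leads_generic_minor by metis
  then show False using z by (auto simp: leads_def)
qed

lemma corner_product_notin_ladder_ideal:
  "(corner_product :: 'k::field cell_poly) \<notin> ladder_ideal"
proof
  interpret psi: comm_ring_hom "psi :: 'k cell_poly \<Rightarrow> _" by (rule comm_ring_hom_psi)
  assume "(corner_product :: 'k cell_poly) \<in> ladder_ideal"
  then have "psi (corner_product :: 'k cell_poly) = 0" by (rule psi_ladder_ideal)
  then have "(corner_product :: 'k cell_poly) = 0"
    by (rule free_kernel_trivial[OF corner_product_in_pcarrier])
  then obtain h where "h \<in> {1..v}" "(corner_minor h :: 'k cell_poly) = 0"
    by (auto simp: corner_product_def)
  then show False using corner_minor_nonzero by blast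
qed

subsection \<open>Bordered corner minors\<close>

text \<open>Line indices of the corner block bordered by row \<open>i\<close> on top and column
  \<open>j\<close> on the right: index 0 is the new row, index \<open>t h - 1\<close> the new
  column.\<close>

definition brow :: "nat \<Rightarrow> nat \<Rightarrow> nat \<Rightarrow> nat" where
  "brow h i a = (if a = 0 then i else d h + 1 - t h + a)"

definition bcol :: "nat \<Rightarrow> nat \<Rightarrow> nat \<Rightarrow> nat" where
  "bcol h j b = (if b < t h - 1 then c h + b else j)"

text \<open>A plain determinant instead of \<open>generic_minor\<close>, because \<open>i\<close> or
  \<open>j\<close> may already belong to the corner block; two rows or columns then agree and the
  value is 0.\<close>

definition bordered :: "nat \<Rightarrow> nat \<Rightarrow> nat \<Rightarrow> 'k::field cell_poly" where
  "bordered h i j = det (mat (t h) (t h) (\<lambda>(a, b). mvar (brow h i a, bcol h j b)))"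

text \<open>The cofactor of the entry in row \<open>Suc a\<close> of the last column. It does not
  involve \<open>j\<close>, so the correction term in \<open>bordered_expand\<close> is a row part
  times a column part.\<close>

definition border_cofactor :: "nat \<Rightarrow> nat \<Rightarrow> nat \<Rightarrow> 'k::field cell_poly" where
  "border_cofactor h i a = (- 1) ^ (Suc a + (t h - 1)) *
     det (mat (t h - 1) (t h - 1) (\<lambda>(x, y). mvar (brow h i (insert_index (Suc a) x), c h + y)))"

text \<open>Laplace expansion along the added column. It is used twice: to solve for a non-free
  variable, and to compare a block of variables with a matrix of rank at most
  \<open>t h - 1\<close>.\<close>

lemma bordered_expand:
  assumes h: "h \<in> {1..v}"
  shows "bordered h i j = (- 1) ^ (t h - 1) * corner_minor h * mvar (i, j) +
     (\<Sum>a<t h - 1. border_cofactor h i a * mvar (d h + 2 - t h + a, j) :: 'k::field cell_poly)"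
proof -
  define n where "n = t h - 1"
  have th: "t h = Suc n" "t h \<le> d h" using t_pos[OF h] top[OF h] by (auto simp: n_def)
  define M :: "'k cell_poly mat" where
    "M = mat (t h) (t h) (\<lambda>(a, b). mvar (brow h i a, bcol h j b))"
  have M: "M \<in> carrier_mat (t h) (t h)" by (simp add: M_def)
  have last: "M $$ (a, n) = mvar (brow h i a, j)" if "a < t h" for a
    using that th by (simp add: M_def bcol_def)
  have "mat_delete M 0 n = minor_mat (lrows h) (lcols h)"
  proof (rule eq_matI)
    fix x y assume "x < dim_row (minor_mat (lrows h) (lcols h) :: 'k cell_poly mat)"
      "y < dim_col (minor_mat (lrows h) (lcols h) :: 'k cell_poly mat)"
    then have xy: "x < n" "y < n"
      by (simp_all add: minor_mat_def card_lrows[OF h] card_lcols[OF h] n_def)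
    then show "mat_delete M 0 n $$ (x, y) = (minor_mat (lrows h) (lcols h) :: 'k cell_poly mat) $$
      (x, y)"
      using th by (simp add: mat_delete_def M_def minor_mat_def card_lrows[OF h] card_lcols[OF h]
          sl_lrows_nth[OF h] sl_lcols_nth[OF h] brow_def bcol_def Suc_diff_le)
  qed (simp_all add: mat_delete_def M_def minor_mat_def card_lrows[OF h] card_lcols[OF h] th)
  then have cof0: "cofactor M 0 n = (- 1) ^ n * corner_minor h"
    by (simp add: cofactor_def corner_minor_def generic_minor_def')
  have cof: "cofactor M (Suc a) n = border_cofactor h i a" if "a < n" for a
  proof -
    have "mat_delete M (Suc a) n = mat n n (\<lambda>(x, y). mvar (brow h i (insert_index (Suc a) x), c h
      + y))"
    proof (rule eq_matI)
      fix x y assume "x < dim_row (mat n n (\<lambda>(x, y). mvar (brow h i (insert_index (Suc a) x), c h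
        + y)))"
        "y < dim_col (mat n n (\<lambda>(x, y). mvar (brow h i (insert_index (Suc a) x), c h + y)))"
      then have "x < n" "y < n" by simp_all
      then show "mat_delete M (Suc a) n $$ (x, y)
          = mat n n (\<lambda>(x, y). mvar (brow h i (insert_index (Suc a) x), c h + y)) $$ (x, y)"
        using th by (simp add: mat_delete_def M_def bcol_def insert_index_def)
    qed (simp_all add: mat_delete_def M_def th)
    then show ?thesis unfolding cofactor_def border_cofactor_def n_def[symmetric] by simp
  qed
  have "bordered h i j = (\<Sum>a<t h. M $$ (a, n) * cofactor M a n)"
    unfolding bordered_def M_def[symmetric] using th by (intro laplace_expansion_column[OF M]) simp
  also have "\<dots> = M $$ (0, n) * cofactor M 0 n + (\<Sum>a<n. M $$ (Suc a, n) * cofactor M (Suc a) n)"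
    unfolding th(1) by (rule sum.lessThan_Suc_shift)
  also have "M $$ (0, n) * cofactor M 0 n = (- 1) ^ n * corner_minor h * mvar (i, j)"
    using th by (simp add: last cof0 brow_def)
  also have "(\<Sum>a<n. M $$ (Suc a, n) * cofactor M (Suc a) n)
      = (\<Sum>a<n. border_cofactor h i a * mvar (d h + 2 - t h + a, j))"
    using th by (intro sum.cong) (simp_all add: last cof brow_def Suc_diff_le)
  finally show ?thesis by (simp add: n_def)
qed

lemma rect_corner:
  assumes "h \<in> {1..v}" "(i0, j0) \<in> L" "i0 \<le> i" "i \<le> d h" "c h \<le> j" "j \<le> j0"
  shows "(i, j) \<in> L"
  using rect[OF assms(2) corner[OF assms(1)]] assms by blast

text \<open>The cell \<open>(i0, j0)\<close> certifies that the rectangle from it to the corner lies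
  in \<open>L\<close>. Within that rectangle, either a row or column repeats and the determinant is
  0, or the bordered minor is one of the generators.\<close>

lemma bordered_in_ladder_ideal:
  assumes h: "h \<in> {1..v}" and ij0: "(i0, j0) \<in> L" "i0 + t h \<le> d h + 1" "c h + t h \<le> j0 + 1"
    and ij: "i0 \<le> i" "i \<le> d h" "c h \<le> j" "j \<le> j0"
  shows "bordered h i j \<in> (ladder_ideal :: 'k::field cell_poly set)"
proof -
  have th: "0 < t h" "t h \<le> d h" using t_pos[OF h] top[OF h] by auto
  define M :: "'k cell_poly mat" where
    "M = mat (t h) (t h) (\<lambda>(a, b). mvar (brow h i a, bcol h j b))"
  have M: "M \<in> carrier_mat (t h) (t h)" by (simp add: M_def)
  note zero = ideal_poly_zero[OF ideal_ladder_ideal]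
  consider "i \<in> lrows h" | "j \<in> lcols h" | "i < d h + 2 - t h" "c h + t h - 1 \<le> j"
    using ij by (force simp: lrows_def lcols_def)
  then show ?thesis
  proof cases
    case 1
    define a where "a = i - (d h + 1 - t h)"
    have a: "0 < a" "a < t h" "brow h i a = i" using 1 th by (auto simp: a_def lrows_def brow_def)
    have "row M 0 = row M a"
      using a th by (intro eq_vecI) (auto simp: M_def brow_def)
    then have "det M = 0" using a th by (intro det_identical_rows[OF M, of 0 a]) auto
    then show ?thesis using zero by (simp add: bordered_def M_def)
  next
    case 2
    define b where "b = j - c h"
    have b: "b < t h - 1" "bcol h j b = j" using 2 by (auto simp: b_def lcols_def bcol_def)
    have "col M b = col M (t h - 1)"
      using b th by (intro eq_vecI) (auto simp: M_def bcol_def)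
    then have "det M = 0" using b th by (intro det_identical_columns[OF M, of b "t h - 1"]) auto
    then show ?thesis using zero by (simp add: bordered_def M_def)
  next
    case 3
    define xs ys where "xs = i # [d h + 2 - t h..<d h + 1]" and "ys = [c h..<c h + t h - 1] @ [j]"
    have xs: "sl (set xs) = xs" and ys: "sl (set ys) = ys"
      using 3 th by (intro sorted_list_of_set.idem_if_sorted_distinct;
          auto simp: xs_def ys_def sorted_append simp del: upt_Suc)+
    have "length xs = t h" "length ys = t h" using th
      by (auto simp: xs_def ys_def simp del: upt_Suc)
    then have card: "card (set xs) = t h" "card (set ys) = t h"
      using xs ys by (metis length_sorted_list_of_set)+
    have "set xs \<times> set ys \<subseteq> sub h"
    proof
      fix p assume "p \<in> set xs \<times> set ys"
      then obtain x y where p: "p = (x, y)" "x \<in> set xs" "y \<in> set ys" by auto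
      have "i0 \<le> x" "x \<le> d h" "c h \<le> y" "y \<le> j0"
        using p(2,3) ij ij0 th by (auto simp: xs_def ys_def)
      then show "p \<in> sub h" using rect_corner[OF h ij0(1)] by (simp add: p(1) sub_iff)
    qed
    then have "(set xs, set ys) \<in> minor_supports (t h) (sub h)"
      using card by (simp add: minor_supports_def)
    then have "generic_minor (set xs) (set ys) \<in> (minors :: 'k cell_poly set)"
      unfolding minors_def using h by blast
    moreover have "minor_mat (set xs) (set ys) = M"
    proof (rule eq_matI)
      fix a b assume "a < dim_row M" "b < dim_col M"
      then have ab: "a < t h" "b < t h" by (simp_all add: M_def)
      have "xs ! a = brow h i a" using ab th by (cases a) (simp_all add: xs_def brow_def del:
        upt_Suc)
      moreover have "ys ! b = bcol h j b" using ab th by (auto simp: ys_def bcol_def nth_append)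
      ultimately show "minor_mat (set xs) (set ys) $$ (a, b) = M $$ (a, b)"
        using ab by (simp add: minor_mat_def card M_def xs ys)
    qed (simp_all add: minor_mat_def card M_def)
    ultimately have "det M \<in> (minors :: 'k cell_poly set)" by (simp add: generic_minor_def')
    then show ?thesis
      unfolding bordered_def M_def[symmetric] ladder_ideal_def by (rule ideal_span_generator)
  qed
qed

lemma border_cofactor_in_subring:
  assumes h: "h \<in> {1..v}" and S: "subring_set (S :: 'k::field cell_poly set)"
    and "\<And>y. y \<in> lcols h \<Longrightarrow> mvar (i, y) \<in> S"
    and "\<And>x y. x \<in> lrows h \<Longrightarrow> y \<in> lcols h \<Longrightarrow> mvar (x, y) \<in> S"
  shows "a < t h - 1 \<Longrightarrow> border_cofactor h i a \<in> S"
proof -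
  have th: "0 < t h" "t h \<le> d h" using t_pos[OF h] top[OF h] by auto
  assume "a < t h - 1"
  have "mvar (brow h i (insert_index (Suc a) x), c h + y) \<in> S" if "x < t h - 1" "y < t h - 1"
    for x y
  proof -
    have "c h + y \<in> lcols h" using that by (simp add: lcols_def)
    moreover have "brow h i (insert_index (Suc a) x)
      = i \<or> brow h i (insert_index (Suc a) x) \<in> lrows h"
      using that th by (auto simp: brow_def insert_index_def lrows_def)
    ultimately show ?thesis using assms(3,4) by metis
  qed
  then show ?thesis
    unfolding border_cofactor_def
    by (intro subring_set_mult[OF S] subring_set_power[OF S] subring_set_uminus[OF S]
      subring_set_1[OF S]
        subring_set_det[OF S, of _ "t h - 1"]) auto
qed

subsection \<open>Elimination after inverting the corner minors\<close>

definition solver :: "nat \<times> nat \<Rightarrow> nat" where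
  "solver x = (SOME h. h \<in> {1..v} \<and> fst x + t h \<le> d h + 1 \<and> c h + t h \<le> snd x + 1)"

lemma solver:
  assumes "(i, j) \<in> L - free_cells"
  shows "solver (i, j) \<in> {1..v}" "i + t (solver (i, j)) \<le> d (solver (i, j)) + 1"
    "c (solver (i, j)) + t (solver (i, j)) \<le> j + 1"
proof -
  have "\<exists>h. h \<in> {1..v} \<and> i + t h \<le> d h + 1 \<and> c h + t h \<le> j + 1"
    using assms by (auto simp: free_cells_def)
  from someI_ex[OF this] show "solver (i, j) \<in> {1..v}"
    "i + t (solver (i, j)) \<le> d (solver (i, j)) + 1" "c (solver (i, j)) + t (solver (i, j)) \<le> j + 1"
    unfolding solver_def fst_conv snd_conv by blast+
qed

definition solved_minor :: "nat \<times> nat \<Rightarrow> 'k::field cell_poly" where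
  "solved_minor x = bordered (solver x) (fst x) (snd x)"

lemma solved_minor_in_ladder_ideal:
  assumes "x \<in> L - free_cells"
  shows "solved_minor x \<in> (ladder_ideal :: 'k::field cell_poly set)"
proof -
  obtain i j where x: "x = (i, j)" by (cases x)
  have s: "(i, j) \<in> L - free_cells" using assms x by simp
  have "0 < t (solver (i, j))" using t_pos[OF solver(1)[OF s]] .
  then show ?thesis
    unfolding solved_minor_def x fst_conv snd_conv
    using solver[OF s] s by (intro bordered_in_ladder_ideal[of _ i j]) auto
qed

text \<open>Kept apart from \<open>ladder_ideal\<close>, with which it agrees only up to powers of
  \<open>corner_product\<close>, because the pigeonhole argument depends on the explicit number of
  generators.\<close>

definition solved_ideal :: "'k::field cell_poly set" where
  "solved_ideal = ideal_span L (solved_minor ` (L - free_cells))"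

lemma solved_minor_in_pcarrier:
  "solved_minor ` (L - free_cells) \<subseteq> (pcarrier L :: 'k::field cell_poly set)"
  using solved_minor_in_ladder_ideal ideal_poly_carrier[OF ideal_ladder_ideal] by blast

lemma ideal_solved_ideal: "ideal (solved_ideal :: 'k::field cell_poly set) (poly_ring L)"
  unfolding solved_ideal_def by (rule ideal_ideal_span[OF solved_minor_in_pcarrier])

lemma solved_ideal_subset: "solved_ideal \<subseteq> (ladder_ideal :: 'k::field cell_poly set)"
  unfolding solved_ideal_def using solved_minor_in_ladder_ideal
  by (intro ideal_span_subset[OF ideal_ladder_ideal]) blast

lemma corner_product_in_pcarrier_L: "corner_product \<in> pcarrier L"
  using corner_product_in_pcarrier pcarrier_mono[OF free_cells_subset] by blast

text \<open>Stands for the elements which, once \<open>corner_product\<close> is inverted, agree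
  modulo \<open>solved_ideal\<close> with polynomials in the free variables.\<close>

definition eliminable :: "'k::field cell_poly set" where
  "eliminable = {f \<in> pcarrier L. \<exists>n. \<exists>g \<in> pcarrier free_cells. corner_product ^ n *
    f - g \<in> solved_ideal}"

lemma eliminableI:
  "f \<in> pcarrier L \<Longrightarrow> g \<in> pcarrier free_cells \<Longrightarrow> corner_product ^ n * f - g \<in> solved_ideal \<Longrightarrow>
    f \<in> eliminable"
  unfolding eliminable_def by blast

lemma free_in_eliminable: "pcarrier free_cells \<subseteq> (eliminable :: 'k::field cell_poly set)"
proof
  fix f :: "'k cell_poly" assume f: "f \<in> pcarrier free_cells"
  then have "f \<in> pcarrier L" using pcarrier_mono[OF free_cells_subset] by blast
  then show "f \<in> eliminable"
    using f ideal_poly_zero[OF ideal_solved_ideal] by (intro eliminableI[of f f 0]) simp_all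
qed

lemma subring_set_eliminable: "subring_set (eliminable :: 'k::field cell_poly set)"
proof -
  let ?\<Delta> = "corner_product :: 'k cell_poly"
  note pow = pcarrier_closed(7)[OF corner_product_in_pcarrier]
    pcarrier_closed(7)[OF corner_product_in_pcarrier_L]
  have mult: "f * f' \<in> eliminable \<and> f + f' \<in> eliminable" if ff': "f \<in> eliminable" "f' \<in> eliminable"
    for f f' :: "'k cell_poly"
  proof -
    obtain n g where g: "g \<in> pcarrier free_cells" "?\<Delta> ^ n * f - g \<in> solved_ideal"
      and f: "f \<in> pcarrier L"
      using ff'(1) unfolding eliminable_def by blast
    obtain n' g' where g': "g' \<in> pcarrier free_cells" "?\<Delta> ^ n' * f' - g' \<in> solved_ideal"
      and f': "f' \<in> pcarrier L"
      using ff'(2) unfolding eliminable_def by blast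
    have gL: "g \<in> pcarrier L" using g(1) pcarrier_mono[OF free_cells_subset] by blast
    have "?\<Delta> ^ (n + n') * (f * f') - g * g' = (?\<Delta> ^ n' * f') * (?\<Delta> ^ n * f - g)
      + g * (?\<Delta> ^ n' * f' - g')"
      by (simp add: power_add algebra_simps)
    also have "\<dots> \<in> solved_ideal"
      using g(2) g'(2) pow f' gL
      by (intro ideal_poly_add[OF ideal_solved_ideal] ideal_poly_mult[OF ideal_solved_ideal]
        pcarrier_closed(5)) assumption+
    finally have 1: "f * f' \<in> eliminable"
      using f f' g(1) g'(1) by (intro eliminableI[of _ "g * g'" "n + n'"] pcarrier_closed(5))
        assumption+
    have "?\<Delta> ^ (n + n') * (f + f') - (?\<Delta> ^ n' * g + ?\<Delta> ^ n * g')
        = ?\<Delta> ^ n' * (?\<Delta> ^ n * f - g) + ?\<Delta> ^ n * (?\<Delta> ^ n' * f' - g')"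
      by (simp add: power_add algebra_simps)
    also have "\<dots> \<in> solved_ideal"
      using g(2) g'(2) pow
      by (intro ideal_poly_add[OF ideal_solved_ideal] ideal_poly_mult[OF ideal_solved_ideal])
        assumption+
    finally have "f + f' \<in> eliminable"
      using f f' g(1) g'(1) pow
      by (intro eliminableI[of _ "?\<Delta> ^ n' * g + ?\<Delta> ^ n * g'" "n + n'"] pcarrier_closed(4)
        pcarrier_closed(5)) assumption+
    with 1 show ?thesis ..
  qed
  have one: "a \<in> eliminable" if "a \<in> pcarrier free_cells" for a :: "'k cell_poly"
    using that free_in_eliminable by blast
  have "- f \<in> eliminable" if "f \<in> eliminable" for f :: "'k cell_poly"
    using mult[OF one[OF pcarrier_closed(3)[OF pcarrier_closed(1)]] that] by simp
  then show ?thesis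
    unfolding subring_set_def using mult one[OF pcarrier_closed(1)] by blast
qed

lemma solved_ideal_cancel:
  fixes f g :: "'k::field cell_poly"
  assumes "corner_product * f - g \<in> solved_ideal" "g \<in> eliminable" "f \<in> pcarrier L"
  shows "f \<in> eliminable"
proof -
  let ?\<Delta> = "corner_product :: 'k cell_poly"
  obtain n g' where g': "g' \<in> pcarrier free_cells" "?\<Delta> ^ n * g - g' \<in> solved_ideal"
    using assms(2) unfolding eliminable_def by blast
  have "?\<Delta> ^ Suc n * f - g' = ?\<Delta> ^ n * (?\<Delta> * f - g) + (?\<Delta> ^ n * g - g')"
    by (simp add: algebra_simps)
  also have "\<dots> \<in> solved_ideal"
    using assms(1) g'(2) pcarrier_closed(7)[OF corner_product_in_pcarrier_L]
    by (intro ideal_poly_add[OF ideal_solved_ideal] ideal_poly_mult[OF ideal_solved_ideal])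
  finally show ?thesis by (rule eliminableI[OF assms(3) g'(1)])
qed

lemma mvar_eliminable:
  assumes "x \<in> L"
  shows "mvar x \<in> (eliminable :: 'k::field cell_poly set)"
proof -
  define R where "R = Max (fst ` L)"
  have R: "i \<le> R" if "(i, j) \<in> L" for i j
    unfolding R_def using that finite_L by (intro Max_ge) force+
  have S: "subring_set (eliminable :: 'k cell_poly set)" by (rule subring_set_eliminable)
  have "mvar (i, j) \<in> (eliminable :: 'k cell_poly set)" if "(i, j) \<in> L" for i j
    using that
  \<comment> \<open>Besides the cell itself, its bordered minor involves only other cells weakly to
    the left and weakly below, for which \<open>j + (R - i)\<close> is smaller. \<open>R\<close>
    bounds all rows, so the subtraction is exact.\<close>
  proof (induction "j + (R - i)" arbitrary: i j rule: less_induct)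
    case less
    show ?case
    proof (cases "(i, j) \<in> free_cells")
      case True
      then have "mvar (i, j) \<in> (pcarrier free_cells :: 'k cell_poly set)" by (rule mvar_in_pcarrier)
      then show ?thesis using free_in_eliminable by blast
    next
      case False
      then have ij: "(i, j) \<in> L - free_cells" using less.prems by simp
      define h where "h = solver (i, j)"
      have h: "h \<in> {1..v}" "i + t h \<le> d h + 1" "c h + t h \<le> j + 1" using solver[OF ij]
        by (simp_all add: h_def)
      have th: "0 < t h" "t h \<le> d h" using t_pos[OF h(1)] top[OF h(1)] by auto
      have cell: "mvar (x, y) \<in> (eliminable :: 'k cell_poly set)"
        if "i \<le> x" "x \<le> d h" "c h \<le> y" "y \<le> j" "(x, y) \<noteq> (i, j)" for x y
      proof (rule less.hyps)
        show xy: "(x, y) \<in> L" using rect_corner[OF h(1) less.prems that(1-4)] .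
        show "y + (R - x) < j + (R - i)" using R[OF xy] R[OF less.prems] that by auto
      qed
      have row: "mvar (i, y) \<in> (eliminable :: 'k cell_poly set)" if "y \<in> lcols h" for y
        using that h th by (intro cell) (auto simp: lcols_def)
      have colm: "mvar (x, j) \<in> (eliminable :: 'k cell_poly set)" if "x \<in> lrows h" for x
        using that h th by (intro cell) (auto simp: lrows_def)
      have block: "mvar (x, y) \<in> (eliminable :: 'k cell_poly set)" if "x \<in> lrows h" "y \<in> lcols h"
        for x y
        using that h th by (intro cell) (auto simp: lrows_def lcols_def)
      define p :: "'k cell_poly" where
        "p = (\<Sum>a<t h - 1. border_cofactor h i a * mvar (d h + 2 - t h + a, j))"
      have p: "p \<in> eliminable"
        unfolding p_def
      proof (intro subring_set_sum[OF S] subring_set_mult[OF S])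
        fix a assume "a \<in> {..<t h - 1}"
        then show "border_cofactor h i a \<in> (eliminable :: 'k cell_poly set)"
          by (intro border_cofactor_in_subring[OF h(1) S row block]) auto
        show "mvar (d h + 2 - t h + a, j) \<in> (eliminable :: 'k cell_poly set)"
          using \<open>a \<in> {..<t h - 1}\<close> th by (intro colm) (auto simp: lrows_def)
      qed
      define \<epsilon> :: "'k cell_poly" where "\<epsilon> = (- 1) ^ (t h - 1)"
      have \<epsilon>: "\<epsilon> * \<epsilon> = 1" by (simp add: \<epsilon>_def flip: power_add mult_2)
      define q :: "'k cell_poly" where "q = (\<Prod>h'\<in>{1..v} - {h}. corner_minor h')"
      have q: "q \<in> pcarrier free_cells"
        unfolding q_def by (intro subring_set_prod[OF subring_set_pcarrier]
          corner_minor_in_pcarrier) auto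
      have prod: "corner_product = q * (corner_minor h :: 'k cell_poly)"
        unfolding corner_product_def q_def using h(1) by (subst prod.remove[of _ h]) (auto simp:
          mult.commute)
      have e: "\<epsilon> \<in> pcarrier free_cells"
        unfolding \<epsilon>_def by (intro pcarrier_closed(7) pcarrier_closed(3) pcarrier_closed(1))
      have "solved_minor (i, j) = \<epsilon> * corner_minor h * mvar (i, j) + p"
        unfolding solved_minor_def fst_conv snd_conv h_def[symmetric] bordered_expand[OF h(1)] \<epsilon>_def
          p_def ..
      then have "\<epsilon> * q * solved_minor (i, j) = (\<epsilon> * \<epsilon>) * (q * corner_minor h) * mvar (i, j)
        + \<epsilon> * q * p"
        by (simp add: algebra_simps)
      then have eq: "corner_product * mvar (i, j) - (- (\<epsilon> * q * p)) = \<epsilon> * q * solved_minor (i, j)"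
        by (simp add: \<epsilon> prod)
      show ?thesis
      proof (rule solved_ideal_cancel)
        have "solved_minor (i, j) \<in> (solved_ideal :: 'k cell_poly set)"
          unfolding solved_ideal_def using ij by (intro ideal_span_generator) blast
        moreover have "\<epsilon> * q \<in> pcarrier L"
          using pcarrier_closed(5)[OF e q] pcarrier_mono[OF free_cells_subset] by blast
        ultimately show "corner_product * mvar (i, j) - (- (\<epsilon> * q * p)) \<in> solved_ideal"
          unfolding eq by (intro ideal_poly_mult[OF ideal_solved_ideal])
        show "- (\<epsilon> * q * p) \<in> eliminable"
          using e q p free_in_eliminable
          by (intro subring_set_uminus[OF S] subring_set_mult[OF S]) blast+
        show "mvar (i, j) \<in> pcarrier L" by (rule mvar_in_pcarrier[OF less.prems])
      qed
    qed
  qed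
  then show ?thesis using assms by (cases x) simp
qed

lemma pcarrier_eliminable: "pcarrier L \<subseteq> (eliminable :: 'k::field cell_poly set)"
proof
  fix f :: "'k cell_poly" assume "f \<in> pcarrier L"
  then show "f \<in> eliminable"
  proof (rule mpoly_subring_induct)
    show "single 0 a \<in> (eliminable :: 'k cell_poly set)" for a
      using free_in_eliminable const_in_pcarrier by blast
  qed (rule mvar_eliminable subring_set_add[OF subring_set_eliminable]
      subring_set_mult[OF subring_set_eliminable]; assumption)+
qed

text \<open>Elimination replaces a multiple of \<open>f\<close> by a polynomial in the free
  variables that again lies in the ideal. Such a polynomial is zero, so the multiple is in
  \<open>solved_ideal\<close>.\<close>

lemma ladder_ideal_locally_solved:
  fixes f :: "'k::field cell_poly"
  assumes "f \<in> ladder_ideal"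
  obtains n where "corner_product ^ n * f \<in> solved_ideal"
proof -
  have f: "f \<in> pcarrier L" using assms by (simp only: ladder_ideal_iff)
  then obtain n g where g: "g \<in> pcarrier free_cells" "corner_product ^ n * f - g \<in> solved_ideal"
    using pcarrier_eliminable unfolding eliminable_def by blast
  have "corner_product ^ n * f \<in> ladder_ideal"
    using assms pcarrier_closed(7)[OF corner_product_in_pcarrier_L]
      by (intro ideal_poly_mult[OF ideal_ladder_ideal])
  from ideal_poly_diff[OF ideal_ladder_ideal this subsetD[OF solved_ideal_subset g(2)]]
  have "g \<in> ladder_ideal" by simp
  then have "g = 0" using free_kernel_trivial[OF g(1) psi_ladder_ideal] by blast
  then show ?thesis using g(2) that by simp
qed

subsection \<open>The product of the antidiagonal minors\<close>

definition line :: "nat \<Rightarrow> (nat \<times> nat) set" where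
  "line s = {x \<in> L. fst x + snd x = s}"

definition line_minor :: "nat \<Rightarrow> 'k::field cell_poly" where
  "line_minor s = generic_minor (fst ` line s) (snd ` line s)"

definition line_sums :: "nat set" where
  "line_sums = (\<lambda>x. fst x + snd x) ` L"

definition splitting_form :: "'k::field cell_poly" where
  "splitting_form = (\<Prod>s\<in>line_sums. line_minor s)"

text \<open>The ladder condition fills the rectangle between the two end cells, so an antidiagonal
  of \<open>L\<close> has no gaps. The bound \<open>i0 + m \<le> s + 1\<close> makes
  \<open>s - (i0 + p)\<close> exact.\<close>

lemma line_segment:
  assumes "s \<in> line_sums"
  obtains i0 m where "0 < m" "i0 + m \<le> s + 1" "line s = (\<lambda>p. (i0 + p, s - (i0 + p))) ` {0..<m}"
proof -
  let ?R = "fst ` line s"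
  have fin: "finite ?R" using finite_L by (simp add: line_def)
  have ne: "?R \<noteq> {}" using assms unfolding line_def line_sums_def by blast
  define i0 i1 where "i0 = Min ?R" and "i1 = Max ?R"
  have "i0 \<in> ?R" "i1 \<in> ?R" using fin ne by (simp_all add: i0_def i1_def)
  moreover have "(i, s - i) \<in> L \<and> i \<le> s" if "i \<in> ?R" for i
    using that by (auto simp: line_def)
  ultimately have L: "(i0, s - i0) \<in> L" "i0 \<le> s" "(i1, s - i1) \<in> L" "i1 \<le> s" by blast+
  have R: "i0 \<le> i" "i \<le> i1" if "i \<in> ?R" for i
    using fin that by (simp_all add: i0_def i1_def)
  have "i0 \<le> i1" using R(1)[OF \<open>i1 \<in> ?R\<close>] .
  show ?thesis
  proof (rule that)
    show "0 < Suc i1 - i0" "i0 + (Suc i1 - i0) \<le> s + 1" using \<open>i0 \<le> i1\<close> L by simp_all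
    show "line s = (\<lambda>p. (i0 + p, s - (i0 + p))) ` {0..<Suc i1 - i0}"
    proof (intro equalityI subsetI)
      fix x assume x: "x \<in> line s"
      then have "i0 \<le> fst x" "fst x \<le> i1" using R[of "fst x"] by auto
      moreover have "x = (fst x, s - fst x)" using x by (cases x) (auto simp: line_def)
      ultimately show "x \<in> (\<lambda>p. (i0 + p, s - (i0 + p))) ` {0..<Suc i1 - i0}"
        by (intro image_eqI[of _ _ "fst x - i0"]) auto
    next
      fix x assume "x \<in> (\<lambda>p. (i0 + p, s - (i0 + p))) ` {0..<Suc i1 - i0}"
      then obtain p where p: "x = (i0 + p, s - (i0 + p))" "p < Suc i1 - i0" by auto
      then have "x \<in> L" using rect[OF L(1,3), of "i0 + p" "s - (i0 + p)"] by simp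
      then show "x \<in> line s" using p L by (simp add: line_def)
    qed
  qed
qed

lemma line_desc:
  assumes "s \<in> line_sums"
  obtains ps where "desc ps" "set ps = line s"
proof -
  obtain i0 m where m: "i0 + m \<le> s + 1" "line s = (\<lambda>p. (i0 + p, s - (i0 + p))) ` {0..<m}"
    using line_segment[OF assms] by metis
  have "desc (map (\<lambda>p. (i0 + p, s - (i0 + p))) [0..<m])"
    unfolding desc_def sorted_wrt_map using m(1)
    by (intro sorted_wrt_mono_rel[OF _ sorted_wrt_upt]) auto
  then show ?thesis using m(2) by (intro that) auto
qed

lemma card_line:
  assumes "s \<in> line_sums"
  shows "card (fst ` line s) = card (line s)" "card (snd ` line s) = card (line s)"
    "antidiagonal (fst ` line s) (snd ` line s) = (\<Sum>x\<in>line s. single x 1)"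
proof -
  obtain ps where ps: "desc ps" "set ps = line s" using line_desc[OF assms] .
  note * = desc_antidiagonal[OF ps(1), unfolded ps(2)]
  have "length ps = card (line s)" using distinct_card[OF desc_distinct[OF ps(1)]] ps(2) by simp
  then show "card (fst ` line s) = card (line s)" "card (snd ` line s) = card (line s)"
    "antidiagonal (fst ` line s) (snd ` line s) = (\<Sum>x\<in>line s. single x 1)"
    using * by simp_all
qed

lemma finite_line_sums: "finite line_sums"
  using finite_L by (simp add: line_sums_def)

lemma sum_lines: "(\<Sum>s\<in>line_sums. \<Sum>x\<in>line s. g x) = (\<Sum>x\<in>L. g x :: 'b::comm_monoid_add)"
proof -
  have "(\<Sum>s\<in>line_sums. \<Sum>x\<in>line s. g x) = (\<Sum>x\<in>(\<Union>s\<in>line_sums. line s). g x)"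
    using finite_line_sums finite_L
    by (intro sum.UNION_disjoint[symmetric]) (auto simp: line_def)
  also have "(\<Union>s\<in>line_sums. line s) = L" by (auto simp: line_def line_sums_def)
  finally show ?thesis .
qed

lemma splitting_form_leads:
  assumes "good_weight \<omega>"
  obtains a :: "'k::field" where "leads \<omega> splitting_form (\<Sum>x\<in>L. single x 1) a" "a \<noteq> 0"
proof -
  have "\<exists>a. leads \<omega> (line_minor s) (\<Sum>x\<in>line s. single x 1) a \<and> a \<noteq> (0 :: 'k)"
    if s: "s \<in> line_sums" for s
  proof -
    have "monge_on (fst ` line s \<times> snd ` line s) \<omega>"
      using assms by (auto simp: good_weight_def monge_on_def)
    moreover have "card (fst ` line s) = card (snd ` line s)" using card_line[OF s] by simp
    ultimately obtain a where "leads \<omega> (line_minor s) (antidiagonal (fst ` line s) (snd ` line s))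
      a"
      "a = 1 \<or> a = (- 1 :: 'k)"
      unfolding line_minor_def using leads_generic_minor by metis
    then show ?thesis unfolding card_line(3)[OF s] by auto
  qed
  then obtain a where a: "\<And>s. s \<in> line_sums \<Longrightarrow>
      leads \<omega> (line_minor s) (\<Sum>x\<in>line s. single x 1) (a s) \<and> a s \<noteq> (0 :: 'k)"
    by metis
  then have "leads \<omega> splitting_form (\<Sum>s\<in>line_sums. \<Sum>x\<in>line s. single x 1) (\<Prod>s\<in>line_sums. a s)"
    unfolding splitting_form_def by (intro leads_prod) blast
  moreover have "(\<Prod>s\<in>line_sums. a s) \<noteq> 0" using a finite_line_sums by auto
  ultimately show ?thesis using that unfolding sum_lines by blast
qed

text \<open>Two cells of an antidiagonal span a rectangle inside the ladder, so the whole square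
  block around the antidiagonal lies in \<open>L\<close> and its minor is available.\<close>

lemma line_in_rect:
  assumes "s \<in> line_sums" "x \<in> fst ` line s" "y \<in> snd ` line s"
  shows "(x, y) \<in> L"
proof -
  obtain j i where L: "(x, j) \<in> L" "x + j = s" "(i, y) \<in> L" "i + y = s"
    using assms by (force simp: line_def)
  show ?thesis
  proof (cases "x \<le> i")
    case True
    then show ?thesis using rect[OF L(1,3), of x y] L(2,4) by simp
  next
    case False
    then show ?thesis using rect[OF L(3,1), of x y] L(2,4) by simp
  qed
qed

lemma line_minor_in_pcarrier: "s \<in> line_sums \<Longrightarrow> line_minor s \<in> pcarrier L"
  unfolding line_minor_def
  by (rule generic_minor_in_pcarrier) (auto simp: card_line intro: line_in_rect)

lemma degree_splitting_form:
  assumes "m \<in> keys (splitting_form :: 'k::field cell_poly)"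
  shows "monom_degree m = card L"
proof -
  have "monom_degree m = (\<Sum>s\<in>S. card (line s))"
    if "finite S" "S \<subseteq> line_sums" "m \<in> keys (\<Prod>s\<in>S. line_minor s :: 'k cell_poly)" for S m
    using that
  proof (induction S arbitrary: m rule: finite_induct)
    case (insert s S)
    then obtain x y where "m = x + y" "x \<in> keys (line_minor s :: 'k cell_poly)"
      "y \<in> keys (\<Prod>s\<in>S. line_minor s :: 'k cell_poly)"
      using keys_mult[of "line_minor s :: 'k cell_poly" "\<Prod>s\<in>S. line_minor s"] by auto
    moreover have "monom_degree x = card (line s)"
      using degree_generic_minor[of "fst ` line s" "snd ` line s" x] card_line[of s] insert.prems
        calculation(2)
      by (simp add: line_minor_def)
    ultimately show ?case using insert by (simp add: monom_degree_eq_weight)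
  qed (simp add: monom_degree_def)
  from this[OF finite_line_sums order_refl] assms
  have "monom_degree m = (\<Sum>s\<in>line_sums. card (line s))" by (simp add: splitting_form_def)
  also have "\<dots> = card L" using sum_lines[of "\<lambda>_. 1::nat"] by simp
  finally show ?thesis .
qed

text \<open>On the rows and columns inside the region of one lower corner, the antidiagonal block is,
  after multiplication by the corner minor, congruent to a matrix factoring through rank
  \<open>t h - 1\<close>.\<close>

lemma line_minor_in_ideal_pow:
  assumes s: "s \<in> line_sums"
  shows "\<exists>n. corner_product ^ n * line_minor s
    \<in> ideal_pow L (ladder_ideal :: 'k::field cell_poly set) (card (line s - free_cells))"
proof (cases "line s \<subseteq> free_cells")
  case True
  then have empty: "line s - free_cells = {}" by blast
  have card: "card (line s - free_cells) = 0" unfolding empty by simp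
  have "corner_product ^ 0 * line_minor s \<in> (pcarrier L :: 'k cell_poly set)"
    unfolding power_0 mult_1 by (rule line_minor_in_pcarrier[OF s])
  then show ?thesis
    unfolding card ideal_pow_0[OF ideal_ladder_ideal] by (intro exI[of _ 0])
next
  case False
  let ?I = "ladder_ideal :: 'k cell_poly set"
  obtain i0 m where m: "0 < m" "i0 + m \<le> s + 1" and
    seg: "line s = (\<lambda>p. (i0 + p, s - (i0 + p))) ` {0..<m}"
    using line_segment[OF s] .
  define j0 j1 where "j0 = s - i0" and "j1 = s + 1 - (i0 + m)"
  have j1: "j1 + m = j0 + 1" using m by (simp add: j0_def j1_def)
  have corner0: "(i0, j0) \<in> L" and corner1: "(i0 + (m - 1), j1) \<in> L"
  proof -
    have "(i0 + 0, s - (i0 + 0)) \<in> line s" unfolding seg using m by (intro imageI) simp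
    then show "(i0, j0) \<in> L" by (simp add: j0_def line_def)
    have "(i0 + (m - 1), s - (i0 + (m - 1))) \<in> line s" unfolding seg using m by (intro imageI) simp
    moreover have "s - (i0 + (m - 1)) = j1" using m by (simp add: j1_def)
    ultimately show "(i0 + (m - 1), j1) \<in> L" by (simp add: line_def)
  qed
  have rows: "fst ` line s = {i0..<i0 + m}" 
  proof -
    have "fst ` line s = (+) i0 ` {0..<m}" unfolding seg by (simp add: image_image)
    then show ?thesis by (simp add: add.commute)
  qed
  have cols: "snd ` line s = {j1..<j1 + m}"
  proof -
    have "snd ` line s = (\<lambda>p. s - (i0 + p)) ` {0..<m}" unfolding seg by (simp add: image_image)
    also have "\<dots> = {j1..<j1 + m}"
    proof (intro equalityI subsetI)
      fix y assume "y \<in> (\<lambda>p. s - (i0 + p)) ` {0..<m}"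
      then show "y \<in> {j1..<j1 + m}" using m by (auto simp: j1_def)
    next
      fix y assume "y \<in> {j1..<j1 + m}"
      then show "y \<in> (\<lambda>p. s - (i0 + p)) ` {0..<m}"
        using m by (intro image_eqI[of _ _ "s - i0 - y"]) (auto simp: j1_def)
    qed
    finally show ?thesis .
  qed
  define F where "F = fst ` (line s - free_cells)"
  have finF: "finite F" "F \<noteq> {}" using False finite_L by (auto simp: F_def line_def)
  \<comment> \<open>A corner \<open>h\<close> for which the lowest non-free cell of the line fails
    to be free does the same for all line cells above it. One corner minor therefore suffices for
    the whole line.\<close>
  define ie where "ie = Max F"
  have "ie \<in> F" using finF by (simp add: ie_def)
  then obtain x where x: "x \<in> line s" "x \<notin> free_cells" "ie = fst x" unfolding F_def by blast
  moreover obtain p where "p < m" "x = (i0 + p, s - (i0 + p))" using x(1) by (auto simp: seg)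
  moreover have "x \<in> L" using x(1) by (simp add: line_def)
  ultimately obtain p where p: "p < m" "ie = i0 + p" "(ie, s - ie) \<notin> free_cells" "(ie, s - ie) \<in> L"
    by (metis fst_conv)
  then obtain h where h: "h \<in> {1..v}" "ie + t h \<le> d h + 1" "c h + t h \<le> s - ie + 1"
    by (auto simp: free_cells_def)
  define e where "e = ie + 1 - i0"
  have card_e: "card (line s - free_cells) \<le> e"
  proof -
    have "line s - free_cells \<subseteq> (\<lambda>p. (i0 + p, s - (i0 + p))) ` {0..<e}"
    proof
      fix x assume x: "x \<in> line s - free_cells"
      then obtain q where q: "x = (i0 + q, s - (i0 + q))" by (auto simp: seg)
      have "fst x \<le> ie" unfolding ie_def using finF x by (intro Max_ge) (auto simp: F_def)
      then show "x \<in> (\<lambda>p. (i0 + p, s - (i0 + p))) ` {0..<e}"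
        unfolding q by (intro imageI) (simp add: e_def)
    qed
    then have "card (line s - free_cells) \<le> card ((\<lambda>p. (i0 + p, s - (i0 + p))) ` {0..<e})"
      by (intro card_mono) auto
    also have "\<dots> \<le> card {0..<e}" by (rule card_image_le) simp
    finally show ?thesis by simp
  qed
  define r where "r = t h - 1"
  have th: "t h = Suc r" "t h \<le> d h" using t_pos[OF h(1)] top[OF h(1)] by (auto simp: r_def)
  have i0h: "i0 + t h \<le> d h + 1" and j0h: "c h + t h \<le> j0 + 1"
    using h p(2) by (auto simp: j0_def)
  have er: "e + r + i0 \<le> d h + 1" "e + r + c h \<le> j0 + 1" "e + r \<le> m"
    and both: "i0 + m \<le> d h + 1 \<or> c h \<le> j1"
  proof -
    have ie_s: "ie \<le> s" using p m by simp
    show 1: "e + r + i0 \<le> d h + 1" "e + r + c h \<le> j0 + 1"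
      using h p(2) th ie_s by (auto simp: e_def j0_def)
    \<comment> \<open>Otherwise the line could be continued by \<open>(i0 + m, j1 - 1)\<close>, a
      cell of the rectangle between the top of the line and the corner.\<close>
    show "e + r \<le> m"
    proof (rule ccontr)
      assume *: "\<not> e + r \<le> m"
      have "(i0 + m, j1 - 1) \<in> L"
        using rect_corner[OF h(1) corner0, of "i0 + m" "j1 - 1"] * 1 j1 by simp
      moreover have "i0 + m + (j1 - 1) = s" using m * 1 j1 by (simp add: j1_def)
      ultimately have "(i0 + m, j1 - 1) \<in> line s" by (simp add: line_def)
      then have "i0 + m \<in> fst ` line s" by force
      then show False by (simp add: rows)
    qed
    \<comment> \<open>A block overshooting the corner both downwards and to the left would contain
      both outer neighbours of the corner, against \<open>outer\<close>.\<close>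
    show "i0 + m \<le> d h + 1 \<or> c h \<le> j1"
    proof (rule ccontr)
      assume *: "\<not> (i0 + m \<le> d h + 1 \<or> c h \<le> j1)"
      have "(d h + 1, c h) \<in> L" "(d h, c h - 1) \<in> L"
        using * rect[OF corner0 corner1] i0h j0h th by auto
      then show False using outer[OF h(1)] by blast
    qed
  qed
  \<comment> \<open>Rows and columns of the block inside the region of corner \<open>h\<close>. As
    the block overshoots in at most one direction, \<open>card A + card B - m - r\<close> is at
    least \<open>e\<close>, which bounds the number of non-free cells on the line.\<close>
  define A B where "A = {p. p < m \<and> i0 + p \<le> d h}" and "B = {q. q < m \<and> c h \<le> j1 + q}"
  have AB: "A \<subseteq> {..<m}" "B \<subseteq> {..<m}" by (auto simp: A_def B_def)
  have "A = {..<min m (d h + 1 - i0)}" "B = {c h - j1..<m}" by (auto simp: A_def B_def)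
  then have "card A = min m (d h + 1 - i0)" "card B = m - (c h - j1)" by simp_all
  then have pow: "e \<le> card A + card B - m - r"
    using er both j1 by linarith
  have inL: "(i, j) \<in> L" if "i0 \<le> i" "i \<le> d h" "c h \<le> j" "j \<le> j0" for i j
    using rect_corner[OF h(1) corner0 that] .
  define M where "M = (minor_mat (fst ` line s) (snd ` line s) :: 'k cell_poly mat)"
  have card_rows: "card (fst ` line s) = m" "card (snd ` line s) = m" by (simp_all add: rows cols)
  have M: "M \<in> carrier_mat m m" by (simp add: M_def minor_mat_carrier card_rows)
  have M_nth: "M $$ (p, q) = mvar (i0 + p, j1 + q)" if "p < m" "q < m" for p q
    using that by (simp add: M_def minor_mat_def card_rows) (simp add: rows cols)
  have M_carrier: "M $$ (p, q) \<in> pcarrier L" if "p < m" "q < m" for p q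
    unfolding M_nth[OF that] using that rect[OF corner0 corner1, of "i0 + p" "j1 + q"] j1
    by (intro mvar_in_pcarrier) simp
  define \<delta> :: "'k cell_poly" where "\<delta> = (- 1) ^ r * corner_minor h"
  have cm: "corner_minor h \<in> (pcarrier L :: 'k cell_poly set)"
    using corner_minor_in_pcarrier[OF h(1)] pcarrier_mono[OF free_cells_subset] by blast
  have \<delta>: "\<delta> \<in> pcarrier L"
    unfolding \<delta>_def by (intro pcarrier_closed(5) pcarrier_closed(7) pcarrier_closed(3)
      pcarrier_closed(1) cm)
  \<comment> \<open>\<open>K\<close> depends only on the row and \<open>Y\<close> only on the
    column, since border cofactors do not involve the column. Outside \<open>A\<close> and
    \<open>B\<close> both are 0, and there \<open>E\<close> is only required to have entries in the
    ring.\<close>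
  define K :: "'k cell_poly mat" where
    "K = mat m r (\<lambda>(p, a). if p \<in> A then - border_cofactor h (i0 + p) a else 0)"
  define Y :: "'k cell_poly mat" where
    "Y = mat r m (\<lambda>(a, q). if q \<in> B then mvar (d h + 2 - t h + a, j1 + q) else 0)"
  define E where "E = \<delta> \<cdot>\<^sub>m M - K * Y"
  have K: "K \<in> carrier_mat m r" and Y: "Y \<in> carrier_mat r m" by (simp_all add: K_def Y_def)
  have KY: "K * Y \<in> carrier_mat m m" using K Y by simp
  have E: "E \<in> carrier_mat m m" unfolding E_def by (rule minus_carrier_mat[OF KY])
  have K': "K $$ (p, a) \<in> pcarrier L" if "p < m" "a < r" for p a
  proof (cases "p \<in> A")
    case True
    have "border_cofactor h (i0 + p) a \<in> pcarrier L"
    proof (rule border_cofactor_in_subring[OF h(1) subring_set_pcarrier])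
      show "mvar (i0 + p, y) \<in> pcarrier L" if "y \<in> lcols h" for y
        using that True j0h th by (intro mvar_in_pcarrier inL) (auto simp: A_def lcols_def)
      show "mvar (x, y) \<in> pcarrier L" if "x \<in> lrows h" "y \<in> lcols h" for x y
        using that block_free_cells[OF h(1)] free_cells_subset by (intro mvar_in_pcarrier) blast
    qed (use that in \<open>simp add: r_def\<close>)
    then show ?thesis using True that pcarrier_closed(3) by (simp add: K_def del: poly_ring_simps)
  qed (use that pcarrier_closed(2) in \<open>simp add: K_def del: poly_ring_simps\<close>)
  have Y': "Y $$ (a, q) \<in> pcarrier L" if "a < r" "q < m" for a q
  proof (cases "q \<in> B")
    case True
    then have "mvar (d h + 2 - t h + a, j1 + q) \<in> (pcarrier L :: 'k cell_poly set)"
      using that th i0h j1 by (intro mvar_in_pcarrier inL) (auto simp: B_def)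
    then show ?thesis using True that by (simp add: Y_def del: poly_ring_simps)
  qed (use that pcarrier_closed(2) in \<open>simp add: Y_def del: poly_ring_simps\<close>)
  have KY_nth: "(K * Y) $$ (p, q) = (\<Sum>a<r. K $$ (p, a) * Y $$ (a, q))" if "p < m" "q < m" for p q
    using that K Y by (simp add: scalar_prod_def lessThan_atLeast0)
  have E_nth: "E $$ (p, q) = \<delta> * M $$ (p, q) - (\<Sum>a<r. K $$ (p, a) * Y $$ (a, q))" if "p < m" "q < m"
    for p q
    unfolding E_def KY_nth[OF that, symmetric] using that M KY
    by (subst index_minus_mat(1)) auto
  have E': "E $$ (p, q) \<in> pcarrier L" if "p < m" "q < m" for p q
    unfolding E_nth[OF that] using that
    by (intro pcarrier_closed(6) pcarrier_closed(5) \<delta> M_carrier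
      subring_set_sum[OF subring_set_pcarrier] K' Y') auto
  have EI: "E $$ (p, q) \<in> ?I" if "p \<in> A" "q \<in> B" for p q
  proof -
    have pq: "p < m" "q < m" using that AB by auto
    have "(\<Sum>a<r. K $$ (p, a) * Y $$ (a, q))
        = - (\<Sum>a<r. border_cofactor h (i0 + p) a * mvar (d h + 2 - t h + a, j1 + q))"
      unfolding sum_negf[symmetric] using that pq by (intro sum.cong) (simp_all add: K_def Y_def)
    then have "E $$ (p, q) = bordered h (i0 + p) (j1 + q)"
      unfolding E_nth[OF pq] M_nth[OF pq] bordered_expand[OF h(1)] \<delta>_def r_def by simp
    also have "\<dots> \<in> ?I"
      using that j1 by (intro bordered_in_ladder_ideal[OF h(1) corner0 i0h j0h]) (auto simp: A_def
        B_def)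
    finally show ?thesis .
  qed
  have "det (K * Y + E) \<in> ideal_pow L ?I (card A + card B - m - r)"
    by (rule det_add_product_in_ideal_pow[OF ideal_ladder_ideal K Y E K' Y' E' AB EI])
  moreover have "K * Y + E = \<delta> \<cdot>\<^sub>m M"
    using M KY K Y by (intro eq_matI) (auto simp: E_def)
  ultimately have "\<delta> ^ m * line_minor s \<in> ideal_pow L ?I (card A + card B - m - r)"
    using M by (simp add: line_minor_def generic_minor_def' M_def)
  then have power: "\<delta> ^ m * line_minor s \<in> ideal_pow L ?I (card (line s - free_cells))"
    using ideal_pow_antimono[OF ideal_ladder_ideal] card_e pow by (meson order.trans subsetD)
  \<comment> \<open>The remaining corner minors turn the power of \<open>\<delta>\<close> into a
    power of \<open>corner_product\<close>, so that all lines share one denominator.\<close>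
  define q :: "'k cell_poly" where "q = (- 1) ^ r * (\<Prod>h'\<in>{1..v} - {h}. corner_minor h')"
  have sq: "(- 1) ^ r * (- 1) ^ r = (1 :: 'k cell_poly)" by (simp flip: power_add mult_2)
  have "corner_product = corner_minor h * (\<Prod>h'\<in>{1..v} - {h}. corner_minor h' :: 'k cell_poly)"
    unfolding corner_product_def using h(1) by (intro prod.remove) auto
  also have "\<dots> = ((- 1) ^ r * (- 1) ^ r) * (corner_minor h * (\<Prod>h'\<in>{1..v} - {h}. corner_minor h'))"
    unfolding sq by simp
  also have "\<dots> = q * \<delta>" unfolding q_def \<delta>_def by (simp only: ac_simps)
  finally have prod: "corner_product = q * \<delta>" .
  have "(\<Prod>h'\<in>{1..v} - {h}. corner_minor h') \<in> (pcarrier L :: 'k cell_poly set)"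
    using corner_minor_in_pcarrier pcarrier_mono[OF free_cells_subset]
    by (intro subring_set_prod[OF subring_set_pcarrier]) blast
  then have q: "q \<in> pcarrier L"
    unfolding q_def by (intro pcarrier_closed(5) pcarrier_closed(7) pcarrier_closed(3)
      pcarrier_closed(1))
  have "q ^ m * (\<delta> ^ m * line_minor s) \<in> ideal_pow L ?I (card (line s - free_cells))"
    by (rule ideal_poly_mult[OF ideal_ideal_pow[OF ideal_ladder_ideal] pcarrier_closed(7)[OF q]
      power])
  then have "corner_product ^ m * line_minor s \<in> ideal_pow L ?I (card (line s - free_cells))"
    unfolding prod by (simp only: power_mult_distrib mult.assoc)
  then show ?thesis by blast
qed

text \<open>The lines partition \<open>L\<close>, so the orders contributed by the line minors add
  up to the number of non-free cells.\<close>

lemma splitting_form_in_ideal_pow: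
  obtains n where "corner_product ^ n * splitting_form
    \<in> ideal_pow L (ladder_ideal :: 'k::field cell_poly set) (card (L - free_cells))"
proof -
  obtain n where n: "\<And>s. s \<in> line_sums \<Longrightarrow> corner_product ^ n s * line_minor s
    \<in> ideal_pow L (ladder_ideal :: 'k cell_poly set) (card (line s - free_cells))"
    using line_minor_in_ideal_pow[where 'k = 'k] by metis
  have "(\<Prod>s\<in>line_sums. corner_product ^ n s * line_minor s)
    \<in> ideal_pow L (ladder_ideal :: 'k cell_poly set) (\<Sum>s\<in>line_sums. card (line s - free_cells))"
    by (rule ideal_pow_prod_mem[OF ideal_ladder_ideal n])
  also have "(\<Prod>s\<in>line_sums. corner_product ^ n s * line_minor s)
      = (corner_product ^ sum n line_sums * splitting_form :: 'k cell_poly)"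
    by (simp add: prod.distrib splitting_form_def power_sum)
  also have "(\<Sum>s\<in>line_sums. card (line s - free_cells)) = card (L - free_cells)"
  proof -
    have fin: "finite (line s)" for s using finite_L by (simp add: line_def)
    have "card (line s - free_cells) = (\<Sum>x\<in>line s. if x \<in> free_cells then 0 else 1)" for s
      using fin[of s] by (simp add: sum.If_cases Diff_eq)
    then have "(\<Sum>s\<in>line_sums. card (line s - free_cells)) = (\<Sum>x\<in>L. if x \<in> free_cells then 0 else 1)"
      by (simp only: sum_lines)
    also have "\<dots> = card (L - free_cells)" using finite_L by (simp add: sum.If_cases Diff_eq)
    finally show ?thesis .
  qed
  finally show ?thesis by (rule that)
qed

end

section \<open>A criterion for symbolic F-splitting\<close>

lemma ideal_span_mult_mem:
  fixes T :: "('v, 'k::field) mpoly set"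
  assumes "T \<subseteq> pcarrier V" "S \<subseteq> pcarrier V"
    and f: "f \<in> ideal_span V S" and g: "g \<in> ideal_span V T"
  shows "f * g \<in> ideal_span V {s * t | s t. s \<in> S \<and> t \<in> T}"
proof -
  let ?U = "{s * t | s t. s \<in> S \<and> t \<in> T}"
  have "?U \<subseteq> pcarrier V"
  proof
    fix u assume "u \<in> ?U"
    then obtain s t where "u = s * t" "s \<in> S" "t \<in> T" by blast
    then show "u \<in> pcarrier V" using assms(1,2) pcarrier_closed(5)[of s V t] by blast
  qed
  note U = ideal_ideal_span[OF this]
  have "s * g \<in> ideal_span V ?U" if s: "s \<in> S" for s
    using g
  proof induction
    case zero
    then show ?case using ideal_poly_zero[OF U] by simp
  next
    case (step h t g)
    have "s * t \<in> ideal_span V ?U" by (rule ideal_span_generator) (use s step(2) in blast)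
    from ideal_poly_add[OF U ideal_poly_mult[OF U step(1) this] step(4)]
    have "h * (s * t) + s * g \<in> ideal_span V ?U" .
    then show ?case by (simp add: algebra_simps)
  qed
  note sg = this
  show ?thesis
    using f
  proof induction
    case zero
    then show ?case using ideal_poly_zero[OF U] by simp
  next
    case (step h s f)
    from ideal_poly_add[OF U ideal_poly_mult[OF U step(1) sg[OF step(2)]] step(4)]
    have "h * (s * g) + f * g \<in> ideal_span V ?U" .
    then show ?case by (simp add: algebra_simps)
  qed
qed

lemma ideal_pow_ideal_span:
  fixes g :: "'i \<Rightarrow> ('v, 'k::field) mpoly"
  assumes X: "finite X" and g: "\<And>x. x \<in> X \<Longrightarrow> g x \<in> pcarrier V"
  shows "ideal_pow V (ideal_span V (g ` X)) n \<subseteq> ideal_span V {\<Prod>x\<in>X. g x ^ a x | a. sum a X = n}"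
proof (induction n)
  case 0
  have gX: "g ` X \<subseteq> pcarrier V" using g by blast
  show ?case
  proof
    fix f assume "f \<in> ideal_pow V (ideal_span V (g ` X)) 0"
    then have f: "f \<in> pcarrier V" by (simp only: ideal_pow_0[OF ideal_ideal_span[OF gX]])
    have "1 \<in> {\<Prod>x\<in>X. g x ^ a x | a. sum a X = 0}" by (auto intro!: exI[of _ "\<lambda>_. 0"])
    from ideal_span.step[OF f this ideal_span.zero]
    show "f \<in> ideal_span V {\<Prod>x\<in>X. g x ^ a x | a. sum a X = 0}" by simp
  qed
next
  case (Suc n)
  have gX: "g ` X \<subseteq> pcarrier V" using g by blast
  let ?M = "\<lambda>n. {\<Prod>x\<in>X. g x ^ a x | a. sum a X = n}"
  have M: "?M n \<subseteq> pcarrier V" for n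
  proof
    fix u assume "u \<in> ?M n"
    then obtain a where "u = (\<Prod>x\<in>X. g x ^ a x)" by blast
    then show "u \<in> pcarrier V"
      by (simp only:) (intro subring_set_prod[OF subring_set_pcarrier] pcarrier_closed(7) g)
  qed
  note id = ideal_ideal_span[OF M]
  have sub: "{s * t | s t. s \<in> ?M n \<and> t \<in> g ` X} \<subseteq> ideal_span V (?M (Suc n))"
  proof
    fix u assume "u \<in> {s * t | s t. s \<in> ?M n \<and> t \<in> g ` X}"
    then obtain a y where u: "u = (\<Prod>x\<in>X. g x ^ a x) * g y" "sum a X = n" "y \<in> X" by blast
    have "(\<Prod>x\<in>X. g x ^ (a(y := Suc (a y))) x) = g y ^ Suc (a y) * (\<Prod>x\<in>X - {y}. g x ^ a x)"
      using X u(3) by (subst prod.remove[of _ y]) auto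
    moreover have "(\<Prod>x\<in>X. g x ^ a x) = g y ^ a y * (\<Prod>x\<in>X - {y}. g x ^ a x)"
      using X u(3) by (rule prod.remove)
    moreover have "sum (a(y := Suc (a y))) X = Suc (a y) + sum a (X - {y})"
      using X u(3) by (subst sum.remove[of _ y]) auto
    moreover have "sum a X = a y + sum a (X - {y})" using X u(3) by (rule sum.remove)
    ultimately have "u = (\<Prod>x\<in>X. g x ^ (a(y := Suc (a y))) x)" "sum (a(y := Suc (a y))) X = Suc n"
      using u(1,2) by simp_all
    then have "u \<in> ?M (Suc n)" by blast
    then show "u \<in> ideal_span V (?M (Suc n))" by (rule ideal_span_generator)
  qed
  show ?case
  proof
    fix f assume "f \<in> ideal_pow V (ideal_span V (g ` X)) (Suc n)"
    then have "f \<in> ideal_prod (poly_ring V) (ideal_pow V (ideal_span V (g ` X)) n) (ideal_span V (g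
      ` X))"
      by (simp only: ideal_pow_Suc[OF ideal_ideal_span[OF gX]])
    then show "f \<in> ideal_span V (?M (Suc n))"
    proof induction
      case (prod i j)
      then have "i \<in> ideal_span V (?M n)" using Suc by blast
      from ideal_span_mult_mem[OF gX M this prod(2)]
      show ?case using ideal_span_subset[OF id sub] unfolding poly_ring_simps(2) by blast
    next
      case (sum i j)
      then show ?case using ideal_poly_add[OF id] unfolding poly_ring_simps(3) by blast
    qed
  qed
qed

text \<open>For a monomial in the generators, divide every exponent by \<open>p\<close>. The
  remainders add up to at most \<open>card X * (p - 1)\<close>, so \<open>p\<close> times the sum of
  the quotients exceeds \<open>n * p\<close>, and the quotients add up to at least
  \<open>n + 1\<close>.\<close>

lemma ideal_pow_subset_frobenius_power:
  fixes g :: "'i \<Rightarrow> ('v, 'k::field) mpoly"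
  assumes X: "finite X" and g: "\<And>x. x \<in> X \<Longrightarrow> g x \<in> pcarrier V" and "0 < p"
  defines "J \<equiv> ideal_span V (g ` X)"
  shows "ideal_pow V J (n * p + 1 + card X * (p - 1)) \<subseteq> ideal_span V ((\<lambda>z. z ^ p) ` ideal_pow V J (n
    + 1))"
proof -
  have gX: "g ` X \<subseteq> pcarrier V" using g by blast
  have J: "ideal J (poly_ring V)" unfolding J_def by (rule ideal_ideal_span[OF gX])
  let ?N = "n * p + 1 + card X * (p - 1)"
  let ?Z = "(\<lambda>z. z ^ p) ` ideal_pow V J (n + 1)"
  have "?Z \<subseteq> pcarrier V"
    using ideal_poly_carrier[OF ideal_ideal_pow[OF J]] pcarrier_closed(7) by blast
  note Z = ideal_ideal_span[OF this]
  have "u \<in> ideal_span V ?Z" if uN: "u \<in> {\<Prod>x\<in>X. g x ^ a x | a. sum a X = ?N}" for u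
  proof -
    obtain a where a: "u = (\<Prod>x\<in>X. g x ^ a x)" "sum a X = ?N" using uN by blast
    define z w where "z = (\<Prod>x\<in>X. g x ^ (a x div p))" and "w = (\<Prod>x\<in>X. g x ^ (a x mod p))"
    have "g x ^ a x = (g x ^ (a x div p)) ^ p * g x ^ (a x mod p)" for x
      by (simp flip: power_mult power_add)
    then have u: "u = w * z ^ p"
      by (simp add: a(1) z_def w_def prod.distrib prod_power_distrib mult.commute)
    have "z \<in> ideal_pow V J (\<Sum>x\<in>X. a x div p)"
      unfolding z_def
    proof (rule ideal_pow_prod_mem[OF J])
      fix x assume "x \<in> X"
      then have "g x \<in> J" unfolding J_def by (intro ideal_span_generator) blast
      then have "g x \<in> ideal_pow V J 1" by (simp only: ideal_pow_1[OF J])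
      from ideal_pow_power_mem[OF J this, of "a x div p"]
      show "g x ^ (a x div p) \<in> ideal_pow V J (a x div p)" by simp
    qed
    moreover have "n + 1 \<le> (\<Sum>x\<in>X. a x div p)"
    proof (rule ccontr)
      assume "\<not> n + 1 \<le> (\<Sum>x\<in>X. a x div p)"
      then have "(\<Sum>x\<in>X. a x div p) * p \<le> n * p" by (intro mult_right_mono) auto
      moreover have "(\<Sum>x\<in>X. a x mod p) \<le> card X * (p - 1)"
      proof -
        have "a x mod p \<le> p - 1" for x using \<open>0 < p\<close> mod_less_divisor[of p "a x"] by linarith
        then show ?thesis using sum_bounded_above[of X "\<lambda>x. a x mod p" "p - 1"] by simp
      qed
      moreover have "sum a X = (\<Sum>x\<in>X. a x div p) * p + (\<Sum>x\<in>X. a x mod p)"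
        by (simp add: sum_distrib_right flip: sum.distrib)
      ultimately show False using a(2) by linarith
    qed
    ultimately have "z \<in> ideal_pow V J (n + 1)" using ideal_pow_antimono[OF J] by blast
    then have "z ^ p \<in> ideal_span V ?Z" by (intro ideal_span_generator) blast
    moreover have "w \<in> pcarrier V"
      unfolding w_def by (intro subring_set_prod[OF subring_set_pcarrier] pcarrier_closed(7) g)
    ultimately show ?thesis unfolding u by (intro ideal_poly_mult[OF Z])
  qed
  then have "ideal_span V {\<Prod>x\<in>X. g x ^ a x | a. sum a X = ?N} \<subseteq> ideal_span V ?Z"
    by (intro ideal_span_subset[OF Z] subsetI)
  then show ?thesis using ideal_pow_ideal_span[where g = g and V = V and n = ?N, OF X g]
    unfolding J_def by blast
qed

subsection \<open>The trace\<close>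

text \<open>The field acts on itself by \<open>a ^ p * b\<close>, with \<open>p\<close> the
  characteristic; additivity in \<open>a\<close> is the freshman's dream. The vector 1 is
  independent, so a linear map to the field with its usual structure can be prescribed to be 1
  there. It splits Frobenius on coefficients.\<close>

lemma frobenius_functional_exists:
  assumes "CHAR('k::field) > 0"
  obtains \<pi> :: "'k::field \<Rightarrow> 'k" where "\<And>a b. \<pi> (a + b) = \<pi> a + \<pi> b"
    "\<And>a b. \<pi> (a ^ CHAR('k::field) * b) = a * \<pi> b" "\<pi> 1 = 1"
proof -
  have prime: "prime CHAR('k)" using assms by (rule prime_CHAR_semidom)
  interpret vector_space_pair "\<lambda>a b :: 'k. a ^ CHAR('k) * b" "(*) :: 'k \<Rightarrow> 'k \<Rightarrow> 'k"
    by unfold_locales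
      (auto simp: algebra_simps power_mult_distrib freshmans_dream[OF prime refl])
  have "vs1.independent {1}" by (simp add: vs1.dependent_single)
  from linear_independent_extend[OF this, of "\<lambda>_. 1"] obtain \<pi> where
    \<pi>: "Vector_Spaces.linear (\<lambda>a b :: 'k. a ^ CHAR('k) * b) (*) \<pi>" "\<pi> 1 = 1" by auto
  interpret \<pi>: Vector_Spaces.linear "\<lambda>a b :: 'k. a ^ CHAR('k) * b" "(*)" \<pi> by (rule \<pi>(1))
  show ?thesis by (rule that[of \<pi>]) (simp_all add: \<pi>.add \<pi>.scale \<pi>(2))
qed

lemma lookup_single_mult:
  fixes g :: "('v, 'k::field) mpoly"
  shows "lookup (single m a * g) (m + n) = a * lookup g n"
proof (induction g rule: poly_mapping_keys_induct)
  case (single k b)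
  then show ?case by (auto simp: mult_single lookup_single when_def)
qed (simp_all add: distrib_left lookup_add)

lemma lookup_single_mult_zero:
  fixes g :: "('v, 'k::field) mpoly"
  assumes "\<And>n. k \<noteq> m + n"
  shows "lookup (single m a * g) k = 0"
proof -
  have "k \<notin> keys (single m a * g)"
    using keys_mult[of "single m a" g] assms by (auto split: if_splits)
  then show ?thesis by (simp add: in_keys_iff)
qed

context
  fixes V :: "'v set" and \<pi> :: "'k::field \<Rightarrow> 'k" and p :: nat
  assumes V: "finite V" and p: "p = CHAR('k)" "0 < p"
    and \<pi>_add: "\<And>a b. \<pi> (a + b) = \<pi> a + \<pi> b"
    and \<pi>_mult: "\<And>a b. \<pi> (a ^ p * b) = a * \<pi> b" and \<pi>_1: "\<pi> 1 = 1"
begin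

lemma functional_zero: "\<pi> 0 = 0"
  using \<pi>_add[of 0 0] add_left_imp_eq[of "\<pi> 0" "\<pi> 0" 0] by (simp only: add_0_right)

definition trace_exponent :: "('v \<Rightarrow>\<^sub>0 nat) \<Rightarrow> ('v \<Rightarrow>\<^sub>0 nat)" where
  "trace_exponent n = (\<Sum>x\<in>V. single x (p * lookup n x + (p - 1)))"

lemma lookup_trace_exponent:
  "lookup (trace_exponent n) x = (if x \<in> V then p * lookup n x + (p - 1) else 0)"
  unfolding trace_exponent_def using V by (simp add: lookup_sum lookup_single when_def)

lemma inj_trace_exponent: "inj_on trace_exponent {n. keys n \<subseteq> V}"
proof (rule inj_onI, rule poly_mapping_eqI)
  fix m n x assume mn: "m \<in> {n. keys n \<subseteq> V}" "n \<in> {n. keys n \<subseteq> V}"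
    and eq: "trace_exponent m = trace_exponent n"
  show "lookup m x = lookup n x"
  proof (cases "x \<in> V")
    case True
    have "p * lookup m x + (p - 1) = p * lookup n x + (p - 1)"
      using arg_cong[OF eq, of "\<lambda>f. lookup f x"]
      unfolding lookup_trace_exponent if_P[OF True] .
    then have "p * lookup m x = p * lookup n x" by (rule add_right_imp_eq)
    then show ?thesis using p(2) by simp
  next
    case False
    then have "x \<notin> keys m" "x \<notin> keys n" using mn by auto
    then show ?thesis by (simp add: in_keys_iff)
  qed
qed

text \<open>The usual trace of a polynomial ring: exponents \<open>p n + (p - 1, ..., p - 1)\<close>
  go to \<open>n\<close> and all others are dropped, with \<open>\<pi>\<close> taking care of the
  coefficients. Exponents are confined to \<open>V\<close> because \<open>trace_exponent\<close>
  ignores other variables.\<close>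

definition trace :: "('v, 'k) mpoly \<Rightarrow> ('v, 'k) mpoly" where
  "trace g = (\<Sum>n | keys n \<subseteq> V \<and> trace_exponent n \<in> keys g.
     single n (\<pi> (lookup g (trace_exponent n))))"

lemma lookup_trace:
  "lookup (trace g) n
    = (if keys n \<subseteq> V then \<pi> (lookup g (trace_exponent n)) else 0)"
proof -
  let ?N = "{n. keys n \<subseteq> V \<and> trace_exponent n \<in> keys g}"
  have "finite (trace_exponent ` ?N)" by (rule finite_subset[of _ "keys g"]) auto
  then have "finite ?N"
    by (rule finite_imageD) (rule inj_on_subset[OF inj_trace_exponent], blast)
  then show ?thesis
    unfolding trace_def
    by (auto simp: lookup_sum lookup_single when_def in_keys_iff functional_zero)
qed

lemma trace_in_pcarrier: "trace g \<in> pcarrier V"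
proof -
  have "keys m \<subseteq> V" if "m \<in> keys (trace g)" for m
    using that by (auto simp: in_keys_iff lookup_trace split: if_splits)
  then show ?thesis by simp
qed

lemma trace_add: "trace (f + g) = trace f + trace g"
  by (rule poly_mapping_eqI) (simp add: lookup_trace lookup_add \<pi>_add)

lemma freshman: "(f + g) ^ p = f ^ p + (g :: ('v, 'k) mpoly) ^ p"
proof -
  have "prime CHAR(('v, 'k) mpoly)" using p by (simp add: CHAR_mpoly prime_CHAR_semidom)
  then show ?thesis unfolding p(1) by (metis CHAR_mpoly freshmans_dream)
qed

lemma trace_single_power_mult:
  assumes "keys m \<subseteq> V"
  shows "trace (single m a ^ p * g) = single m a * trace g"
proof -
  have "\<exists>q. single m a ^ n = single q (a ^ n) \<and>
      (\<forall>x. lookup q x = n * lookup m x)" for n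
  proof (induction n)
    case (Suc n)
    then obtain q where "single m a ^ n = single q (a ^ n)"
      "\<forall>x. lookup q x = n * lookup m x" by blast
    then show ?case by (intro exI[of _ "m + q"]) (simp add: mult_single lookup_add)
  qed (auto intro!: exI[of _ 0])
  then obtain q where q: "single m a ^ p = single q (a ^ p)"
    "\<And>x. lookup q x = p * lookup m x" by blast
  show ?thesis
  proof (rule poly_mapping_eqI)
    fix k
    have rhs_carrier: "single m a * trace g \<in> pcarrier V"
      by (intro pcarrier_closed(5) trace_in_pcarrier single_in_pcarrier assms)
    show "lookup (trace (single m a ^ p * g)) k
        = lookup (single m a * trace g) k"
    proof (cases "keys k \<subseteq> V")
      case False
      then have "k \<notin> keys (single m a * trace g)" using rhs_carrier by auto
      then show ?thesis using False by (simp add: lookup_trace in_keys_iff)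
    next
      case k: True
      show ?thesis
      proof (cases "\<exists>n. k = m + n")
        case True
        then obtain n where n: "k = m + n" by blast
        have "keys n \<subseteq> V" using k unfolding n by (auto simp: in_keys_iff lookup_add)
        have "trace_exponent k = q + trace_exponent n"
        proof (rule poly_mapping_eqI)
          fix x
          have "lookup m x = 0" if "x \<notin> V" using assms that by (metis in_keys_iff subsetD)
          then show "lookup (trace_exponent k) x = lookup (q + trace_exponent n) x"
            by (simp add: lookup_trace_exponent lookup_add q(2) n algebra_simps)
        qed
        then have "lookup (trace (single m a ^ p * g)) k
            = a * \<pi> (lookup g (trace_exponent n))"
          using k by (simp add: lookup_trace q(1) lookup_single_mult \<pi>_mult)
        also have "\<dots> = lookup (single m a * trace g) k"
          unfolding n lookup_single_mult using \<open>keys n \<subseteq> V\<close> by (simp add: lookup_trace)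
        finally show ?thesis .
      next
        case False
        \<comment> \<open>If \<open>q\<close>, which is \<open>p\<close> times \<open>m\<close>,
          could be split off, then in each variable \<open>p\<close> times the exponent in
          \<open>m\<close> would be at most \<open>p\<close> times the exponent in \<open>k\<close>
          plus \<open>p - 1\<close>, making \<open>k\<close> a multiple of \<open>m\<close>.\<close>
        have "trace_exponent k \<noteq> q + z" for z
        proof
          assume eq: "trace_exponent k = q + z"
          have "lookup m x \<le> lookup k x" for x
          proof (cases "x \<in> V")
            case True
            have "p * lookup k x + (p - 1) = p * lookup m x + lookup z x"
              using arg_cong[OF eq, of "\<lambda>f. lookup f x"] True
              by (simp add: lookup_trace_exponent lookup_add q(2))
            then have "p * lookup m x < p * Suc (lookup k x)"
              using p(2) unfolding mult_Suc_right by linarith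
            then show ?thesis unfolding mult_less_cancel1 by simp
          next
            case False
            then show ?thesis using assms by (metis in_keys_iff subsetD le0)
          qed
          then have "k = m + (k - m)" by (intro poly_mapping_eqI) (simp add: lookup_add
            lookup_minus)
          then show False using False by blast
        qed
        then have "lookup (trace (single m a ^ p * g)) k = 0"
          by (simp add: lookup_trace q(1) lookup_single_mult_zero functional_zero)
        moreover have "lookup (single m a * trace g) k = 0"
          using False by (intro lookup_single_mult_zero) blast
        ultimately show ?thesis by simp
      qed
    qed
  qed
qed

lemma trace_power_mult:
  assumes "r \<in> pcarrier V"
  shows "trace (r ^ p * g) = r * trace g"
proof (induction r rule: poly_mapping_keys_induct)
  case zero
  have "trace 0 = 0" by (rule poly_mapping_eqI) (simp add: lookup_trace functional_zero)
  then show ?case using p(2) by (simp add: zero_power)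
next
  case (single m a)
  then show ?case using assms by (intro trace_single_power_mult) auto
next
  case (add r s)
  then show ?case by (simp add: freshman distrib_right trace_add)
qed

text \<open>For nonzero \<open>n\<close> the degree of \<open>trace_exponent n\<close> exceeds the
  degree of \<open>G\<close>, so only the constant term survives; the factor
  \<open>inverse \<mu>\<close> and \<open>\<pi> 1 = 1\<close> make it 1.\<close>

lemma trace_power_eq_1:
  assumes deg: "\<And>m. m \<in> keys G \<Longrightarrow> monom_degree m = card V * (p - 1)"
    and "lookup G (trace_exponent 0) = \<mu>" "\<mu> \<noteq> 0"
  shows "trace (single 0 (inverse \<mu>) * G) = 1"
proof (rule poly_mapping_eqI)
  fix n
  show "lookup (trace (single 0 (inverse \<mu>) * G)) n = lookup 1 n"
  proof (cases "n = 0")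
    case True
    have "lookup (single 0 (inverse \<mu>) * G) (0 + trace_exponent 0) = 1"
      unfolding lookup_single_mult using assms(2,3) by simp
    then show ?thesis using True by (simp add: lookup_trace \<pi>_1 lookup_one)
  next
    case False
    show ?thesis
    proof (cases "keys n \<subseteq> V")
      case True
      have "monom_degree (trace_exponent n) = p * monom_degree n + card V * (p - 1)"
      proof -
        have "keys (trace_exponent n) \<subseteq> V"
          by (auto simp: in_keys_iff lookup_trace_exponent split: if_splits)
        then show ?thesis
          unfolding monom_degree_eq_weight weight_eq[OF V True]
            weight_eq[OF V \<open>keys (trace_exponent n) \<subseteq> V\<close>]
          by (simp add: lookup_trace_exponent sum.distrib sum_distrib_left)
      qed
      moreover have "monom_degree n \<noteq> 0"
      proof -
        obtain x where "x \<in> keys n" using False by (metis ex_in_conv keys_eq_empty)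
        then show ?thesis by (auto simp: monom_degree_def in_keys_iff)
      qed
      ultimately have "trace_exponent n \<notin> keys G" using deg[of "trace_exponent n"] p(2) by auto
      then have "lookup (single 0 (inverse \<mu>) * G) (0 + trace_exponent n) = 0"
        unfolding lookup_single_mult by (simp add: in_keys_iff)
      then show ?thesis using False by (simp add: lookup_trace functional_zero lookup_one)
    qed (use False in \<open>simp add: lookup_trace lookup_one\<close>)
  qed
qed

end

section \<open>From the trace to symbolic powers\<close>

lemma ideal_pow_localized:
  fixes I J :: "('v, 'k::field) mpoly set"
  assumes I: "ideal I (poly_ring V)" and J: "ideal J (poly_ring V)" and \<Delta>: "\<Delta> \<in> pcarrier V"
    and loc: "\<And>f. f \<in> I \<Longrightarrow> \<exists>n. \<Delta> ^ n * f \<in> J"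
  shows "f \<in> ideal_pow V I N \<Longrightarrow> \<exists>n. \<Delta> ^ n * f \<in> ideal_pow V J N"
proof (induction N arbitrary: f)
  case 0
  then show ?case unfolding ideal_pow_0[OF I] ideal_pow_0[OF J] by (intro exI[of _ 0]) simp
next
  case (Suc N)
  note JS = ideal_ideal_pow[OF J, of "Suc N"]
  from Suc.prems have "f \<in> ideal_prod (poly_ring V) (ideal_pow V I N) I"
    by (simp only: ideal_pow_Suc[OF I])
  then show ?case
  proof induction
    case (prod i j)
    obtain m where m: "\<Delta> ^ m * i \<in> ideal_pow V J N" using Suc.IH[OF prod(1)] by blast
    obtain n where n: "\<Delta> ^ n * j \<in> ideal_pow V J 1" using loc[OF prod(2)] ideal_pow_1[OF J] by auto
    have "\<Delta> ^ (m + n) * (i * j) = (\<Delta> ^ m * i) * (\<Delta> ^ n * j)" by (simp add: power_add ac_simps)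
    also have "\<dots> \<in> ideal_pow V J (N + 1)" by (rule ideal_pow_mult_mem[OF J m n])
    finally show ?case unfolding poly_ring_simps(2) by auto
  next
    case (sum f g)
    then obtain m n where "\<Delta> ^ m * f \<in> ideal_pow V J (Suc N)" "\<Delta> ^ n * g \<in> ideal_pow V J (Suc N)"
      by blast
    from ideal_poly_add[OF JS ideal_poly_mult[OF JS pcarrier_closed(7)[OF \<Delta>] this(1)]
        ideal_poly_mult[OF JS pcarrier_closed(7)[OF \<Delta>] this(2)]]
    have "\<Delta> ^ n * (\<Delta> ^ m * f) + \<Delta> ^ m * (\<Delta> ^ n * g) \<in> ideal_pow V J (Suc N)" .
    also have "\<Delta> ^ n * (\<Delta> ^ m * f) + \<Delta> ^ m * (\<Delta> ^ n * g) = \<Delta> ^ (m + n) * (f + g)"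
      by (simp add: power_add algebra_simps)
    finally show ?case unfolding poly_ring_simps(3) by blast
  qed
qed

lemma minimal_primes_primeideal:
  assumes "primeideal I R"
  shows "minimal_primes R I = {I}"
  unfolding minimal_primes_def using assms by blast

text \<open>By the pigeonhole principle, a power of the form \<open>\<Phi>\<close> of sufficiently high order along \<open>I\<close>
  moves \<open>I^(np+1)\<close> into the Frobenius power of \<open>I^(n+1)\<close>, at least after inverting \<open>\<Delta>\<close>, and the
  trace turns Frobenius powers back into ordinary powers.\<close>

lemma symbolic_F_splitI:
  fixes I :: "('v, 'k::field) mpoly set" and g :: "'i \<Rightarrow> ('v, 'k) mpoly"
  assumes char: "CHAR('k) > 0" and V: "finite V"
    and hom: "homogeneous_ideal V I" and prime: "primeideal I (poly_ring V)"
    and X: "finite X" "\<And>x. x \<in> X \<Longrightarrow> g x \<in> I"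
    and \<Delta>: "\<Delta> \<in> pcarrier V" "\<Delta> \<notin> I"
    and loc: "\<And>f. f \<in> I \<Longrightarrow> \<exists>n. \<Delta> ^ n * f \<in> ideal_span V (g ` X)"
    and \<Phi>: "\<Phi> \<in> pcarrier V" "\<Delta> ^ k * \<Phi> \<in> ideal_pow V I (card X)"
    and lead: "leads \<omega> \<Phi> (\<Sum>x\<in>V. single x 1) a" "a \<noteq> 0"
    and deg: "\<And>m. m \<in> keys \<Phi> \<Longrightarrow> monom_degree m = card V"
  shows "symbolic_F_split V I"
proof -
  define p where "p = CHAR('k)"
  have p: "p = CHAR('k)" "0 < p" using char by (simp_all add: p_def)
  obtain \<pi> :: "'k \<Rightarrow> 'k" where \<pi>: "\<And>a b. \<pi> (a + b) = \<pi> a + \<pi> b"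
    "\<And>a b. \<pi> (a ^ p * b) = a * \<pi> b" "\<pi> 1 = 1"
    using frobenius_functional_exists[OF char] unfolding p_def by blast
  note ctx = V p \<pi>
  interpret I: primeideal I "poly_ring V" by (rule prime)
  have I: "ideal I (poly_ring V)" by (rule I.ideal_axioms)
  have gI: "g ` X \<subseteq> I" using X(2) by blast
  have gV: "g x \<in> pcarrier V" if "x \<in> X" for x using ideal_poly_carrier[OF I X(2)[OF that]] .
  define J where "J = ideal_span V (g ` X)"
  have J: "ideal J (poly_ring V)" unfolding J_def using gV by (intro ideal_ideal_span) blast
  have JI: "J \<subseteq> I" unfolding J_def by (rule ideal_span_subset[OF I gI])
  have mult_notin: "f * h \<notin> I" if "f \<in> pcarrier V" "h \<in> pcarrier V" "f \<notin> I" "h \<notin> I" for f h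
    using I.I_prime[OF that(1,2)] that(3,4) unfolding poly_ring_simps(2) by blast
  have one_notin: "1 \<notin> I"
    using I.I_notcarr I.one_imp_carrier unfolding poly_ring_simps(4) by blast
  have pow_notin: "\<Delta> ^ n \<notin> I" for n
  proof (induction n)
    case (Suc n)
    show ?case unfolding power_Suc by (rule mult_notin[OF \<Delta>(1) pcarrier_closed(7)[OF \<Delta>(1)] \<Delta>(2)
      Suc])
  qed (simp add: one_notin)
  define G where "G = \<Phi> ^ (p - 1)"
  have G: "G \<in> pcarrier V" unfolding G_def by (rule pcarrier_closed(7)[OF \<Phi>(1)])
  \<comment> \<open>The coefficient of the monomial with all exponents \<open>p - 1\<close>. Leading
    terms multiply, so it is a power of \<open>a\<close>.\<close>
  define \<mu> where "\<mu> = lookup G (trace_exponent V p 0)"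
  have "\<mu> \<noteq> 0"
  proof -
    have "leads \<omega> (\<Prod>i<p - 1. \<Phi>) (\<Sum>i<p - 1. \<Sum>x\<in>V. single x 1) (\<Prod>i<p - 1. a)"
      by (rule leads_prod[OF lead(1)])
    moreover have "(\<Sum>i<p - 1. \<Sum>x\<in>V. single x 1) = trace_exponent V p 0"
      by (rule poly_mapping_eqI)
        (simp add: lookup_sum lookup_single when_def lookup_trace_exponent[OF ctx] V)
    ultimately show ?thesis using lead(2) by (simp add: G_def \<mu>_def leads_def)
  qed
  have degG: "monom_degree m = card V * (p - 1)" if "m \<in> keys G" for m
  proof -
    have "monom_degree m = card V * n" if "m \<in> keys (\<Phi> ^ n)" for n
      using that
    proof (induction n arbitrary: m)
      case (Suc n)
      then obtain x y where "m = x + y" "x \<in> keys \<Phi>" "y \<in> keys (\<Phi> ^ n)"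
        using keys_mult[of \<Phi> "\<Phi> ^ n"] by auto
      then show ?case using Suc.IH[of y] deg[of x] by (simp add: monom_degree_eq_weight)
    qed (simp add: monom_degree_def)
    then show ?thesis using that by (simp add: G_def)
  qed
  define c where "c = single (0 :: 'v \<Rightarrow>\<^sub>0 nat) (inverse \<mu>)"
  define T where "T f = trace V \<pi> p (c * G * f)" for f
  have T1: "trace V \<pi> p (c * G) = 1"
    unfolding c_def using trace_power_eq_1[OF ctx degG _ \<open>\<mu> \<noteq> 0\<close>] by (simp add: \<mu>_def)
  have T_add: "T (f + h) = T f + T h" for f h
    unfolding T_def distrib_left by (rule trace_add[OF ctx])
  have T_mult: "T (r ^ p * f) = r * T f" if "r \<in> pcarrier V" for r f
    unfolding T_def using trace_power_mult[OF ctx that, of "c * G * f"] by (simp only: ac_simps)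
  have T_power: "T (r ^ p) = r" if "r \<in> pcarrier V" for r
    using T_mult[OF that, of 1] T1 by (simp add: T_def)
  have T_carrier: "T f \<in> pcarrier V" for f
    unfolding T_def by (rule trace_in_pcarrier[OF ctx])
  define \<phi> where "\<phi> x = T (radicand x)" for x
  have split: "root_splitting p (poly_ring V) \<phi>"
    unfolding root_splitting_def
  proof (intro conjI ballI)
    show "\<phi> \<in> hom (add_monoid (root_ring (poly_ring V))) (add_monoid (poly_ring V))"
    proof (rule homI)
      show "\<phi> x \<in> carrier (add_monoid (poly_ring V))" for x
        using T_carrier by (simp add: \<phi>_def del: poly_ring_simps)
      fix x y assume "x \<in> carrier (add_monoid (root_ring (poly_ring V :: ('v, 'k) mpoly ring)))"
        "y \<in> carrier (add_monoid (root_ring (poly_ring V :: ('v, 'k) mpoly ring)))"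
      then show "\<phi> (x \<otimes>\<^bsub>add_monoid (root_ring (poly_ring V))\<^esub> y)
        = \<phi> x \<otimes>\<^bsub>add_monoid (poly_ring V)\<^esub> \<phi> y"
        by (simp add: \<phi>_def root_ring_def T_add)
    qed
    fix r :: "('v, 'k) mpoly" assume r: "r \<in> pcarrier V"
    show "\<phi> (root_incl p (poly_ring V) r) = r"
      using T_power[OF r] by (simp add: \<phi>_def root_incl_def)
    show "\<phi> (root_incl p (poly_ring V) r \<otimes>\<^bsub>root_ring (poly_ring V)\<^esub> x) = r \<otimes>\<^bsub>poly_ring V\<^esub> \<phi> x" for x
      using T_mult[OF r] by (simp add: \<phi>_def root_incl_def root_ring_def)
  qed
  have sym: "symbolic_power (poly_ring V) I n = {f \<in> pcarrier V. \<exists>s \<in> pcarrier V - I. s *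
    f \<in> ideal_pow V I n}" for n
    unfolding symbolic_power_def minimal_primes_primeideal[OF prime] poly_ring_simps(2) by simp
  have span: "trace V \<pi> p (h * w) \<in> ideal_pow V J n"
    if "w \<in> ideal_span V ((\<lambda>z. z ^ p) ` ideal_pow V J n)" for h w n
    using that
  proof induction
    case zero
    have "trace V \<pi> p 0 = 0" by (rule poly_mapping_eqI) (simp add: lookup_trace[OF ctx]
      functional_zero[OF ctx])
    then show ?case using ideal_poly_zero[OF ideal_ideal_pow[OF J]] by simp
  next
    case (step u t f)
    then obtain z where z: "t = z ^ p" "z \<in> ideal_pow V J n" by blast
    have "trace V \<pi> p (h * (u * t + f)) = trace V \<pi> p (z ^ p * (h * u)) + trace V \<pi> p (h * f)"
      by (simp add: z(1) distrib_left ac_simps flip: trace_add[OF ctx])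
    also have "trace V \<pi> p (z ^ p * (h * u)) = trace V \<pi> p (h * u) * z"
      by (subst trace_power_mult[OF ctx ideal_poly_carrier[OF ideal_ideal_pow[OF J] z(2)]]) (rule
        mult.commute)
    finally show ?case
      using ideal_poly_add[OF ideal_ideal_pow[OF J]
          ideal_poly_mult[OF ideal_ideal_pow[OF J] trace_in_pcarrier[OF ctx] z(2)] step(4)] by simp
  qed
  have "T f \<in> symbolic_power (poly_ring V) I (n + 1)"
    if f: "f \<in> symbolic_power (poly_ring V) I (n * p + 1)" for f n
  proof -
    obtain s where s: "s \<in> pcarrier V" "s \<notin> I" "s * f \<in> ideal_pow V I (n * p + 1)"
      using f unfolding sym by blast
    \<comment> \<open>The order \<open>n * p + 1\<close> of \<open>s * f\<close> plus the order
      gained from the power of \<open>\<Phi>\<close>: exactly what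
      \<open>ideal_pow_subset_frobenius_power\<close> consumes.\<close>
    let ?N = "n * p + 1 + card X * (p - 1)"
    have "(\<Delta> ^ k * \<Phi>) ^ (p - 1) \<in> ideal_pow V I (card X * (p - 1))"
      by (rule ideal_pow_power_mem[OF I \<Phi>(2)])
    from ideal_pow_mult_mem[OF I s(3) this]
    have "(s * f) * (\<Delta> ^ k * \<Phi>) ^ (p - 1) \<in> ideal_pow V I ?N" .
    from ideal_pow_localized[OF I J \<Delta>(1) _ this] loc
    obtain K where K: "\<Delta> ^ K * ((s * f) * (\<Delta> ^ k * \<Phi>) ^ (p - 1)) \<in> ideal_pow V J ?N"
      unfolding J_def by blast
    \<comment> \<open>All denominators collected in one element, which stays outside
      \<open>I\<close> because \<open>I\<close> is prime.\<close>
    define s' where "s' = \<Delta> ^ K * (\<Delta> ^ (k * (p - 1)) * s)"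
    note pow = pcarrier_closed(7)[OF \<Delta>(1)]
    have s': "s' \<in> pcarrier V"
      unfolding s'_def by (rule pcarrier_closed(5)[OF pow pcarrier_closed(5)[OF pow s(1)]])
    have s'_notin: "s' \<notin> I"
      unfolding s'_def
      by (rule mult_notin[OF pow pcarrier_closed(5)[OF pow s(1)] pow_notin mult_notin[OF pow s(1)
        pow_notin s(2)]])
    have "\<Delta> ^ K * ((s * f) * (\<Delta> ^ k * \<Phi>) ^ (p - 1)) = s' * (G * f)"
      by (simp add: s'_def G_def power_mult_distrib power_mult ac_simps)
    then have "s' * (G * f) \<in> ideal_span V ((\<lambda>z. z ^ p) ` ideal_pow V J (n + 1))"
      using K ideal_pow_subset_frobenius_power[where g = g and V = V and n = n, OF X(1) gV p(2)]
        unfolding J_def by auto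
    \<comment> \<open>The factor \<open>s' ^ (p - 1)\<close> completes \<open>s'\<close> to
      \<open>s' ^ p\<close>, which leaves the trace as \<open>s'\<close> and becomes the denominator
      for \<open>T f\<close>.\<close>
    from span[OF this, of "c * s' ^ (p - 1)"]
    have "trace V \<pi> p (c * s' ^ (p - 1) * (s' * (G * f))) \<in> ideal_pow V J (n + 1)" .
    also have "c * s' ^ (p - 1) * (s' * (G * f)) = c * G * (s' ^ p * f)"
      using power_minus_mult[OF p(2), of s'] by (simp add: ac_simps)
    also have "trace V \<pi> p (c * G * (s' ^ p * f)) = s' * T f"
      using T_mult[OF s', of f] by (simp add: T_def)
    finally have "s' * T f \<in> ideal_pow V I (n + 1)" using ideal_pow_mono[OF J I JI] by blast
    then show ?thesis unfolding sym using s' s'_notin T_carrier by blast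
  qed
  then have "\<phi> ` (PRoot ` symbolic_power (poly_ring V) I (n * p + 1))
    \<subseteq> symbolic_power (poly_ring V) I (n + 1)" for n
    by (auto simp: \<phi>_def)
  then show ?thesis
    unfolding symbolic_F_split_def using hom split unfolding p_def by blast
qed

section \<open>Symbolic F-splitting of the ladder ideal\<close>

context ladder_data
begin

lemma homogeneous_ladder_ideal:
  "homogeneous_ideal L (ladder_ideal :: 'k::field cell_poly set)"
proof -
  let ?H = "{f \<in> ladder_ideal. homogeneous f} :: 'k cell_poly set"
  have H: "?H \<subseteq> pcarrier L" using ideal_poly_carrier[OF ideal_ladder_ideal] by blast
  have "minors \<subseteq> ?H"
  proof
    fix f :: "'k cell_poly" assume f: "f \<in> minors"
    then obtain A B where AB: "f = generic_minor A B" "card A = card B"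
      unfolding minors_def minor_supports_def by auto
    then have "homogeneous f" unfolding homogeneous_def using degree_generic_minor by blast
    moreover have "f \<in> ladder_ideal" using f unfolding ladder_ideal_def
      by (rule ideal_span_generator)
    ultimately show "f \<in> ?H" by blast
  qed
  then have "ladder_ideal \<subseteq> ideal_span L ?H"
    unfolding ladder_ideal_def
    by (intro ideal_span_subset[OF ideal_ideal_span[OF H[unfolded ladder_ideal_def]]])
      (auto intro!: ideal_span_generator simp: ladder_ideal_def[symmetric])
  moreover have "ideal_span L ?H \<subseteq> ladder_ideal" by (intro ideal_span_subset[OF ideal_ladder_ideal])
    blast
  ultimately show ?thesis
    unfolding homogeneous_ideal_def genideal_eq_ideal_span[OF H] using ideal_ladder_ideal by blast
qed

lemma symbolic_F_split_ladder_ideal: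
  assumes "CHAR('k::field) > 0"
  shows "symbolic_F_split L (ladder_ideal :: 'k cell_poly set)"
proof -
  obtain k where k: "corner_product ^ k * splitting_form
      \<in> ideal_pow L (ladder_ideal :: 'k cell_poly set) (card (L - free_cells))"
    using splitting_form_in_ideal_pow by blast
  obtain \<omega> where \<omega>: "good_weight \<omega>" using good_weight_exists[OF finite_L] by metis
  obtain a :: 'k where a: "leads \<omega> splitting_form (\<Sum>x\<in>L. single x 1) a" "a \<noteq> 0"
    using splitting_form_leads[OF \<omega>] .
  show ?thesis
  proof (rule symbolic_F_splitI[OF assms finite_L homogeneous_ladder_ideal primeideal_ladder_ideal _
        solved_minor_in_ladder_ideal corner_product_in_pcarrier_L corner_product_notin_ladder_ideal
          _ _ k a
        degree_splitting_form])
    show "finite (L - free_cells)" using finite_L by simp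
    show "\<exists>n. corner_product ^ n * f \<in> ideal_span L (solved_minor ` (L - free_cells))"
      if "f \<in> ladder_ideal" for f :: "'k cell_poly"
      using ladder_ideal_locally_solved[OF that] unfolding solved_ideal_def by blast
    show "splitting_form \<in> (pcarrier L :: 'k cell_poly set)"
      unfolding splitting_form_def
      by (intro subring_set_prod[OF subring_set_pcarrier] line_minor_in_pcarrier)
  qed
qed

end

section \<open>Mixed ladder determinantal ideals\<close>

lemma generic_minors_subset:
  assumes "L' \<subseteq> L"
  shows "{generic_minor A B | A B. (A, B) \<in> minor_supports t L'}
    \<subseteq> (pcarrier L :: 'k::field cell_poly set)"
proof
  fix f :: "'k cell_poly"
  assume "f \<in> {generic_minor A B | A B. (A, B) \<in> minor_supports t L'}"
  then obtain A B where "f = generic_minor A B" "card A = card B" "A \<times> B \<subseteq> L'"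
    unfolding minor_supports_def by auto
  then show "f \<in> pcarrier L" using generic_minor_in_pcarrier[of A B L] assms by blast
qed

lemma minor_ideal_eq:
  "L' \<subseteq> L \<Longrightarrow> minor_ideal L t L'
    = (ideal_span L {generic_minor A B | A B. (A, B) \<in> minor_supports t L'} :: 'k::field cell_poly
      set)"
  unfolding minor_ideal_def by (rule genideal_eq_ideal_span[OF generic_minors_subset])

text \<open>At most \<open>c h' - c h\<close> columns of a minor in the first subladder lie left of
  column \<open>c h'\<close>. At least \<open>t'\<close> columns remain, and expanding along the
  others leads to minors of the second subladder. The contrapositive yields
  \<open>c_t\<close>.\<close>

lemma minor_ideal_subset_columns:
  assumes L: "subladder L d c h \<subseteq> L" "subladder L d c h' \<subseteq> L"
    and "d h \<le> d h'" "c h \<le> c h'" "0 < t" "c h' + t' \<le> c h + t"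
  shows "minor_ideal L t (subladder L d c h)
    \<subseteq> (minor_ideal L t' (subladder L d c h') :: 'k::field cell_poly set)"
proof -
  let ?J = "minor_ideal L t' (subladder L d c h') :: 'k cell_poly set"
  have J: "ideal ?J (poly_ring L)"
    unfolding minor_ideal_eq[OF L(2)] by (rule ideal_ideal_span[OF generic_minors_subset[OF L(2)]])
  have "generic_minor A B \<in> ?J" if AB: "(A, B) \<in> minor_supports t (subladder L d c h)" for A B
  proof -
    have card: "card A = t" "card B = t" and sub: "A \<times> B \<subseteq> subladder L d c h"
      using AB by (auto simp: minor_supports_def)
    then have fin: "finite A" "finite B" and ne: "A \<noteq> {}"
      using \<open>0 < t\<close> by (metis card.infinite less_irrefl, metis card.infinite less_irrefl, metis
        card.empty less_irrefl)
    have low: "c h \<le> b" if "b \<in> B" for b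
      using that ne sub unfolding subladder_def by blast
    have "B - {c h'..} \<subseteq> {c h..<c h'}" using low by auto
    then have "card (B - {c h'..}) \<le> c h' - c h" using card_mono[of "{c h..<c h'}"] by force
    moreover have "card B = card (B - {c h'..}) + card (B \<inter> {c h'..})"
      using fin by (metis Int_Diff_Un Int_Diff_disjoint Un_commute card_Un_disjoint finite_Diff
        finite_Int inf_commute)
    ultimately have "t' \<le> card (B \<inter> {c h'..})" using card assms by linarith
    then obtain B' where B': "B' \<subseteq> B \<inter> {c h'..}" "card B' = t'" by (metis obtain_subset_with_card_n)
    show ?thesis
    proof (rule generic_minor_in_ideal_columns[OF J fin])
      show "card A = card B" using card by simp
      show "A \<times> B \<subseteq> L" using sub L by blast
      show "B' \<subseteq> B" using B' by blast
      fix A' assume "A' \<subseteq> A" "card A' = card B'"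
      moreover have "A' \<times> B' \<subseteq> subladder L d c h'"
        using \<open>A' \<subseteq> A\<close> B' sub \<open>d h \<le> d h'\<close> unfolding subladder_def by fastforce
      ultimately have "(A', B') \<in> minor_supports t' (subladder L d c h')"
        using B' by (simp add: minor_supports_def)
      then show "generic_minor A' B' \<in> ?J"
        unfolding minor_ideal_eq[OF L(2)] by (intro ideal_span_generator) blast
    qed
  qed
  then show ?thesis
    unfolding minor_ideal_eq[OF L(1)] by (intro ideal_span_subset[OF J]) blast
qed

text \<open>At most \<open>d h' - d h\<close> rows of a minor in the second subladder lie below row
  \<open>d h\<close>, so \<open>t\<close> rows can be kept and the others expanded away. The
  contrapositive yields \<open>d_t\<close>.\<close>

lemma minor_ideal_subset_rows:
  assumes L: "subladder L d c h \<subseteq> L" "subladder L d c h' \<subseteq> L"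
    and "d h \<le> d h'" "c h \<le> c h'" "0 < t'" "d h' + t \<le> d h + t'"
  shows "minor_ideal L t' (subladder L d c h')
    \<subseteq> (minor_ideal L t (subladder L d c h) :: 'k::field cell_poly set)"
proof -
  let ?J = "minor_ideal L t (subladder L d c h) :: 'k cell_poly set"
  have J: "ideal ?J (poly_ring L)"
    unfolding minor_ideal_eq[OF L(1)] by (rule ideal_ideal_span[OF generic_minors_subset[OF L(1)]])
  have "generic_minor A B \<in> ?J" if AB: "(A, B) \<in> minor_supports t' (subladder L d c h')" for A B
  proof -
    have card: "card A = t'" "card B = t'" and sub: "A \<times> B \<subseteq> subladder L d c h'"
      using AB by (auto simp: minor_supports_def)
    then have fin: "finite A" "finite B" and ne: "B \<noteq> {}"
      using \<open>0 < t'\<close> by (metis card.infinite less_irrefl, metis card.infinite less_irrefl, metis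
        card.empty less_irrefl)
    have high: "a \<le> d h'" if "a \<in> A" for a
      using that ne sub unfolding subladder_def by blast
    have "A - {..d h} \<subseteq> {d h<..d h'}" using high by auto
    then have "card (A - {..d h}) \<le> d h' - d h" using card_mono[of "{d h<..d h'}"] by force
    moreover have "card A = card (A - {..d h}) + card (A \<inter> {..d h})"
      using fin by (metis Int_Diff_Un Int_Diff_disjoint Un_commute card_Un_disjoint finite_Diff
        finite_Int inf_commute)
    ultimately have "t \<le> card (A \<inter> {..d h})" using card assms by linarith
    then obtain A' where A': "A' \<subseteq> A \<inter> {..d h}" "card A' = t" by (metis obtain_subset_with_card_n)
    show ?thesis
    proof (rule generic_minor_in_ideal_rows[OF J fin])
      show "card A = card B" using card by simp
      show "A \<times> B \<subseteq> L" using sub L by blast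
      show "A' \<subseteq> A" using A' by blast
      fix B' assume "B' \<subseteq> B" "card A' = card B'"
      moreover have "A' \<times> B' \<subseteq> subladder L d c h"
        using \<open>B' \<subseteq> B\<close> A' sub \<open>c h \<le> c h'\<close> unfolding subladder_def by fastforce
      ultimately have "(A', B') \<in> minor_supports t (subladder L d c h)"
        using A' by (simp add: minor_supports_def)
      then show "generic_minor A' B' \<in> ?J"
        unfolding minor_ideal_eq[OF L(1)] by (intro ideal_span_generator) blast
    qed
  qed
  then show ?thesis
    unfolding minor_ideal_eq[OF L(2)] by (intro ideal_span_subset[OF J]) blast
qed

theorem theorem4p2:
  fixes k l u v :: nat
    and L :: "(nat \<times> nat) set"
    and b a d c t :: "nat \<Rightarrow> nat"
  assumes "CHAR('k::field) > 0"
    and "F_finite TYPE('k)"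
    and "ladder k l L"
    and "upper_corners l L u b a"
    and "lower_corners k L v d c"
    and "distinct_corners u b a v d c"
    and "\<And>j. j \<in> {1..v} \<Longrightarrow> 0 < t j"
    and entries_involved: "\<And>i w. (i, w) \<in> L \<Longrightarrow>
          \<exists>j \<in> {1..v}. \<exists>(A, B) \<in> minor_supports (t j) (subladder L d c j). i \<in> A \<and> w \<in> B"
    and no_inclusions: "\<And>i j. i \<in> {1..v} \<Longrightarrow> j \<in> {1..v} \<Longrightarrow> i \<noteq> j \<Longrightarrow>
          \<not> (minor_ideal L (t i) (subladder L d c i) :: (nat \<times> nat, 'k) mpoly set)
              \<subseteq> minor_ideal L (t j) (subladder L d c j)"
    and no_smaller_matrix: "\<And>A B. A \<subseteq> {1..k} \<Longrightarrow> B \<subseteq> {1..l} \<Longrightarrow> L \<subseteq> A \<times> B \<Longrightarrow>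
          A = {1..k} \<and> B = {1..l}"
  shows "symbolic_F_split L (mixed_ladder_ideal L v d c t :: (nat \<times> nat, 'k) mpoly set)"
proof -
  have L: "L \<subseteq> {1..k} \<times> {1..l}"
    and box: "\<And>i j i' j'. (i, j) \<in> L \<Longrightarrow> (i', j') \<in> L \<Longrightarrow> i \<le> i' \<Longrightarrow> j' \<le> j \<Longrightarrow> {i..i'} \<times> {j'..j} \<subseteq> L"
    using \<open>ladder k l L\<close> unfolding ladder_def by blast+
  have rect: "(x, y) \<in> L"
    if "(i, j) \<in> L" "(i', j') \<in> L" "i \<le> x" "x \<le> i'" "j' \<le> y" "y \<le> j" for i j i' j' x y
    using box[OF that(1,2)] that(3-6) by auto
  have corner: "(d h, c h) \<in> L" "(d h + 1, c h) \<notin> L \<or> (d h, c h - 1) \<notin> L" if "h \<in> {1..v}" for h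
    using \<open>lower_corners k L v d c\<close> that unfolding lower_corners_def by blast+
  have mono: "d h \<le> d h'" "c h \<le> c h'" if "h \<in> {1..v}" "h' \<in> {1..v}" "h \<le> h'" for h h'
  proof -
    have "mono_on {1..v} d" "mono_on {1..v} c"
      using \<open>lower_corners k L v d c\<close> unfolding lower_corners_def by blast+
    then show "d h \<le> d h'" "c h \<le> c h'" using that by (blast intro: mono_onD)+
  qed
  have sub: "subladder L d c h \<subseteq> L" for h by (auto simp: subladder_def)
  \<comment> \<open>Without \<open>t h\<close>-minors the ideal of \<open>h\<close> would be zero
    and thus contained in the ideal of any other corner. If \<open>h\<close> is the only corner, a
    minor involving the entry at the corner does the job.\<close>
  have supports: "\<exists>A B. (A, B) \<in> minor_supports (t h) (subladder L d c h)" if h: "h \<in> {1..v}" for h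
  proof (cases "v = 1")
    case True
    then have "{1..v} = {h}" using h by auto
    then show ?thesis using entries_involved[of "d h" "c h"] corner(1)[OF h] by auto
  next
    case False
    obtain h' where h': "h' \<in> {1..v}" "h \<noteq> h'"
      using False h by (cases "h = 1") (auto intro: that[of 1] that[of v])
    show ?thesis
    proof (rule ccontr)
      assume "\<not> ?thesis"
      then have "{generic_minor A B | A B. (A, B) \<in> minor_supports (t h) (subladder L d c h)}
          = ({} :: 'k cell_poly set)" by blast
      moreover have "ideal_span L {} \<subseteq> (minor_ideal L (t h') (subladder L d c h') :: 'k cell_poly
        set)"
        unfolding minor_ideal_eq[OF sub]
        by (rule ideal_span_subset[OF ideal_ideal_span[OF generic_minors_subset[OF sub]]]) simp
      ultimately show False
        using no_inclusions[OF h h'] minor_ideal_eq[OF sub, of "t h" h, where 'k = 'k] by simp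
    qed
  qed
  interpret ladder_data L v d c t
  proof
    show "finite L" using L by (rule finite_subset) simp
    show "\<exists>h\<in>{1..v}. x \<in> subladder L d c h" if "x \<in> L" for x
    proof -
      obtain i j where x: "x = (i, j)" by (cases x)
      from entries_involved[of i j] that x obtain h A B where "h \<in> {1..v}"
        "(A, B) \<in> minor_supports (t h) (subladder L d c h)" "i \<in> A" "j \<in> B" by auto
      then show ?thesis unfolding x minor_supports_def by blast
    qed
    fix h assume h: "h \<in> {1..v}"
    show "0 < t h" using h by (rule assms)
    obtain A B where AB: "card A = t h" "card B = t h" "A \<times> B \<subseteq> subladder L d c h"
      using supports[OF h] unfolding minor_supports_def by auto
    \<comment> \<open>The top right cell of a \<open>t h\<close>-minor lies at least
      \<open>t h - 1\<close> rows above row \<open>d h\<close> and as many columns right of column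
      \<open>c h\<close>. The cell demanded by \<open>top\<close> is in the rectangle between it and
      the corner.\<close>
    define i j where "i = sl A ! 0" and "j = sl B ! (t h - 1)"
    have "i \<in> A" "j \<in> B" "sl A ! (t h - 1) \<in> A" "sl B ! 0 \<in> B"
      using AB \<open>0 < t h\<close> unfolding i_def j_def by (auto intro: sl_nth_in)
    then have ij: "(i, j) \<in> L" "sl A ! (t h - 1) \<le> d h" "c h \<le> sl B ! 0"
      using AB(3) by (auto simp: subladder_def)
    have "i + (t h - 1) \<le> sl A ! (t h - 1)" "sl B ! 0 + (t h - 1) \<le> j"
      using sl_nth_ge[of 0 "t h - 1" A] sl_nth_ge[of 0 "t h - 1" B] AB(1,2) \<open>0 < t h\<close>
      by (simp_all add: i_def j_def)
    moreover have "1 \<le> i" using ij(1) L by auto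
    ultimately show "t h \<le> d h \<and> (d h + 1 - t h, c h + t h - 1) \<in> L"
      using ij \<open>0 < t h\<close> by (auto intro: rect[OF ij(1) corner(1)[OF h]])
    fix h' assume h': "h' \<in> {1..v}" and "h < h'"
    note dc = mono[OF h h' less_imp_le[OF \<open>h < h'\<close>]]
    \<comment> \<open>If this failed, the ideal of the later subladder would be contained in that of
      the earlier one; for the column inequality below the roles are exchanged.\<close>
    show "d h + t h' < d h' + t h"
    proof (rule ccontr)
      assume "\<not> d h + t h' < d h' + t h"
      then show False
        using minor_ideal_subset_rows[OF sub sub dc, of "t h'" "t h", where 'k = 'k] assms(7)[OF h']
          no_inclusions[OF h' h] \<open>h < h'\<close> by simp
    qed
    show "c h + t h < c h' + t h'"
    proof (rule ccontr)
      assume "\<not> c h + t h < c h' + t h'"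
      then show False
        using minor_ideal_subset_columns[OF sub sub dc, of "t h" "t h'", where 'k = 'k]
          assms(7)[OF h]
          no_inclusions[OF h h'] \<open>h < h'\<close> by simp
    qed
  qed (use rect corner mono in blast)+
  have "mixed_ladder_ideal L v d c t = (ladder_ideal :: 'k cell_poly set)"
    unfolding mixed_ladder_ideal_def ladder_ideal_def minors_def minor_ideal_eq[OF sub]
    by (rule finsum_ideal_span) (simp, rule generic_minors_subset[OF sub])
  then show ?thesis using symbolic_F_split_ladder_ideal[OF assms(1)] by simp
qed

end
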